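(* Let $F$ be a self-affine carpet (as defined in the context) of horizontal type or of vertical type. Then either \[ \dim_{\mathrm L}F<\dim_{\mathrm H}F<\dim_{\mathrm B}F<\dim_{\mathrm A}F \] or \[ \dim_{\mathrm L}F=\dim_{\mathrm H}F=\dim_{\mathrm B}F=\dim_{\mathrm A}F. \]
   Context: Self-affine carpets. Two classes of finite iterated function systems (IFS) on $[0,1]^2$ are considered. Extended Lalley–Gatzouras class: divide $[0,1]^2$ into columns by a finite positive number of vertical lines; divide each column independently into rectangles by horizontal slices; select a subset of the resulting rectangles, subject only to the requirement that each selected rectangle has base length greater than or equal to its height. Barański class: divide $[0,1]^2$ into a grid of rectangles by a finite number of full vertical lines and full horizontal lines (at least one in each direction); select any subset of the resulting rectangles. In both cases, for each selected rectangle include in the IFS the orientation-preserving map $S_i(x,y)=(c_ix,d_iy)+(a_i,b_i)$ taking $[0,1]^2$ onto that rectangle; thus $c_i,d_i\in(0,1)$ are its base length and height. The index set is $\mathcal I$, finite with $|\mathcal I|\geq2$. The attractor is the unique non-empty compact $F$ with $F=\bigcup_{i\in\mathcal I}S_i(F)$. $F$ is called a self-affine carpet if it is the attractor of an IFS in one of these two classes with at least one map that is not a similarity (i.e. $c_i\neq d_i$ for some $i$). $F$ is of horizontal type if $c_i\geq d_i$ for all $i$; of vertical type if $c_i\leq d_i$ for all $i$. $\dim_{\mathrm H}$ and $\dim_{\mathrm B}$ are Hausdorff and box dimension. With $N_r(E)$ the smallest number of open sets of diameter at most $r$ needed to cover $E$ and $B(x,R)$ the closed ball, \[ \dim_{\mathrm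 A}F=\inf\Big\{\alpha:\ \exists\, C,\rho>0 \text{ such that for all } 0<r<R\leq\rho,\ \sup_{x\in F}N_r(B(x,R)\cap F)\leq C (R/r)^{\alpha}\Big\}, \] \[ \dim_{\mathrm L}F=\sup\Big\{\alpha:\ \exists\, C,\rho>0 \text{ such that for all } 0<r<R\leq\rho,\ \inf_{x\in F}N_r(B(x,R)\cap F)\geq C (R/r)^{\alpha}\Big\}. \] *)

theory Defs
  imports "HOL-Analysis.Analysis"
begin

text \<open>
  The plane is \<open>real \<times> real\<close>, whose library metric is the Euclidean one.
  The library's \<open>diameter\<close> is real-valued and unspecified on unbounded sets, so every
  covering set below is also required to be \<open>bounded\<close>.
\<close>

section \<open>Dimensions of subsets of the plane\<close>

definition covering_number :: "real \<Rightarrow> (real \<times> real) set \<Rightarrow> nat" where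
  "covering_number r E =
     Inf {card \<U> | \<U>. finite \<U> \<and> E \<subseteq> \<Union>\<U> \<and> (\<forall>U\<in>\<U>. open U \<and> bounded U \<and> diameter U \<le> r)}"

text \<open>The suprema and infima over \<open>x \<in> F\<close> are taken in \<open>ereal\<close>, a complete lattice.\<close>

definition assouad_dim :: "(real \<times> real) set \<Rightarrow> real" where
  "assouad_dim F =
     Inf {\<alpha>. \<exists>C>0. \<exists>\<rho>>0. \<forall>r R. 0 < r \<and> r < R \<and> R \<le> \<rho> \<longrightarrow>
            (SUP x\<in>F. ereal (covering_number r (cball x R \<inter> F))) \<le> ereal (C * (R / r) powr \<alpha>)}"

definition lower_dim :: "(real \<times> real) set \<Rightarrow> real" where
  "lower_dim F =
     Sup {\<alpha>. \<exists>C>0. \<exists>\<rho>>0. \<forall>r R. 0 < r \<and> r < R \<and> R \<le> \<rho> \<longrightarrow>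
            (INF x\<in>F. ereal (covering_number r (cball x R \<inter> F))) \<ge> ereal (C * (R / r) powr \<alpha>)}"

definition box_dim_exists :: "(real \<times> real) set \<Rightarrow> bool" where
  "box_dim_exists F \<longleftrightarrow>
     (\<exists>b. ((\<lambda>r. ln (real (covering_number r F)) / (- ln r)) \<longlongrightarrow> b) (at_right 0))"

text \<open>Meaningful only if \<open>box_dim_exists F\<close>: \<open>Lim\<close> is unspecified when there is no limit.\<close>

definition box_dim :: "(real \<times> real) set \<Rightarrow> real" where
  "box_dim F = Lim (at_right 0) (\<lambda>r. ln (real (covering_number r F)) / (- ln r))"

definition hausdorff_pre_measure :: "real \<Rightarrow> real \<Rightarrow> (real \<times> real) set \<Rightarrow> ennreal" where
  "hausdorff_pre_measure s \<delta> E =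
     (INF U \<in> {U :: nat \<Rightarrow> (real \<times> real) set.
                 E \<subseteq> (\<Union>i. U i) \<and> (\<forall>i. bounded (U i) \<and> diameter (U i) \<le> \<delta>)}.
        \<Sum>i. ennreal (diameter (U i) powr s))"

definition hausdorff_measure :: "real \<Rightarrow> (real \<times> real) set \<Rightarrow> ennreal" where
  "hausdorff_measure s E = (SUP \<delta>\<in>{0<..}. hausdorff_pre_measure s \<delta> E)"

text \<open>
  Only exponents \<open>s > 0\<close> are used, since \<open>0 powr 0 = 0\<close> makes \<open>hausdorff_measure 0\<close> differ
  from counting measure; leaving out \<open>s = 0\<close> does not change the infimum.
\<close>

definition hausdorff_dim :: "(real \<times> real) set \<Rightarrow> real" where
  "hausdorff_dim E = Inf {s. s > 0 \<and> hausdorff_measure s E = 0}"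

section \<open>Self-affine carpets\<close>

text \<open>
  A map \<open>(x, y) \<mapsto> (c x + a, d y + b)\<close> is encoded by the rectangle onto which it takes the unit
  square: lower left corner \<open>(a, b)\<close>, base length \<open>c\<close>, height \<open>d\<close>. An iterated function system
  is a set of rectangles.
\<close>

datatype rect = Rect (left: real) (bottom: real) (base: real) (height: real)

definition rect_map :: "rect \<Rightarrow> real \<times> real \<Rightarrow> real \<times> real" where
  "rect_map q = (\<lambda>(x, y). (base q * x + left q, height q * y + bottom q))"

definition attractor :: "rect set \<Rightarrow> (real \<times> real) set \<Rightarrow> bool" where
  "attractor I F \<longleftrightarrow> F \<noteq> {} \<and> compact F \<and> F = (\<Union>q\<in>I. rect_map q ` F)"

text \<open>The \<open>m - 1\<close> points \<open>t 1 < \<dots> < t (m - 1)\<close> divide the unit interval into \<open>m\<close> pieces.\<close>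

definition subdivision :: "nat \<Rightarrow> (nat \<Rightarrow> real) \<Rightarrow> bool" where
  "subdivision m t \<longleftrightarrow> m \<ge> 1 \<and> t 0 = 0 \<and> t m = 1 \<and> (\<forall>j<m. t j < t (Suc j))"

text \<open>
  At least one vertical line means at least two columns. Column \<open>j\<close> is sliced at the heights
  \<open>y j\<close>; a column left unsliced has height 1 and cannot contribute, by the last condition.
\<close>

definition extended_lalley_gatzouras :: "rect set \<Rightarrow> bool" where
  "extended_lalley_gatzouras I \<longleftrightarrow>
     (\<exists>m x n y. m \<ge> 2 \<and> subdivision m x \<and> (\<forall>j<m. subdivision (n j) (y j)) \<and>
        I \<subseteq> {Rect (x j) (y j k) (x (Suc j) - x j) (y j (Suc k) - y j k) | j k. j < m \<and> k < n j}) \<and>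
     (\<forall>q\<in>I. base q \<ge> height q)"

definition baranski :: "rect set \<Rightarrow> bool" where
  "baranski I \<longleftrightarrow>
     (\<exists>m x n y. m \<ge> 2 \<and> subdivision m x \<and> n \<ge> 2 \<and> subdivision n y \<and>
        I \<subseteq> {Rect (x j) (y k) (x (Suc j) - x j) (y (Suc k) - y k) | j k. j < m \<and> k < n})"

definition self_affine_carpet :: "rect set \<Rightarrow> (real \<times> real) set \<Rightarrow> bool" where
  "self_affine_carpet I F \<longleftrightarrow>
     (extended_lalley_gatzouras I \<or> baranski I) \<and> finite I \<and> card I \<ge> 2 \<and>
     (\<exists>q\<in>I. base q \<noteq> height q) \<and> attractor I F"

definition horizontal_type :: "rect set \<Rightarrow> bool" where
  "horizontal_type I \<longleftrightarrow> (\<forall>q\<in>I. base q \<ge> height q)"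

definition vertical_type :: "rect set \<Rightarrow> bool" where
  "vertical_type I \<longleftrightarrow> (\<forall>q\<in>I. base q \<le> height q)"

end

theory Submission
  imports Defs "HOL-Probability.Infinite_Product_Measure"
begin

text \<open>
  A vertical type carpet that is not of horizontal type is a Baranski carpet, and exchanging the
  coordinates makes it horizontal. In the horizontal case a point is coded by a sequence of
  rectangles; at scale \<open>R\<close> it lies in an approximate square, determined by the first \<open>k\<close> rectangles
  (heights down to \<open>R\<close>) and the columns of the first \<open>l \<ge> k\<close> rectangles (bases down to \<open>R\<close>).
  Let \<open>s1\<close> be the dimension of the projection to the horizontal axis, \<open>t q\<close> the dimension of the
  fibre generated by the column of \<open>q\<close>, and \<open>s1 + \<beta>\<close> the root of the box dimension equation.

  If \<open>t\<close> is constant, the Bernoulli measure with weights \<open>base q powr s1 * height q powr t q\<close> is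
  Ahlfors regular of dimension \<open>s1 + \<beta>\<close>. Otherwise the strict inequalities come from four estimates.
  Since some rectangle has its base larger than its height, there are approximate squares with
  \<open>l - k\<close> arbitrarily large, whose vertical structure is that of a single prescribed column; hence
  the Assouad dimension is at least \<open>s1 + Max t > s1 + \<beta>\<close> and the lower dimension at most
  \<open>s1 + Min t\<close>. The same Bernoulli measure has, on a set of positive mass, decay faster than
  \<open>s1 + Min t\<close>, which bounds the Hausdorff dimension from below. Finally the Hausdorff dimension is
  below \<open>s1 + \<beta>\<close> because column statistics that are typical for the indices between \<open>k\<close> and \<open>l\<close> at
  one scale are atypical for the same indices at smaller scales.
\<close>

section \<open>Nested intervals and the coding map\<close>

text \<open>Selected rectangles may share edges, so the coding is not injective, and rectangles of
  different columns need not be aligned vertically. For this reason cells and measures live on the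
  sequence space \<open>\<Omega>\<close> and are never pushed forward to the plane. Geometry enters
  through two facts: the points coded by an approximate square of scale R are within 2 R of each
  other, and a set of diameter comparable to R meets boundedly many approximate squares of scale R.
  Only the upper bound for the lower dimension asks for more, namely a ball that sees a single cell.
  The Hausdorff dimension is never computed, only trapped. Both strict inequalities around it come
  from tilting a weight vector by a factor whose mean is below 1. The resulting exponential gain is
  split evenly between mass and exponent, which is the origin of the square roots \<open>y\<close>
  and \<open>\<eta>\<close>.\<close>

definition scale :: "(nat \<Rightarrow> real) \<Rightarrow> nat \<Rightarrow> real" where
  "scale a n = (\<Prod>m<n. a m)"

text \<open>The maps \<open>x \<mapsto> a m * x + b m\<close> for \<open>m < n\<close>, composed
  with index 0 outermost, take the unit interval to the one from \<open>offset a b n\<close> to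
  \<open>offset a b n + scale a n\<close>.\<close>

definition offset :: "(nat \<Rightarrow> real) \<Rightarrow> (nat \<Rightarrow> real) \<Rightarrow> nat \<Rightarrow> real" where
  "offset a b n = (\<Sum>m<n. scale a m * b m)"

lemma scale_0 [simp]: "scale a 0 = 1"
  by (simp add: scale_def)

lemma scale_Suc: "scale a (Suc n) = scale a n * a n"
  by (simp add: scale_def)

lemma offset_0 [simp]: "offset a b 0 = 0"
  by (simp add: offset_def)

lemma offset_Suc: "offset a b (Suc n) = offset a b n + scale a n * b n"
  by (simp add: offset_def)

lemma scale_cong: "(\<And>m. m < n \<Longrightarrow> a m = a' m) \<Longrightarrow> scale a n = scale a' n"
  by (auto simp: scale_def intro!: prod.cong)

lemma offset_cong:
  assumes "\<And>m. m < n \<Longrightarrow> a m = a' m" "\<And>m. m < n \<Longrightarrow> b m = b' m"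
  shows "offset a b n = offset a' b' n"
  unfolding offset_def using assms by (intro sum.cong refl arg_cong2[where f="(*)"] scale_cong) auto

locale nested_intervals =
  fixes a b :: "nat \<Rightarrow> real"
  assumes ratio_pos: "\<And>m. 0 < a m" and offset_nonneg: "\<And>m. 0 \<le> b m"
    and sum_le_1: "\<And>m. b m + a m \<le> 1"
begin

lemma ratio_le_1: "a m \<le> 1"
  using offset_nonneg[of m] sum_le_1[of m] by simp

lemma scale_pos: "0 < scale a n"
  unfolding scale_def using ratio_pos by (intro prod_pos) auto

lemma scale_antimono: "n \<le> n' \<Longrightarrow> scale a n' \<le> scale a n"
proof (induction rule: dec_induct)
  case (step m)
  have "scale a (Suc m) \<le> scale a m * 1"
    unfolding scale_Suc using scale_pos[of m] ratio_le_1[of m] by (intro mult_left_mono) auto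
  then show ?case using step by simp
qed simp

lemma offset_mono: "n \<le> n' \<Longrightarrow> offset a b n \<le> offset a b n'"
proof (induction rule: dec_induct)
  case (step m)
  have "0 \<le> scale a m * b m" using scale_pos[of m] offset_nonneg[of m] by simp
  then show ?case using step by (simp add: offset_Suc)
qed simp

lemma offset_scale_antimono: "n \<le> n' \<Longrightarrow> offset a b n' + scale a n' \<le> offset a b n + scale a n"
proof (induction rule: dec_induct)
  case (step m)
  have "scale a m * (b m + a m) \<le> scale a m * 1"
    using scale_pos[of m] sum_le_1[of m] by (intro mult_left_mono) auto
  then show ?case using step by (simp add: offset_Suc scale_Suc algebra_simps)
qed simp

lemma offset_le_1: "offset a b n \<le> 1"
  using offset_scale_antimono[of 0 n] scale_pos[of n] by simp

lemma summable_offset: "summable (\<lambda>m. scale a m * b m)"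
proof (rule bounded_imp_summable)
  show "0 \<le> scale a m * b m" for m using scale_pos[of m] offset_nonneg[of m] by simp
  show "(\<Sum>k\<le>n. scale a k * b k) \<le> 1" for n
    using offset_le_1[of "Suc n"] by (simp add: offset_def lessThan_Suc_atMost)
qed

lemma offset_tendsto: "offset a b \<longlonglongrightarrow> (\<Sum>m. scale a m * b m)"
  unfolding offset_def[abs_def] using summable_LIMSEQ[OF summable_offset] .

lemma limit_ge: "offset a b n \<le> (\<Sum>m. scale a m * b m)"
  using offset_tendsto by (rule tendsto_lowerbound)
    (auto simp: eventually_sequentially intro: exI[of _ n] offset_mono)

lemma limit_le: "(\<Sum>m. scale a m * b m) \<le> offset a b n + scale a n"
proof (rule tendsto_upperbound[OF offset_tendsto])
  have "offset a b n' \<le> offset a b n + scale a n" if "n \<le> n'" for n'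
    using offset_scale_antimono[OF that] scale_pos[of n'] by simp
  then show "\<forall>\<^sub>F i in sequentially. offset a b i \<le> offset a b n + scale a n"
    by (auto simp: eventually_sequentially)
qed simp

end

text \<open>Before \<open>N\<close> both sequences apply the same affine map, which preserves the
  order of the two intervals at \<open>N\<close>; later stages only shrink inside the intervals of
  stage \<open>Suc N\<close>.\<close>

lemma nested_intervals_separated:
  assumes "nested_intervals a b" "nested_intervals a' b'"
    and agree: "\<And>m. m < N \<Longrightarrow> a m = a' m" "\<And>m. m < N \<Longrightarrow> b m = b' m"
    and sep: "b N + a N \<le> b' N" and "N < n" "N < n'"
  shows "offset a b n + scale a n \<le> offset a' b' n'"
proof -
  interpret A: nested_intervals a b by fact
  interpret B: nested_intervals a' b' by fact
  have "offset a b n + scale a n \<le> offset a b (Suc N) + scale a (Suc N)"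
    using \<open>N < n\<close> by (intro A.offset_scale_antimono) simp
  also have "\<dots> = offset a b N + scale a N * (b N + a N)"
    by (simp add: offset_Suc scale_Suc algebra_simps)
  also have "\<dots> \<le> offset a b N + scale a N * b' N"
    using sep A.scale_pos[of N] by (simp add: mult_left_mono)
  also have "\<dots> = offset a' b' (Suc N)"
    using offset_cong[of N a a' b b', OF agree] scale_cong[of N a a', OF agree(1)] by (simp add: offset_Suc)
  also have "\<dots> \<le> offset a' b' n'" using \<open>N < n'\<close> by (intro B.offset_mono) simp
  finally show ?thesis .
qed

text \<open>The horizontal interval of a rectangle serves as the name of its column, so that both
  classes can be treated without their subdivisions. The second component is the width of the
  column.\<close>

definition col :: "rect \<Rightarrow> real \<times> real" where
  "col q = (left q, base q)"

abbreviation cc :: "(nat \<Rightarrow> rect) \<Rightarrow> nat \<Rightarrow> real" where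
  "cc \<omega> \<equiv> scale (\<lambda>m. base (\<omega> m))"

abbreviation dd :: "(nat \<Rightarrow> rect) \<Rightarrow> nat \<Rightarrow> real" where
  "dd \<omega> \<equiv> scale (\<lambda>m. height (\<omega> m))"

abbreviation xx :: "(nat \<Rightarrow> rect) \<Rightarrow> nat \<Rightarrow> real" where
  "xx \<omega> \<equiv> offset (\<lambda>m. base (\<omega> m)) (\<lambda>m. left (\<omega> m))"

abbreviation yy :: "(nat \<Rightarrow> rect) \<Rightarrow> nat \<Rightarrow> real" where
  "yy \<omega> \<equiv> offset (\<lambda>m. height (\<omega> m)) (\<lambda>m. bottom (\<omega> m))"

definition pt :: "(nat \<Rightarrow> rect) \<Rightarrow> real \<times> real" where
  "pt \<omega> = (\<Sum>m. cc \<omega> m * left (\<omega> m), \<Sum>m. dd \<omega> m * bottom (\<omega> m))"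

text \<open>What both classes share in the horizontal case. Distinct columns do not overlap, and
  neither do distinct rectangles of one column, but nothing relates the heights at which different
  columns are sliced.\<close>

locale carpet =
  fixes I :: "rect set" and F :: "(real \<times> real) set"
  assumes fin: "finite I" and ne: "I \<noteq> {}"
    and height_pos: "q \<in> I \<Longrightarrow> 0 < height q"
    and height_le: "q \<in> I \<Longrightarrow> height q \<le> base q"
    and base_less: "q \<in> I \<Longrightarrow> base q < 1"
    and left_nonneg: "q \<in> I \<Longrightarrow> 0 \<le> left q"
    and right_le: "q \<in> I \<Longrightarrow> left q + base q \<le> 1"
    and bottom_nonneg: "q \<in> I \<Longrightarrow> 0 \<le> bottom q"
    and top_le: "q \<in> I \<Longrightarrow> bottom q + height q \<le> 1"
    and col_sep: "\<lbrakk>q \<in> I; q' \<in> I; col q \<noteq> col q'\<rbrakk> \<Longrightarrow>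
      left q + base q \<le> left q' \<or> left q' + base q' \<le> left q"
    and row_sep: "\<lbrakk>q \<in> I; q' \<in> I; col q = col q'; q \<noteq> q'\<rbrakk> \<Longrightarrow>
      bottom q + height q \<le> bottom q' \<or> bottom q' + height q' \<le> bottom q"
    and attr: "attractor I F"
begin

definition \<Omega> :: "(nat \<Rightarrow> rect) set" where
  "\<Omega> = UNIV \<rightarrow>\<^sub>E I"

lemma Omega_iff: "\<omega> \<in> \<Omega> \<longleftrightarrow> (\<forall>m. \<omega> m \<in> I)"
  by (auto simp: \<Omega>_def)

lemma Omega_D: "\<omega> \<in> \<Omega> \<Longrightarrow> \<omega> m \<in> I"
  by (simp add: Omega_iff)

lemma base_pos: "q \<in> I \<Longrightarrow> 0 < base q"
  using height_pos height_le by fastforce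

lemma height_less: "q \<in> I \<Longrightarrow> height q < 1"
  using base_less height_le by fastforce

lemma nested_x: "\<omega> \<in> \<Omega> \<Longrightarrow> nested_intervals (\<lambda>m. base (\<omega> m)) (\<lambda>m. left (\<omega> m))"
  by unfold_locales (auto simp: Omega_iff base_pos left_nonneg right_le)

lemma nested_y: "\<omega> \<in> \<Omega> \<Longrightarrow> nested_intervals (\<lambda>m. height (\<omega> m)) (\<lambda>m. bottom (\<omega> m))"
  by unfold_locales (auto simp: Omega_iff height_pos bottom_nonneg top_le)

lemmas cc_pos = nested_intervals.scale_pos[OF nested_x]
lemmas dd_pos = nested_intervals.scale_pos[OF nested_y]
lemmas cc_antimono = nested_intervals.scale_antimono[OF nested_x]
lemmas dd_antimono = nested_intervals.scale_antimono[OF nested_y]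
lemmas pt_x_ge = nested_intervals.limit_ge[OF nested_x]
lemmas pt_x_le = nested_intervals.limit_le[OF nested_x]
lemmas pt_y_ge = nested_intervals.limit_ge[OF nested_y]
lemmas pt_y_le = nested_intervals.limit_le[OF nested_y]

lemma pt_in:
  assumes "\<omega> \<in> \<Omega>"
  shows "xx \<omega> n \<le> fst (pt \<omega>)" "fst (pt \<omega>) \<le> xx \<omega> n + cc \<omega> n"
    "yy \<omega> n \<le> snd (pt \<omega>)" "snd (pt \<omega>) \<le> yy \<omega> n + dd \<omega> n"
  using pt_x_ge[OF assms, of n] pt_x_le[OF assms, of n] pt_y_ge[OF assms, of n] pt_y_le[OF assms, of n]
  by (auto simp: pt_def)

definition \<kappa> :: real where "\<kappa> = Min (height ` I)"

definition \<theta> :: real where "\<theta> = Max (base ` I)"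

lemma kappa_pos: "0 < \<kappa>"
  using fin ne by (auto simp: \<kappa>_def height_pos)

lemma kappa_le_height: "q \<in> I \<Longrightarrow> \<kappa> \<le> height q"
  using fin by (auto simp: \<kappa>_def)

lemma kappa_le_base: "q \<in> I \<Longrightarrow> \<kappa> \<le> base q"
  using kappa_le_height height_le by fastforce

lemma base_le_theta: "q \<in> I \<Longrightarrow> base q \<le> \<theta>"
  using fin by (auto simp: \<theta>_def)

lemma theta_less_1: "\<theta> < 1"
  using fin ne by (auto simp: \<theta>_def base_less)

lemma theta_pos: "0 < \<theta>"
  using ne base_pos base_le_theta by fastforce

lemma kappa_less_1: "\<kappa> < 1"
  using ne kappa_le_base base_less by fastforce

lemma dd_le_cc: "\<omega> \<in> \<Omega> \<Longrightarrow> dd \<omega> n \<le> cc \<omega> n"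
  unfolding scale_def by (intro prod_mono) (auto simp: Omega_iff height_le height_pos less_imp_le)

lemma cc_le_theta: "\<omega> \<in> \<Omega> \<Longrightarrow> cc \<omega> n \<le> \<theta> ^ n"
  using prod_mono[of "{..<n}" "\<lambda>m. base (\<omega> m)" "\<lambda>_. \<theta>"]
  by (auto simp: scale_def Omega_iff base_le_theta base_pos less_imp_le)

lemma dd_le_theta: "\<omega> \<in> \<Omega> \<Longrightarrow> dd \<omega> n \<le> \<theta> ^ n"
  using dd_le_cc cc_le_theta order_trans by blast

lemma dd_ge_kappa: "\<omega> \<in> \<Omega> \<Longrightarrow> \<kappa> ^ n \<le> dd \<omega> n"
  using prod_mono[of "{..<n}" "\<lambda>_. \<kappa>" "\<lambda>m. height (\<omega> m)"] kappa_pos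
  by (auto simp: scale_def Omega_iff kappa_le_height less_imp_le)

lemma cc_tendsto: "\<omega> \<in> \<Omega> \<Longrightarrow> cc \<omega> \<longlonglongrightarrow> 0"
  using theta_pos theta_less_1 cc_le_theta cc_pos
  by (intro tendsto_sandwich[of "\<lambda>_. 0" "cc \<omega>" sequentially "\<lambda>n. \<theta> ^ n"] LIMSEQ_power_zero)
     (auto intro!: always_eventually less_imp_le)

lemma dd_tendsto: "\<omega> \<in> \<Omega> \<Longrightarrow> dd \<omega> \<longlonglongrightarrow> 0"
  using dd_le_cc dd_pos cc_tendsto
  by (intro tendsto_sandwich[of "\<lambda>_. 0" "dd \<omega>" sequentially "cc \<omega>"])
     (auto intro!: always_eventually less_imp_le)

lemma F_compact: "compact F" and F_nonempty: "F \<noteq> {}" and F_eq: "F = (\<Union>q\<in>I. rect_map q ` F)"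
  using attr by (auto simp: attractor_def)

lemma pt_in_F: assumes w: "\<omega> \<in> \<Omega>" shows "pt \<omega> \<in> F"
proof -
  have iter: "(cc \<omega> n * fst z + xx \<omega> n, dd \<omega> n * snd z + yy \<omega> n) \<in> F" if "z \<in> F" for n z
    using that
  proof (induction n arbitrary: z)
    case (Suc n)
    have "rect_map (\<omega> n) z \<in> F" using Suc.prems Omega_D[OF w, of n] F_eq by blast
    from Suc.IH[OF this] show ?case
      by (simp add: rect_map_def scale_Suc offset_Suc algebra_simps case_prod_beta)
  qed simp
  obtain z where z: "z \<in> F" using F_nonempty by auto
  have "(\<lambda>n. (cc \<omega> n * fst z + xx \<omega> n, dd \<omega> n * snd z + yy \<omega> n)) \<longlonglongrightarrow> (0 * fst z + fst (pt \<omega>), 0 * snd z + snd (pt \<omega>))"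
    unfolding pt_def fst_conv snd_conv
    by (intro tendsto_intros cc_tendsto dd_tendsto w
        nested_intervals.offset_tendsto[OF nested_x] nested_intervals.offset_tendsto[OF nested_y])
  from closed_sequentially[OF compact_imp_closed[OF F_compact] _ this] iter[OF z] show ?thesis
    by simp
qed

text \<open>Choosing preimages again and again yields a code. The preimages stay in the bounded set
  \<open>F\<close>, so their contribution is contracted away and only the offsets remain in the
  limit.\<close>

lemma F_code: assumes "x \<in> F" shows "\<exists>\<omega>\<in>\<Omega>. pt \<omega> = x"
proof -
  have "\<forall>z\<in>F. \<exists>p. fst p \<in> I \<and> snd p \<in> F \<and> z = rect_map (fst p) (snd p)"
    using F_eq by fastforce
  then obtain g where g: "\<And>z. z \<in> F \<Longrightarrow> fst (g z) \<in> I \<and> snd (g z) \<in> F \<and> z = rect_map (fst (g z)) (snd (g z))"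
    by metis
  define z where "z n = ((\<lambda>z. snd (g z)) ^^ n) x" for n
  define \<omega> where "\<omega> n = fst (g (z n))" for n
  have z0: "z 0 = x" and zS: "z (Suc n) = snd (g (z n))" for n by (auto simp: z_def)
  have zF: "z n \<in> F" for n by (induction n) (use assms g in \<open>auto simp: z0 zS\<close>)
  have w: "\<omega> \<in> \<Omega>" using g[OF zF] by (auto simp: Omega_iff \<omega>_def)
  have zeq: "z n = rect_map (\<omega> n) (z (Suc n))" for n using g[OF zF] by (auto simp: \<omega>_def zS)
  have x: "fst x = cc \<omega> n * fst (z n) + xx \<omega> n \<and> snd x = dd \<omega> n * snd (z n) + yy \<omega> n" for n
  proof (induction n)
    case (Suc n)
    have "fst (z n) = base (\<omega> n) * fst (z (Suc n)) + left (\<omega> n)"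
      "snd (z n) = height (\<omega> n) * snd (z (Suc n)) + bottom (\<omega> n)"
      using zeq[of n] by (metis (no_types, lifting) case_prod_beta fst_conv rect_map_def)
        (use zeq[of n] in \<open>metis (no_types, lifting) case_prod_beta snd_conv rect_map_def\<close>)
    with Suc show ?case by (auto simp: scale_Suc offset_Suc algebra_simps)
  qed (simp add: z0)
  obtain B where B: "\<And>z. z \<in> F \<Longrightarrow> norm z \<le> B" using compact_imp_bounded[OF F_compact] by (auto simp: bounded_iff)
  have b1: "norm (fst (z n)) \<le> B" "norm (snd (z n)) \<le> B" for n
    using B[OF zF[of n]] norm_fst_le[of "fst (z n)" "snd (z n)"] norm_snd_le[of "snd (z n)" "fst (z n)"]
    by auto
  have "(\<lambda>n. cc \<omega> n * fst (z n)) \<longlonglongrightarrow> 0" "(\<lambda>n. dd \<omega> n * snd (z n)) \<longlonglongrightarrow> 0"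
    using b1 cc_tendsto[OF w] dd_tendsto[OF w]
    by (auto simp: tendsto_Zfun_iff intro!: bounded_bilinear.Zfun_prod_Bfun[OF bounded_bilinear_mult] BfunI[of _ B])
  then have "(\<lambda>n. fst x - cc \<omega> n * fst (z n)) \<longlonglongrightarrow> fst x"
    "(\<lambda>n. snd x - dd \<omega> n * snd (z n)) \<longlonglongrightarrow> snd x"
    using tendsto_diff[OF tendsto_const] by fastforce+
  moreover have "fst x - cc \<omega> n * fst (z n) = xx \<omega> n" "snd x - dd \<omega> n * snd (z n) = yy \<omega> n" for n
    using x[of n] by auto
  ultimately have "xx \<omega> \<longlonglongrightarrow> fst x" "yy \<omega> \<longlonglongrightarrow> snd x" by simp_all
  moreover have "xx \<omega> \<longlonglongrightarrow> fst (pt \<omega>)" "yy \<omega> \<longlonglongrightarrow> snd (pt \<omega>)"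
    using nested_intervals.offset_tendsto[OF nested_x[OF w]] nested_intervals.offset_tendsto[OF nested_y[OF w]]
    by (auto simp: pt_def)
  ultimately have "pt \<omega> = x" by (metis LIMSEQ_unique prod_eqI)
  with w show ?thesis by blast
qed

end

section \<open>Cells, product measures and approximate squares\<close>

text \<open>A stopping index: for the heights it is the \<open>k\<close>, for the bases the
  \<open>l\<close>, of the approximate square of scale \<open>R\<close>. Its value is meaningful
  only if some \<open>scale a n \<le> R\<close>.\<close>

definition hit :: "(nat \<Rightarrow> real) \<Rightarrow> real \<Rightarrow> nat" where
  "hit a R = (LEAST n. scale a n \<le> R)"

text \<open>Whether the index has been reached depends only on the ratios before it. This is what
  makes the approximate squares of one scale a partition of the codes.\<close>

lemma hit_cong:
  assumes "\<exists>n. scale a n \<le> R" and eq: "\<And>m. m < hit a R \<Longrightarrow> a' m = a m"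
  shows "hit a' R = hit a R"
proof -
  have le: "scale a (hit a R) \<le> R" unfolding hit_def using assms(1) by (rule LeastI_ex)
  have s: "scale a' n = scale a n" if "n \<le> hit a R" for n
    using that by (intro scale_cong eq) simp
  show ?thesis
    unfolding hit_def[of a']
  proof (rule Least_equality)
    show "scale a' (hit a R) \<le> R" using le s by simp
    fix n assume n: "scale a' n \<le> R"
    show "hit a R \<le> n"
    proof (rule ccontr)
      assume "\<not> hit a R \<le> n"
      then have "n < hit a R" by simp
      then have "scale a n \<le> R" using n s by simp
      then have "hit a R \<le> n" unfolding hit_def by (rule Least_le)
      with \<open>n < hit a R\<close> show False by simp
    qed
  qed
qed

lemma hit_le: "scale a n \<le> R \<Longrightarrow> hit a R \<le> n"
  unfolding hit_def by (rule Least_le)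

lemma before_hit: "n < hit a R \<Longrightarrow> R < scale a n"
  using hit_le[of a n R] by (meson leD not_le_imp_less)

lemma scale_hit_le: "\<exists>n. scale a n \<le> R \<Longrightarrow> scale a (hit a R) \<le> R"
  unfolding hit_def by (rule LeastI_ex)

text \<open>One step before stopping the product still exceeds \<open>R\<close>, so it overshoots by
  at most one factor \<open>\<kappa>\<close>; the bound \<open>R \<le> 1\<close> covers the case
  without any step.\<close>

lemma scale_hit_ge:
  assumes "\<And>m. \<kappa> \<le> a m" "0 \<le> \<kappa>" "\<kappa> \<le> 1" "0 < R" "R \<le> 1"
  shows "\<kappa> * R \<le> scale a (hit a R)"
proof (cases "hit a R")
  case 0
  then show ?thesis using assms by (simp add: mult_le_one)
next
  case (Suc n)
  then have "R < scale a n" by (intro before_hit) simp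
  then have "R * \<kappa> \<le> scale a n * a n" using assms(1)[of n] assms(2-) by (intro mult_mono) auto
  then show ?thesis using Suc by (simp add: scale_Suc mult.commute)
qed

lemma floor_eq_dist: "0 < d \<Longrightarrow> \<lfloor>u / d\<rfloor> = \<lfloor>v / d\<rfloor> \<Longrightarrow> \<bar>u - v\<bar> < (d::real)"
proof -
  assume d: "0 < d" and e: "\<lfloor>u / d\<rfloor> = \<lfloor>v / d\<rfloor>"
  have "\<bar>u / d - v / d\<bar> < 1" using e by linarith
  then have "\<bar>u - v\<bar> / d < 1" using d by (simp add: diff_divide_distrib[symmetric])
  then show ?thesis using d by simp
qed

lemma card_floor_interval: "a \<le> b \<Longrightarrow> real (card {\<lfloor>a\<rfloor>..\<lfloor>b\<rfloor>}) \<le> b - a + 2" for a b :: real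
  using floor_mono[of a b] by simp linarith

context carpet
begin

section \<open>Separation of codes, and partitions of the code space into cells\<close>

lemma x_separated:
  assumes w: "\<omega> \<in> \<Omega>" "\<omega>' \<in> \<Omega>" and eq: "\<And>i. i < m \<Longrightarrow> col (\<omega> i) = col (\<omega>' i)"
    and neq: "col (\<omega> m) \<noteq> col (\<omega>' m)" and n: "m < n" "m < n'"
  shows "xx \<omega> n + cc \<omega> n \<le> xx \<omega>' n' \<or> xx \<omega>' n' + cc \<omega>' n' \<le> xx \<omega> n"
proof -
  have e: "base (\<omega> i) = base (\<omega>' i)" "left (\<omega> i) = left (\<omega>' i)" if "i < m" for i
    using eq[OF that] by (auto simp: col_def)
  show ?thesis
    using col_sep[OF Omega_D[OF w(1)] Omega_D[OF w(2)] neq]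
      nested_intervals_separated[OF nested_x[OF w(1)] nested_x[OF w(2)] e _ n]
      nested_intervals_separated[OF nested_x[OF w(2)] nested_x[OF w(1)] e[symmetric] _ n(2,1)] by auto
qed

text \<open>Vertical order is known only inside a column, so at the first differing letter the
  columns have to agree; differing columns are the business of \<open>x_separated\<close>.\<close>

lemma y_separated:
  assumes w: "\<omega> \<in> \<Omega>" "\<omega>' \<in> \<Omega>" and eq: "\<And>i. i < m \<Longrightarrow> \<omega> i = \<omega>' i"
    and ceq: "col (\<omega> m) = col (\<omega>' m)" and neq: "\<omega> m \<noteq> \<omega>' m" and n: "m < n" "m < n'"
  shows "yy \<omega> n + dd \<omega> n \<le> yy \<omega>' n' \<or> yy \<omega>' n' + dd \<omega>' n' \<le> yy \<omega> n"
proof -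
  have e: "height (\<omega> i) = height (\<omega>' i)" "bottom (\<omega> i) = bottom (\<omega>' i)" if "i < m" for i
    using eq[OF that] by auto
  show ?thesis
    using row_sep[OF Omega_D[OF w(1)] Omega_D[OF w(2)] ceq neq]
      nested_intervals_separated[OF nested_y[OF w(1)] nested_y[OF w(2)] e _ n]
      nested_intervals_separated[OF nested_y[OF w(2)] nested_y[OF w(1)] e[symmetric] _ n(2,1)] by auto
qed

text \<open>A cylinder for \<open>k = l\<close>. For \<open>k < l\<close> the later letters are
  known only by column, so the cell codes a piece of width at most \<open>cc \<omega> l\<close>
  inside a strip of height \<open>dd \<omega> k\<close>.\<close>

definition cell :: "nat \<Rightarrow> nat \<Rightarrow> (nat \<Rightarrow> rect) \<Rightarrow> (nat \<Rightarrow> rect) set" where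
  "cell k l \<omega> = {\<omega>' \<in> \<Omega>. (\<forall>m<k. \<omega>' m = \<omega> m) \<and> (\<forall>m<l. col (\<omega>' m) = col (\<omega> m))}"

lemma cell_self: "\<omega> \<in> \<Omega> \<Longrightarrow> \<omega> \<in> cell k l \<omega>"
  by (simp add: cell_def)

lemma cell_subset: "cell k l \<omega> \<subseteq> \<Omega>"
  by (auto simp: cell_def)

lemma cell_eqI: "\<omega>' \<in> cell k l \<omega> \<Longrightarrow> cell k l \<omega>' = cell k l \<omega>"
  by (auto simp: cell_def)

lemma cell_mono: "k \<le> k' \<Longrightarrow> l \<le> l' \<Longrightarrow> cell k' l' \<omega> \<subseteq> cell k l \<omega>"
  by (auto simp: cell_def)

lemma cell_cc: "\<omega>' \<in> cell k l \<omega> \<Longrightarrow> n \<le> l \<Longrightarrow> cc \<omega>' n = cc \<omega> n"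
  by (intro scale_cong) (auto simp: cell_def col_def)

lemma cell_dd: "\<omega>' \<in> cell k l \<omega> \<Longrightarrow> n \<le> k \<Longrightarrow> dd \<omega>' n = dd \<omega> n"
  by (intro scale_cong) (auto simp: cell_def)

text \<open>Constancy of \<open>k\<close> and \<open>l\<close> on the cell they define makes the
  cells disjoint, and the common bound \<open>N\<close> makes them finite in number. The indices may
  differ from cell to cell.\<close>

definition stopping :: "((nat \<Rightarrow> rect) \<Rightarrow> nat) \<Rightarrow> ((nat \<Rightarrow> rect) \<Rightarrow> nat) \<Rightarrow> bool" where
  "stopping k l \<longleftrightarrow> (\<exists>N. \<forall>\<omega>\<in>\<Omega>. k \<omega> \<le> l \<omega> \<and> l \<omega> \<le> N) \<and>
     (\<forall>\<omega>\<in>\<Omega>. \<forall>\<omega>'\<in>cell (k \<omega>) (l \<omega>) \<omega>. k \<omega>' = k \<omega> \<and> l \<omega>' = l \<omega>)"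

definition cells :: "((nat \<Rightarrow> rect) \<Rightarrow> nat) \<Rightarrow> ((nat \<Rightarrow> rect) \<Rightarrow> nat) \<Rightarrow> (nat \<Rightarrow> rect) set set" where
  "cells k l = (\<lambda>\<omega>. cell (k \<omega>) (l \<omega>) \<omega>) ` \<Omega>"

lemma stoppingI:
  assumes "\<And>\<omega>. \<omega> \<in> \<Omega> \<Longrightarrow> k \<omega> \<le> l \<omega>" "\<And>\<omega>. \<omega> \<in> \<Omega> \<Longrightarrow> l \<omega> \<le> N"
    "\<And>\<omega> \<omega>'. \<omega> \<in> \<Omega> \<Longrightarrow> \<omega>' \<in> cell (k \<omega>) (l \<omega>) \<omega> \<Longrightarrow> k \<omega>' = k \<omega>"
    "\<And>\<omega> \<omega>'. \<omega> \<in> \<Omega> \<Longrightarrow> \<omega>' \<in> cell (k \<omega>) (l \<omega>) \<omega> \<Longrightarrow> l \<omega>' = l \<omega>"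
  shows "stopping k l"
  unfolding stopping_def using assms by blast

lemma stopping_le: "stopping k l \<Longrightarrow> \<omega> \<in> \<Omega> \<Longrightarrow> k \<omega> \<le> l \<omega>"
  unfolding stopping_def by blast

lemma stopping_bounded: "stopping k l \<Longrightarrow> \<exists>N. \<forall>\<omega>\<in>\<Omega>. l \<omega> \<le> N"
  unfolding stopping_def by blast

lemma stopping_cell_eq:
  assumes "stopping k l" "\<omega> \<in> \<Omega>" "\<omega>' \<in> cell (k \<omega>) (l \<omega>) \<omega>"
  shows "cell (k \<omega>') (l \<omega>') \<omega>' = cell (k \<omega>) (l \<omega>) \<omega>"
proof -
  have "k \<omega>' = k \<omega>" "l \<omega>' = l \<omega>" using assms unfolding stopping_def by blast+
  then show ?thesis using cell_eqI[OF assms(3)] by simp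
qed

lemma cells_eq:
  assumes "stopping k l" "Q \<in> cells k l" "\<omega> \<in> Q"
  shows "Q = cell (k \<omega>) (l \<omega>) \<omega>"
proof -
  obtain \<omega>0 where "\<omega>0 \<in> \<Omega>" "Q = cell (k \<omega>0) (l \<omega>0) \<omega>0" using assms(2) by (auto simp: cells_def)
  then show ?thesis using stopping_cell_eq[OF assms(1)] assms(3) by metis
qed

lemma cells_subset: "Q \<in> cells k l \<Longrightarrow> Q \<subseteq> \<Omega>"
  by (auto simp: cells_def cell_def)

lemma cells_ne: "Q \<in> cells k l \<Longrightarrow> \<exists>\<omega>. \<omega> \<in> Q"
  using cell_self by (auto simp: cells_def)

lemma disjoint_cells: "stopping k l \<Longrightarrow> disjoint (cells k l)"
  unfolding disjoint_def using cells_eq by blast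

lemma finite_cells:
  assumes "stopping k l"
  shows "finite (cells k l)"
proof -
  obtain N where N: "\<And>\<omega>. \<omega> \<in> \<Omega> \<Longrightarrow> k \<omega> \<le> N \<and> l \<omega> \<le> N"
    using stopping_bounded[OF assms] stopping_le[OF assms] by (meson order_trans)
  let ?f = "\<lambda>(a, b, g). cell a b g"
  have "cells k l \<subseteq> ?f ` ({..N} \<times> {..N} \<times> ({..<N} \<rightarrow>\<^sub>E I))"
  proof
    fix Q assume "Q \<in> cells k l"
    then obtain \<omega> where w: "\<omega> \<in> \<Omega>" "Q = cell (k \<omega>) (l \<omega>) \<omega>" by (auto simp: cells_def)
    \<comment> \<open>The restricted sequence lies outside \<open>\<Omega>\<close> in general, but
      \<open>cell\<close> reads only its first \<open>N\<close> letters.\<close>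
    have "Q = cell (k \<omega>) (l \<omega>) (restrict \<omega> {..<N})"
      using N[OF w(1)] by (auto simp: w(2) cell_def)
    then show "Q \<in> ?f ` ({..N} \<times> {..N} \<times> ({..<N} \<rightarrow>\<^sub>E I))"
      using N[OF w(1)] Omega_D[OF w(1)]
      by (intro image_eqI[of _ _ "(k \<omega>, l \<omega>, restrict \<omega> {..<N})"]) auto
  qed
  then show ?thesis
    by (rule finite_subset) (intro finite_imageI finite_cartesian_product finite_PiE fin finite_atMost finite_lessThan)
qed

lemma Union_cells: "\<Union>(cells k l) = \<Omega>"
  using cell_self cells_subset by (fastforce simp: cells_def cell_def)

section \<open>Product measures with independent letters\<close>

definition is_prob :: "(rect \<Rightarrow> real) \<Rightarrow> bool" where
  "is_prob u \<longleftrightarrow> (\<forall>q\<in>I. 0 \<le> u q) \<and> sum u I = 1"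

definition probs :: "(nat \<Rightarrow> rect \<Rightarrow> real) \<Rightarrow> bool" where
  "probs W \<longleftrightarrow> (\<forall>m. is_prob (W m))"

definition colsum :: "(rect \<Rightarrow> real) \<Rightarrow> rect \<Rightarrow> real" where
  "colsum u q = (\<Sum>q'\<in>{q'\<in>I. col q' = col q}. u q')"

text \<open>The distribution of a letter may depend on its index; the weights that single out a
  block of indices rely on this.\<close>

definition \<mu> :: "(nat \<Rightarrow> rect \<Rightarrow> real) \<Rightarrow> (nat \<Rightarrow> rect) measure" where
  "\<mu> W = PiM UNIV (\<lambda>m. point_measure I (\<lambda>q. ennreal (W m q)))"

lemma space_mu: "space (\<mu> W) = \<Omega>"
  by (simp add: \<mu>_def space_PiM space_point_measure \<Omega>_def)

lemma prob_space_letter: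
  "is_prob u \<Longrightarrow> prob_space (point_measure I (\<lambda>q. ennreal (u q)))"
  using fin by (intro prob_space_point_measure) (auto simp: is_prob_def sum_ennreal)

lemma product_prob_mu:
  assumes "probs W"
  shows "product_prob_space (\<lambda>m. point_measure I (\<lambda>q. ennreal (W m q)))"
  using assms prob_space_letter
  unfolding probs_def
  by (auto simp: product_prob_space_def product_sigma_finite_def product_prob_space_axioms_def
      intro: prob_space_imp_sigma_finite)

lemma prob_mu: "probs W \<Longrightarrow> prob_space (\<mu> W)"
  unfolding \<mu>_def probs_def by (intro prob_space_PiM prob_space_letter) auto

lemma cylinder_mu:
  assumes W: "probs W" and A: "\<And>m. m < n \<Longrightarrow> A m \<subseteq> I"
  shows "{\<omega>\<in>\<Omega>. \<forall>m<n. \<omega> m \<in> A m} \<in> sets (\<mu> W)"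
    "measure (\<mu> W) {\<omega>\<in>\<Omega>. \<forall>m<n. \<omega> m \<in> A m} = (\<Prod>m<n. \<Sum>q\<in>A m. W m q)"
proof -
  let ?M = "\<lambda>m. point_measure I (\<lambda>q. ennreal (W m q))"
  interpret product_prob_space ?M UNIV by (rule product_prob_mu[OF W])
  have eq: "{\<omega>\<in>\<Omega>. \<forall>m<n. \<omega> m \<in> A m} = prod_emb UNIV ?M {..<n} (Pi\<^sub>E {..<n} A)"
    using A by (auto simp: prod_emb_iff Omega_iff space_point_measure)
  show "{\<omega>\<in>\<Omega>. \<forall>m<n. \<omega> m \<in> A m} \<in> sets (\<mu> W)"
    unfolding eq \<mu>_def using A by (intro sets_PiM_I) (auto simp: sets_point_measure)
  have m: "measure (?M m) (A m) = (\<Sum>q\<in>A m. W m q)" if "m < n" for m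
  proof -
    have nn: "0 \<le> W m q" if "q \<in> A m" for q
      using W A[OF \<open>m < n\<close>] that by (auto simp: probs_def is_prob_def)
    have "emeasure (?M m) (A m) = ennreal (\<Sum>q\<in>A m. W m q)"
      using A[OF that] fin nn by (subst emeasure_point_measure_finite) (auto simp: sum_ennreal)
    then show ?thesis using nn by (simp add: measure_def sum_nonneg)
  qed
  show "measure (\<mu> W) {\<omega>\<in>\<Omega>. \<forall>m<n. \<omega> m \<in> A m} = (\<Prod>m<n. \<Sum>q\<in>A m. W m q)"
    unfolding eq \<mu>_def using A by (subst measure_PiM_emb) (auto simp: sets_point_measure m)
qed

text \<open>A cell is a product set whose factor is a single letter before \<open>k\<close> and a
  whole column from \<open>k\<close> to \<open>l\<close>, hence the \<open>colsum\<close>.\<close>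

lemma cell_mu:
  assumes W: "probs W" and w: "\<omega> \<in> \<Omega>" and kl: "k \<le> l"
  shows "cell k l \<omega> \<in> sets (\<mu> W)"
    "measure (\<mu> W) (cell k l \<omega>) = (\<Prod>m<k. W m (\<omega> m)) * (\<Prod>m=k..<l. colsum (W m) (\<omega> m))"
proof -
  let ?A = "\<lambda>m. if m < k then {\<omega> m} else {q\<in>I. col q = col (\<omega> m)}"
  have eq: "cell k l \<omega> = {\<omega>'\<in>\<Omega>. \<forall>m<l. \<omega>' m \<in> ?A m}"
    using kl by (force simp: cell_def Omega_iff split: if_splits)
  have A: "?A m \<subseteq> I" for m using Omega_D[OF w] by auto
  show "cell k l \<omega> \<in> sets (\<mu> W)" unfolding eq using A by (intro cylinder_mu W)
  have "measure (\<mu> W) (cell k l \<omega>) = (\<Prod>m<l. \<Sum>q\<in>?A m. W m q)"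
    unfolding eq using A by (intro cylinder_mu W)
  also have "{..<l} = {..<k} \<union> {k..<l}" using kl by auto
  also have "(\<Prod>m\<in>\<dots>. \<Sum>q\<in>?A m. W m q) = (\<Prod>m<k. \<Sum>q\<in>?A m. W m q) * (\<Prod>m=k..<l. \<Sum>q\<in>?A m. W m q)"
    by (intro prod.union_disjoint) auto
  also have "\<dots> = (\<Prod>m<k. W m (\<omega> m)) * (\<Prod>m=k..<l. colsum (W m) (\<omega> m))"
    by (intro arg_cong2[where f="(*)"] prod.cong) (auto simp: colsum_def)
  finally show "measure (\<mu> W) (cell k l \<omega>) = (\<Prod>m<k. W m (\<omega> m)) * (\<Prod>m=k..<l. colsum (W m) (\<omega> m))" .
qed

lemma cells_sets:
  assumes W: "probs W" and st: "stopping k l" and "Q \<in> cells k l"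
  shows "Q \<in> sets (\<mu> W)"
  using assms(3) cell_mu(1)[OF W _ stopping_le[OF st]] by (auto simp: cells_def)

lemma sum_cells:
  assumes W: "probs W" and st: "stopping k l" and C: "\<C> \<subseteq> cells k l"
  shows "(\<Sum>Q\<in>\<C>. measure (\<mu> W) Q) = measure (\<mu> W) (\<Union>\<C>)"
proof -
  interpret prob_space "\<mu> W" by (rule prob_mu[OF W])
  have "disjoint_family_on (\<lambda>Q. Q) \<C>"
    using C disjoint_cells[OF st] by (auto simp: disjoint_family_on_def disjoint_def)
  moreover have "finite \<C>" using C finite_cells[OF st] by (rule finite_subset)
  ultimately show ?thesis
    using C cells_sets[OF W st] by (subst finite_measure_finite_Union[symmetric]) auto
qed

lemma sum_cells_le_1:
  assumes W: "probs W" and st: "stopping k l" and C: "\<C> \<subseteq> cells k l"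
  shows "(\<Sum>Q\<in>\<C>. measure (\<mu> W) Q) \<le> 1"
  unfolding sum_cells[OF assms] by (rule prob_space.prob_le_1[OF prob_mu[OF W]])

lemma mu_Omega: "probs W \<Longrightarrow> measure (\<mu> W) \<Omega> = 1"
  using prob_space.prob_space[OF prob_mu] by (simp add: space_mu)

lemma mu_le_sum:
  assumes W: "probs W" and st: "stopping k l" and C: "\<C> \<subseteq> cells k l" and A: "A \<subseteq> \<Union>\<C>"
  shows "measure (\<mu> W) A \<le> (\<Sum>Q\<in>\<C>. measure (\<mu> W) Q)"
proof -
  interpret prob_space "\<mu> W" by (rule prob_mu[OF W])
  have "\<Union>\<C> \<in> sets (\<mu> W)"
    using C cells_sets[OF W st] finite_cells[OF st] by (intro sets.finite_Union) (auto intro: finite_subset)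
  then show ?thesis unfolding sum_cells[OF W st C] using A by (intro finite_measure_mono)
qed

section \<open>Approximate squares\<close>

abbreviation kR :: "real \<Rightarrow> (nat \<Rightarrow> rect) \<Rightarrow> nat" where
  "kR R \<omega> \<equiv> hit (\<lambda>m. height (\<omega> m)) R"

abbreviation lR :: "real \<Rightarrow> (nat \<Rightarrow> rect) \<Rightarrow> nat" where
  "lR R \<omega> \<equiv> hit (\<lambda>m. base (\<omega> m)) R"

lemma ex_hit_cc: "\<omega> \<in> \<Omega> \<Longrightarrow> 0 < R \<Longrightarrow> \<exists>n. cc \<omega> n \<le> R"
  using order_tendstoD(2)[OF cc_tendsto, of \<omega> R] unfolding eventually_sequentially by (meson less_imp_le order.refl)

lemma ex_hit_dd: "\<omega> \<in> \<Omega> \<Longrightarrow> 0 < R \<Longrightarrow> \<exists>n. dd \<omega> n \<le> R"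
  using order_tendstoD(2)[OF dd_tendsto, of \<omega> R] unfolding eventually_sequentially by (meson less_imp_le order.refl)

lemma cc_hit_le: "\<omega> \<in> \<Omega> \<Longrightarrow> 0 < R \<Longrightarrow> cc \<omega> (lR R \<omega>) \<le> R"
  by (intro scale_hit_le ex_hit_cc)

lemma dd_hit_le: "\<omega> \<in> \<Omega> \<Longrightarrow> 0 < R \<Longrightarrow> dd \<omega> (kR R \<omega>) \<le> R"
  by (intro scale_hit_le ex_hit_dd)

lemma cc_hit_ge: "\<omega> \<in> \<Omega> \<Longrightarrow> 0 < R \<Longrightarrow> R \<le> 1 \<Longrightarrow> \<kappa> * R \<le> cc \<omega> (lR R \<omega>)"
  using kappa_pos kappa_less_1 by (intro scale_hit_ge) (auto simp: Omega_iff kappa_le_base)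

lemma dd_hit_ge: "\<omega> \<in> \<Omega> \<Longrightarrow> 0 < R \<Longrightarrow> R \<le> 1 \<Longrightarrow> \<kappa> * R \<le> dd \<omega> (kR R \<omega>)"
  using kappa_pos kappa_less_1 by (intro scale_hit_ge) (auto simp: Omega_iff kappa_le_height)

lemma lR_mono: "\<omega> \<in> \<Omega> \<Longrightarrow> 0 < r \<Longrightarrow> r \<le> R \<Longrightarrow> lR R \<omega> \<le> lR r \<omega>"
  using cc_hit_le[of \<omega> r] by (intro hit_le) simp

lemma kR_mono: "\<omega> \<in> \<Omega> \<Longrightarrow> 0 < r \<Longrightarrow> r \<le> R \<Longrightarrow> kR R \<omega> \<le> kR r \<omega>"
  using dd_hit_le[of \<omega> r] by (intro hit_le) simp

text \<open>Heights are at most bases, so they reach \<open>R\<close> no later. This is how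
  horizontal type fixes the order of the two indices.\<close>

lemma kR_le_lR: "\<omega> \<in> \<Omega> \<Longrightarrow> 0 < R \<Longrightarrow> kR R \<omega> \<le> lR R \<omega>"
  using cc_hit_le[of \<omega> R] dd_le_cc[of \<omega> "lR R \<omega>"] by (intro hit_le) simp

lemma lR_bounded: assumes "0 < R" shows "\<exists>N. \<forall>\<omega>\<in>\<Omega>. lR R \<omega> \<le> N"
proof -
  obtain N where "\<theta> ^ N < R" using assms theta_less_1 real_arch_pow_inv by blast
  then show ?thesis using cc_le_theta by (meson hit_le less_imp_le order_trans)
qed

lemma lR_cong:
  assumes "\<omega> \<in> \<Omega>" "0 < R" "\<omega>' \<in> cell k (lR R \<omega>) \<omega>"
  shows "lR R \<omega>' = lR R \<omega>"
  using assms(3) by (intro hit_cong ex_hit_cc assms) (auto simp: cell_def col_def)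

lemma kR_cong:
  assumes "\<omega> \<in> \<Omega>" "0 < R" "\<omega>' \<in> cell (kR R \<omega>) l \<omega>"
  shows "kR R \<omega>' = kR R \<omega>"
  using assms(3) by (intro hit_cong ex_hit_dd assms) (auto simp: cell_def)

lemma stopping_square:
  assumes R: "0 < R" shows "stopping (kR R) (lR R)"
proof -
  obtain N where N: "\<And>\<omega>. \<omega> \<in> \<Omega> \<Longrightarrow> lR R \<omega> \<le> N" using lR_bounded[OF R] by blast
  show ?thesis
    by (rule stoppingI[OF kR_le_lR[OF _ R] N kR_cong[OF _ R] lR_cong[OF _ R]])
qed

lemma stopping_strip:
  assumes R: "0 < R" shows "stopping (kR R) (kR R)"
proof -
  obtain N where N: "\<And>\<omega>. \<omega> \<in> \<Omega> \<Longrightarrow> lR R \<omega> \<le> N" using lR_bounded[OF R] by blast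
  show ?thesis
    by (rule stoppingI[OF order.refl order_trans[OF kR_le_lR[OF _ R] N] kR_cong[OF _ R] kR_cong[OF _ R]])
qed

text \<open>Here the scale is the height of the strip itself. It is determined by the first
  \<open>k\<close> letters, which the cell fixes, so the stopping property of \<open>lR\<close> at a
  fixed scale still applies.\<close>

lemma stopping_level: "stopping (\<lambda>_. k) (\<lambda>\<omega>. lR (dd \<omega> k) \<omega>)"
proof -
  have le: "k \<le> lR (dd \<omega> k) \<omega>" if w: "\<omega> \<in> \<Omega>" for \<omega>
  proof (rule ccontr)
    let ?l = "lR (dd \<omega> k) \<omega>"
    assume "\<not> k \<le> ?l"
    then have "?l < k" by simp
    have "dd \<omega> k \<le> dd \<omega> (Suc ?l)" using \<open>?l < k\<close> by (intro dd_antimono w) simp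
    also have "\<dots> < dd \<omega> ?l * 1"
      unfolding scale_Suc using dd_pos[OF w] height_less Omega_D[OF w] by (intro mult_strict_left_mono) auto
    also have "\<dots> \<le> cc \<omega> ?l" using dd_le_cc[OF w] by simp
    also have "\<dots> \<le> dd \<omega> k" by (rule cc_hit_le[OF w dd_pos[OF w]])
    finally show False by simp
  qed
  \<comment> \<open>The scale varies with \<open>\<omega>\<close>; \<open>\<kappa> ^ k\<close> is a
    lower bound for all of them and gives one bound for \<open>l\<close>.\<close>
  obtain N where N: "\<forall>\<omega>\<in>\<Omega>. lR (\<kappa> ^ k) \<omega> \<le> N" using lR_bounded kappa_pos by (meson zero_less_power)
  have bd: "lR (dd \<omega> k) \<omega> \<le> N" if w: "\<omega> \<in> \<Omega>" for \<omega>
    using order_trans[OF lR_mono[OF w _ dd_ge_kappa[OF w]] N[rule_format, OF w]] kappa_pos by simp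
  have eqv: "lR (dd \<omega>' k) \<omega>' = lR (dd \<omega> k) \<omega>"
    if "\<omega> \<in> \<Omega>" "\<omega>' \<in> cell k (lR (dd \<omega> k) \<omega>) \<omega>" for \<omega> \<omega>'
    using lR_cong[OF that(1) dd_pos[OF that(1)] that(2)] cell_dd[OF that(2) order.refl] by simp
  show ?thesis by (rule stoppingI[OF le bd refl eqv])
qed

lemma stopping_const: "stopping (\<lambda>_. n) (\<lambda>_. n)"
  by (auto simp: stopping_def)

abbreviation sq :: "real \<Rightarrow> (nat \<Rightarrow> rect) \<Rightarrow> (nat \<Rightarrow> rect) set" where
  "sq R \<omega> \<equiv> cell (kR R \<omega>) (lR R \<omega>) \<omega>"

abbreviation squares :: "real \<Rightarrow> (nat \<Rightarrow> rect) set set" where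
  "squares R \<equiv> cells (kR R) (lR R)"

text \<open>If some columns differ before both \<open>l\<close>, the first such index separates the
  squares horizontally. Otherwise the stopping property forces equal \<open>l\<close>. Then some
  letters differ before both \<open>k\<close>, and since \<open>k \<le> l\<close> their columns
  still agree, which gives vertical separation.\<close>

lemma sq_separated:
  assumes w: "\<omega> \<in> \<Omega>" "\<omega>' \<in> \<Omega>" and R: "0 < R" "R \<le> 1" and neq: "\<omega>' \<notin> sq R \<omega>"
  shows "\<kappa> * R \<le> \<bar>xx \<omega> (lR R \<omega>) - xx \<omega>' (lR R \<omega>')\<bar> \<or> \<kappa> * R \<le> \<bar>yy \<omega> (kR R \<omega>) - yy \<omega>' (kR R \<omega>')\<bar>"
proof (cases "\<exists>m. m < lR R \<omega> \<and> m < lR R \<omega>' \<and> col (\<omega> m) \<noteq> col (\<omega>' m)")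
  case True
  define m where "m = (LEAST m. m < lR R \<omega> \<and> m < lR R \<omega>' \<and> col (\<omega> m) \<noteq> col (\<omega>' m))"
  have m: "m < lR R \<omega> \<and> m < lR R \<omega>' \<and> col (\<omega> m) \<noteq> col (\<omega>' m)"
    unfolding m_def using True by (rule LeastI_ex)
  have "col (\<omega> i) = col (\<omega>' i)" if "i < m" for i
    using not_less_Least[OF that[unfolded m_def]] that m by auto
  from x_separated[OF w this, of m "lR R \<omega>" "lR R \<omega>'"] m cc_hit_ge[OF w(1) R] cc_hit_ge[OF w(2) R]
  show ?thesis by force
next
  case False
  have ll: "lR R \<omega>' = lR R \<omega>"
  proof (cases "lR R \<omega> \<le> lR R \<omega>'")
    case True
    with False w have "\<omega>' \<in> cell 0 (lR R \<omega>) \<omega>" by (auto simp: cell_def)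
    then show ?thesis by (rule lR_cong[OF w(1) R(1)])
  next
    case F: False
    with False w have "\<omega> \<in> cell 0 (lR R \<omega>') \<omega>'" by (auto simp: cell_def)
    then show ?thesis using lR_cong[OF w(2) R(1)] by simp
  qed
  have k: "\<exists>m. m < kR R \<omega> \<and> m < kR R \<omega>' \<and> \<omega> m \<noteq> \<omega>' m"
  proof (rule ccontr)
    assume *: "\<not> ?thesis"
    have kk: "kR R \<omega>' = kR R \<omega>"
    proof (cases "kR R \<omega> \<le> kR R \<omega>'")
      case True
      with * w have "\<omega>' \<in> cell (kR R \<omega>) 0 \<omega>" by (auto simp: cell_def)
      then show ?thesis by (rule kR_cong[OF w(1) R(1)])
    next
      case F: False
      with * w have "\<omega> \<in> cell (kR R \<omega>') 0 \<omega>'" by (auto simp: cell_def)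
      then show ?thesis using kR_cong[OF w(2) R(1)] by simp
    qed
    have "\<omega>' \<in> sq R \<omega>" using * False w kk ll by (auto simp: cell_def)
    with neq show False by blast
  qed
  define m where "m = (LEAST m. m < kR R \<omega> \<and> m < kR R \<omega>' \<and> \<omega> m \<noteq> \<omega>' m)"
  have m: "m < kR R \<omega> \<and> m < kR R \<omega>' \<and> \<omega> m \<noteq> \<omega>' m"
    unfolding m_def using k by (rule LeastI_ex)
  have "\<omega> i = \<omega>' i" if "i < m" for i
    using not_less_Least[OF that[unfolded m_def]] that m by auto
  moreover have "col (\<omega> m) = col (\<omega>' m)"
    using False m kR_le_lR[OF w(1) R(1)] kR_le_lR[OF w(2) R(1)] by fastforce
  ultimately show ?thesis
    using y_separated[OF w, of m "kR R \<omega>" "kR R \<omega>'"] m dd_hit_ge[OF w(1) R] dd_hit_ge[OF w(2) R]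
    by force
qed

text \<open>A corner within \<open>(1 + z) * R\<close> of a fixed point has at most
  \<open>2 * (1 + z) / \<kappa> + 2\<close> roundings to mesh \<open>\<kappa> * R\<close> in each
  coordinate.\<close>

definition pack :: "real \<Rightarrow> real" where
  "pack z = (2 * (1 + z) / \<kappa> + 2)\<^sup>2"

text \<open>
  Different approximate squares of one scale are separated in one coordinate, so the lower left
  corners rounded to the grid of mesh \<open>\<kappa> R\<close> are distinct.
\<close>

lemma squares_meeting:
  assumes R: "0 < R" "R \<le> 1" and z: "0 \<le> z" and V: "\<And>x y. x \<in> V \<Longrightarrow> y \<in> V \<Longrightarrow> dist x y \<le> z * R"
  shows "real (card {Q \<in> squares R. \<exists>\<omega>\<in>Q. pt \<omega> \<in> V}) \<le> pack z"
proof (cases "{Q \<in> squares R. \<exists>\<omega>\<in>Q. pt \<omega> \<in> V} = {}")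
  case True
  then show ?thesis by (simp only: True) (simp add: pack_def)
next
  case False
  let ?S = "{Q \<in> squares R. \<exists>\<omega>\<in>Q. pt \<omega> \<in> V}"
  from False obtain \<omega>0 where w0: "\<omega>0 \<in> \<Omega>" "pt \<omega>0 \<in> V" using cells_subset by blast
  define d where "d = \<kappa> * R"
  have d: "0 < d" using R kappa_pos by (simp add: d_def)
  define lab where "lab \<omega> = (\<lfloor>xx \<omega> (lR R \<omega>) / d\<rfloor>, \<lfloor>yy \<omega> (kR R \<omega>) / d\<rfloor>)" for \<omega>
  define rep where "rep Q = (SOME \<omega>. \<omega> \<in> Q \<and> pt \<omega> \<in> V)" for Q
  have rep: "rep Q \<in> Q" "pt (rep Q) \<in> V" "rep Q \<in> \<Omega>" if "Q \<in> ?S" for Q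
  proof -
    have "\<exists>\<omega>. \<omega> \<in> Q \<and> pt \<omega> \<in> V" using that by blast
    from someI_ex[OF this] show "rep Q \<in> Q" "pt (rep Q) \<in> V" by (auto simp: rep_def)
    then show "rep Q \<in> \<Omega>" using that cells_subset by blast
  qed
  have inj: "inj_on (\<lambda>Q. lab (rep Q)) ?S"
  proof (rule inj_onI, rule ccontr)
    fix Q Q' assume Q: "Q \<in> ?S" "Q' \<in> ?S" and e: "lab (rep Q) = lab (rep Q')" and "Q \<noteq> Q'"
    have "rep Q' \<notin> sq R (rep Q)"
      using \<open>Q \<noteq> Q'\<close> Q rep[OF Q(1)] rep[OF Q(2)] cells_eq[OF stopping_square[OF R(1)]]
        stopping_cell_eq[OF stopping_square[OF R(1)], of "rep Q" "rep Q'"] by blast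
    from sq_separated[OF rep(3)[OF Q(1)] rep(3)[OF Q(2)] R this] e
    show False using floor_eq_dist[OF d] unfolding lab_def d_def by fastforce
  qed
  let ?B = "\<lambda>u. {\<lfloor>(u - (1 + z) * R) / d\<rfloor> .. \<lfloor>(u + (1 + z) * R) / d\<rfloor>}"
  have cB: "finite (?B u)" "real (card (?B u)) \<le> 2 * (1 + z) / \<kappa> + 2" for u
  proof -
    have "real (card (?B u)) \<le> (u + (1 + z) * R) / d - (u - (1 + z) * R) / d + 2"
      using R z d by (intro card_floor_interval divide_right_mono) auto
    also have "\<dots> = 2 * (1 + z) / \<kappa> + 2" using R kappa_pos by (simp add: d_def field_simps)
    finally show "real (card (?B u)) \<le> 2 * (1 + z) / \<kappa> + 2" .
  qed simp
  have sub: "(\<lambda>Q. lab (rep Q)) ` ?S \<subseteq> ?B (fst (pt \<omega>0)) \<times> ?B (snd (pt \<omega>0))"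
  proof (rule image_subsetI)
    fix Q assume Q: "Q \<in> ?S"
    note w = rep(3)[OF Q]
    let ?w = "rep Q"
    have dist: "dist (pt ?w) (pt \<omega>0) \<le> z * R" using V rep(2)[OF Q] w0(2) by blast
    have "dist (fst (pt ?w)) (fst (pt \<omega>0)) \<le> z * R" "dist (snd (pt ?w)) (snd (pt \<omega>0)) \<le> z * R"
      using dist dist_fst_le[of "pt ?w" "pt \<omega>0"] dist_snd_le[of "pt ?w" "pt \<omega>0"] by auto
    \<comment> \<open>One \<open>R\<close> for the way from the corner to its own point, and
      \<open>z * R\<close> from there to \<open>pt \<omega>0\<close>.\<close>
    then have "\<bar>xx ?w (lR R ?w) - fst (pt \<omega>0)\<bar> \<le> (1 + z) * R" "\<bar>yy ?w (kR R ?w) - snd (pt \<omega>0)\<bar> \<le> (1 + z) * R"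
      using pt_in[OF w, of "lR R ?w"] pt_in[OF w, of "kR R ?w"] cc_hit_le[OF w R(1)] dd_hit_le[OF w R(1)]
      by (auto simp: dist_real_def algebra_simps abs_le_iff)
    then show "lab (rep Q) \<in> ?B (fst (pt \<omega>0)) \<times> ?B (snd (pt \<omega>0))"
      using d by (auto simp: lab_def abs_le_iff intro!: floor_mono divide_right_mono)
  qed
  have "card ?S \<le> card (?B (fst (pt \<omega>0)) \<times> ?B (snd (pt \<omega>0)))"
    by (rule card_inj_on_le[OF inj sub]) simp
  then have "real (card ?S) \<le> real (card (?B (fst (pt \<omega>0)))) * real (card (?B (snd (pt \<omega>0))))"
    by (simp only: card_cartesian_product of_nat_mult[symmetric] of_nat_le_iff)
  also have "\<dots> \<le> (2 * (1 + z) / \<kappa> + 2) * (2 * (1 + z) / \<kappa> + 2)"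
    using z kappa_pos by (intro mult_mono cB) auto
  finally show ?thesis by (simp add: pack_def power2_eq_square)
qed

end

section \<open>Dimensions via approximate squares\<close>

lemma covering_number_le:
  assumes "finite \<U>" "E \<subseteq> \<Union>\<U>" "\<And>U. U \<in> \<U> \<Longrightarrow> open U \<and> bounded U \<and> diameter U \<le> r"
  shows "covering_number r E \<le> card \<U>"
  unfolding covering_number_def using assms by (intro cInf_lower) auto

text \<open>The given cover makes the set of cardinalities nonempty, and a nonempty set of naturals
  contains its infimum.\<close>

lemma covering_number_attained:
  assumes "finite \<U>" "E \<subseteq> \<Union>\<U>" "\<And>U. U \<in> \<U> \<Longrightarrow> open U \<and> bounded U \<and> diameter U \<le> r"
  obtains \<V> where "finite \<V>" "E \<subseteq> \<Union>\<V>" "\<And>U. U \<in> \<V> \<Longrightarrow> open U \<and> bounded U \<and> diameter U \<le> r"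
    "card \<V> = covering_number r E"
proof -
  let ?S = "{card \<U> | \<U>. finite \<U> \<and> E \<subseteq> \<Union>\<U> \<and> (\<forall>U\<in>\<U>. open U \<and> bounded U \<and> diameter U \<le> r)}"
  have "?S \<noteq> {}" using assms by blast
  then have "Inf ?S \<in> ?S" by (rule Inf_nat_def1)
  then obtain \<V> where "finite \<V>" "E \<subseteq> \<Union>\<V>" "\<forall>U\<in>\<V>. open U \<and> bounded U \<and> diameter U \<le> r" "card \<V> = Inf ?S"
    by auto
  then show ?thesis by (intro that[of \<V>]) (auto simp: covering_number_def)
qed

lemma powr_le_powr_imp_le:
  assumes "0 < c" "0 < C" and ex: "\<And>K. 0 < K \<Longrightarrow> \<exists>t. K \<le> t \<and> c * t powr \<sigma> \<le> C * t powr \<alpha>"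
  shows "\<sigma> \<le> (\<alpha>::real)"
proof (rule ccontr)
  assume "\<not> \<sigma> \<le> \<alpha>"
  then have d: "0 < \<sigma> - \<alpha>" by simp
  \<comment> \<open>From \<open>K\<close> on, \<open>t powr (\<sigma> - \<alpha>)\<close> is at
    least \<open>C / c + 1\<close>, while the assumed inequality bounds it by
    \<open>C / c\<close>.\<close>
  define K where "K = (C / c + 1) powr (1 / (\<sigma> - \<alpha>))"
  have "0 < C / c" using assms by simp
  then have "0 < K" by (simp add: K_def)
  then obtain t where t: "K \<le> t" "c * t powr \<sigma> \<le> C * t powr \<alpha>" using ex by blast
  have "0 < t" using \<open>0 < K\<close> t by simp
  have "C / c + 1 = K powr (\<sigma> - \<alpha>)" using d \<open>0 < C / c\<close> by (simp add: K_def powr_powr)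
  also have "\<dots> \<le> t powr (\<sigma> - \<alpha>)" using t \<open>0 < K\<close> d by (intro powr_mono2) auto
  also have "\<dots> \<le> C / c"
    using t(2) \<open>0 < t\<close> assms by (simp add: powr_diff field_simps)
  finally show False by simp
qed

lemma box_dim_eqI:
  assumes c: "0 < c" "0 < C" and r0: "0 < r0"
    and lo: "\<And>r. 0 < r \<Longrightarrow> r \<le> r0 \<Longrightarrow> c * r powr (- b) \<le> real (covering_number r E)"
    and up: "\<And>r. 0 < r \<Longrightarrow> r \<le> r0 \<Longrightarrow> real (covering_number r E) \<le> C * r powr (- b)"
  shows "box_dim_exists E" "box_dim E = b"
proof -
  let ?f = "\<lambda>r. ln (real (covering_number r E)) / (- ln r)"
  have lim: "((\<lambda>r. ln K / (- ln r) + b) \<longlongrightarrow> b) (at_right (0::real))" for K :: real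
  proof -
    have "filterlim (\<lambda>r::real. - ln r) at_top (at_right 0)"
      using ln_at_0 by (simp add: filterlim_uminus_at_top)
    then have "((\<lambda>r. ln K / (- ln r)) \<longlongrightarrow> 0) (at_right (0::real))"
      by (rule tendsto_divide_0[OF tendsto_const filterlim_at_top_imp_at_infinity])
    from tendsto_add[OF this tendsto_const[of b]] show ?thesis by simp
  qed
  have bounds: "ln c / (- ln r) + b \<le> ?f r \<and> ?f r \<le> ln C / (- ln r) + b"
    if r: "0 < r" "r \<le> r0" "r < 1" for r
  proof -
    have l: "0 < - ln r" using r by simp
    have pos: "0 < c * r powr (-b)" using c r by simp
    have "ln (c * r powr (-b)) \<le> ln (real (covering_number r E))"
      using lo[OF r(1,2)] pos by (subst ln_le_cancel_iff) auto
    moreover have "ln (real (covering_number r E)) \<le> ln (C * r powr (-b))"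
      using lo[OF r(1,2)] up[OF r(1,2)] pos by (subst ln_le_cancel_iff) auto
    moreover have "ln (K * r powr (-b)) = ln K + b * (- ln r)" if "0 < K" for K
      using r that by (simp add: ln_mult ln_powr)
    ultimately have "ln c + b * (- ln r) \<le> ln (real (covering_number r E))"
      "ln (real (covering_number r E)) \<le> ln C + b * (- ln r)" using c by auto
    then have "(ln c + b * (- ln r)) / (- ln r) \<le> ?f r" "?f r \<le> (ln C + b * (- ln r)) / (- ln r)"
      using l by (intro divide_right_mono; simp)+
    then show ?thesis using l by (simp add: add_divide_distrib diff_divide_distrib)
  qed
  have ev: "\<forall>\<^sub>F r in at_right 0. 0 < r \<and> r \<le> r0 \<and> r < 1"
    using r0 by (auto simp: eventually_at_right_field intro!: exI[of _ "min r0 1"])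
  have "(?f \<longlongrightarrow> b) (at_right 0)"
    by (rule tendsto_sandwich[OF _ _ lim[of c] lim[of C]])
      (rule eventually_mono[OF ev], use bounds in blast)+
  then show "box_dim_exists E" "box_dim E = b"
    by (auto simp: box_dim_exists_def box_dim_def intro: tendsto_Lim)
qed

lemma hausdorff_measure_eq_0I:
  assumes "\<And>\<epsilon>. 0 < \<epsilon> \<Longrightarrow> \<exists>\<U>. finite \<U> \<and> E \<subseteq> \<Union>\<U> \<and> (\<forall>U\<in>\<U>. bounded U \<and> diameter U \<le> \<epsilon>) \<and>
      (\<Sum>U\<in>\<U>. diameter U powr s) \<le> \<epsilon>"
  shows "hausdorff_measure s E = 0"
proof -
  have bd: "hausdorff_pre_measure s \<delta> E \<le> ennreal \<epsilon>" if d: "0 < \<delta>" and e: "0 < \<epsilon>" for \<delta> \<epsilon>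
  proof -
    obtain \<U> where U: "finite \<U>" "E \<subseteq> \<Union>\<U>" "\<And>U. U \<in> \<U> \<Longrightarrow> bounded U \<and> diameter U \<le> min \<delta> \<epsilon>"
      "(\<Sum>U\<in>\<U>. diameter U powr s) \<le> min \<delta> \<epsilon>"
      using assms[of "min \<delta> \<epsilon>"] d e by auto
    obtain f n where f: "\<U> = f ` {i::nat. i < n}" "inj_on f {i. i < n}"
      using finite_imp_nat_seg_image_inj_on[OF U(1)] by blast
    \<comment> \<open>Padding with empty sets is free: their diameter is 0, and
      \<open>0 powr s = 0\<close>.\<close>
    define V where "V i = (if i < n then f i else {})" for i
    have "hausdorff_pre_measure s \<delta> E \<le> (\<Sum>i. ennreal (diameter (V i) powr s))"
      unfolding hausdorff_pre_measure_def
    proof (rule INF_lower, safe)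
      fix x assume "x \<in> E"
      then obtain i where "i < n" "x \<in> f i" using U(2) by (auto simp: f(1))
      then show "x \<in> \<Union>(range V)" by (auto simp: V_def)
    next
      fix i show "bounded (V i)" "diameter (V i) \<le> \<delta>"
        using U(3) d by (auto simp: V_def f(1))
    qed
    also have "\<dots> = (\<Sum>i<n. ennreal (diameter (V i) powr s))"
      by (rule suminf_finite) (auto simp: V_def)
    also have "\<dots> = (\<Sum>i<n. ennreal (diameter (f i) powr s))" by (simp add: V_def)
    also have "\<dots> = (\<Sum>U\<in>\<U>. ennreal (diameter U powr s))"
      using f(2) unfolding f(1) by (subst sum.reindex) (auto simp: lessThan_def)
    also have "\<dots> = ennreal (\<Sum>U\<in>\<U>. diameter U powr s)" by (rule sum_ennreal) simp
    also have "\<dots> \<le> ennreal \<epsilon>" using U(4) by (intro ennreal_leI) simp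
    finally show ?thesis .
  qed
  have le: "hausdorff_pre_measure s \<delta> E \<le> 0" if "0 < \<delta>" for \<delta>
    by (rule ennreal_le_epsilon) (simp add: bd[OF that])
  have "hausdorff_measure s E \<le> 0"
    unfolding hausdorff_measure_def by (rule SUP_least) (simp only: greaterThan_iff le)
  then show ?thesis by simp
qed

lemma dist_le_abs: "dist (x::real \<times> real) y \<le> \<bar>fst x - fst y\<bar> + \<bar>snd x - snd y\<bar>"
  using norm_Pair_le[of "fst x - fst y" "snd x - snd y"] by (simp add: dist_norm minus_prod_def)

context carpet
begin

definition hits :: "real \<Rightarrow> (real \<times> real) set \<Rightarrow> (nat \<Rightarrow> rect) set set" where
  "hits R V = {Q \<in> squares R. \<exists>\<omega>\<in>Q. pt \<omega> \<in> V}"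

lemma hits_subset: "hits R V \<subseteq> squares R"
  by (auto simp: hits_def)

lemma finite_hits: "0 < R \<Longrightarrow> finite (hits R V)"
  using finite_cells[OF stopping_square] hits_subset by (rule finite_subset[rotated])

lemma hitsI: "\<omega> \<in> \<Omega> \<Longrightarrow> pt \<omega> \<in> V \<Longrightarrow> sq R \<omega> \<in> hits R V"
  using cell_self by (auto simp: hits_def cells_def)

lemma card_hits_le:
  assumes "0 < R" "R \<le> 1" "0 \<le> z" "\<And>x y. x \<in> V \<Longrightarrow> y \<in> V \<Longrightarrow> dist x y \<le> z * R"
  shows "real (card (hits R V)) \<le> pack z"
  unfolding hits_def using assms by (rule squares_meeting)

lemma pack_pos: "0 \<le> z \<Longrightarrow> 0 < pack z"
  unfolding pack_def using kappa_pos by (intro zero_less_power add_nonneg_pos divide_nonneg_pos) auto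

lemma dist_pt_cell:
  assumes w: "\<omega> \<in> \<Omega>" and w': "\<omega>' \<in> cell k l \<omega>"
  shows "dist (pt \<omega>) (pt \<omega>') \<le> cc \<omega> l + dd \<omega> k"
proof -
  have "\<omega>' \<in> \<Omega>" using w' by (simp add: cell_def)
  have e: "xx \<omega>' l = xx \<omega> l" "cc \<omega>' l = cc \<omega> l" "yy \<omega>' k = yy \<omega> k" "dd \<omega>' k = dd \<omega> k"
    using w' by (auto simp: cell_def col_def intro!: offset_cong scale_cong)
  show ?thesis
    using dist_le_abs[of "pt \<omega>" "pt \<omega>'"] pt_in[OF w, of l] pt_in[OF w, of k]
      pt_in[OF \<open>\<omega>' \<in> \<Omega>\<close>, of l] pt_in[OF \<open>\<omega>' \<in> \<Omega>\<close>, of k] unfolding e by linarith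
qed

lemma dist_pt_sq: "\<omega> \<in> \<Omega> \<Longrightarrow> 0 < R \<Longrightarrow> \<omega>' \<in> sq R \<omega> \<Longrightarrow> dist (pt \<omega>) (pt \<omega>') \<le> 2 * R"
  using dist_pt_cell[of \<omega> \<omega>'] cc_hit_le[of \<omega> R] dd_hit_le[of \<omega> R] by fastforce

lemma ex_cover:
  assumes r: "0 < r" and E: "E \<subseteq> F"
  shows "\<exists>\<U>. finite \<U> \<and> E \<subseteq> \<Union>\<U> \<and> (\<forall>U\<in>\<U>. open U \<and> bounded U \<and> diameter U \<le> r) \<and>
    card \<U> \<le> card (hits (r / 5) E)"
proof -
  define rep where "rep Q = (SOME \<omega>. \<omega> \<in> Q)" for Q :: "(nat \<Rightarrow> rect) set"
  \<comment> \<open>All points of a square of scale \<open>r / 5\<close> are within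
    \<open>2 * r / 5\<close> of the representative, hence in the open ball of radius
    \<open>r / 2\<close>, whose diameter is at most \<open>r\<close>.\<close>
  let ?U = "(\<lambda>Q. ball (pt (rep Q)) (r / 2)) ` hits (r / 5) E"
  have "E \<subseteq> \<Union>?U"
  proof
    fix x assume x: "x \<in> E"
    then obtain \<omega> where w: "\<omega> \<in> \<Omega>" "pt \<omega> = x" using E F_code by blast
    have h: "sq (r / 5) \<omega> \<in> hits (r / 5) E" using w x by (intro hitsI) auto
    have "rep (sq (r / 5) \<omega>) \<in> sq (r / 5) \<omega>"
      unfolding rep_def by (rule someI[where x = \<omega>]) (rule cell_self[OF w(1)])
    from dist_pt_sq[OF w(1) _ this] r have "dist (pt \<omega>) (pt (rep (sq (r / 5) \<omega>))) < r / 2" by simp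
    then have "x \<in> ball (pt (rep (sq (r / 5) \<omega>))) (r / 2)" using w by (simp add: dist_commute)
    then show "x \<in> \<Union>?U" using h by blast
  qed
  moreover have "card ?U \<le> card (hits (r / 5) E)" "finite ?U"
    using finite_hits[of "r / 5" E] r by (auto intro: card_image_le)
  moreover have "open U \<and> bounded U \<and> diameter U \<le> r" if "U \<in> ?U" for U
    using that r by auto
  ultimately show ?thesis by blast
qed

lemma covering_number_le_hits:
  assumes "0 < r" "E \<subseteq> F"
  shows "covering_number r E \<le> card (hits (r / 5) E)"
proof -
  obtain \<U> where U: "finite \<U>" "E \<subseteq> \<Union>\<U>" "\<And>U. U \<in> \<U> \<Longrightarrow> open U \<and> bounded U \<and> diameter U \<le> r"
    "card \<U> \<le> card (hits (r / 5) E)"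
    using ex_cover[OF assms] by blast
  show ?thesis using covering_number_le[OF U(1-3)] U(4) by simp
qed

lemma covering_number_cover:
  assumes "0 < r" "E \<subseteq> F"
  obtains \<V> where "finite \<V>" "E \<subseteq> \<Union>\<V>" "\<And>U. U \<in> \<V> \<Longrightarrow> open U \<and> bounded U \<and> diameter U \<le> r"
    "card \<V> = covering_number r E"
proof -
  obtain \<U> where U: "finite \<U>" "E \<subseteq> \<Union>\<U>" "\<And>U. U \<in> \<U> \<Longrightarrow> open U \<and> bounded U \<and> diameter U \<le> r"
    using ex_cover[OF assms] by blast
  obtain \<V> where V: "finite \<V>" "E \<subseteq> \<Union>\<V>" "\<And>U. U \<in> \<V> \<Longrightarrow> open U \<and> bounded U \<and> diameter U \<le> r"
    "card \<V> = covering_number r E"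
    using covering_number_attained[OF U] by blast
  then show ?thesis by (rule that)
qed

text \<open>Each set of an optimal cover has diameter at most \<open>r\<close>, so it meets at most
  \<open>pack 1\<close> squares of scale \<open>r\<close>.\<close>

lemma hits_le_covering_number:
  assumes r: "0 < r" "r \<le> 1" and E: "E \<subseteq> F"
  shows "real (card (hits r E)) \<le> pack 1 * real (covering_number r E)"
proof -
  obtain \<V> where V: "finite \<V>" "E \<subseteq> \<Union>\<V>" "\<And>U. U \<in> \<V> \<Longrightarrow> open U \<and> bounded U \<and> diameter U \<le> r"
    "card \<V> = covering_number r E"
    using covering_number_cover[OF r(1) E] by blast
  have "hits r E \<subseteq> (\<Union>U\<in>\<V>. hits r U)" using V(2) by (fastforce simp: hits_def)
  then have "card (hits r E) \<le> card (\<Union>U\<in>\<V>. hits r U)"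
    using V(1) finite_hits[OF r(1)] by (intro card_mono) auto
  also have "\<dots> \<le> (\<Sum>U\<in>\<V>. card (hits r U))" by (rule card_UN_le[OF V(1)])
  finally have "real (card (hits r E)) \<le> (\<Sum>U\<in>\<V>. real (card (hits r U)))"
    by (simp flip: of_nat_sum)
  also have "\<dots> \<le> (\<Sum>U\<in>\<V>. pack 1)"
  proof (rule sum_mono)
    fix U assume U: "U \<in> \<V>"
    show "real (card (hits r U)) \<le> pack 1"
    proof (rule card_hits_le[OF r])
      fix x y assume "x \<in> U" "y \<in> U"
      then show "dist x y \<le> 1 * r"
        using diameter_bounded_bound[of U x y] V(3)[OF U] by simp
    qed simp
  qed
  also have "\<dots> = pack 1 * real (covering_number r E)" by (simp add: V(4))
  finally show ?thesis .
qed

lemma covering_number_ge_1: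
  assumes "0 < r" "E \<subseteq> F" "E \<noteq> {}"
  shows "1 \<le> covering_number r E"
proof -
  obtain \<V> where V: "finite \<V>" "E \<subseteq> \<Union>\<V>" "card \<V> = covering_number r E"
    using covering_number_cover[OF assms(1,2)] by metis
  have "\<V> \<noteq> {}" using V(2) assms(3) by auto
  then show ?thesis using V by (metis card_gt_0_iff One_nat_def Suc_leI)
qed

section \<open>Covering numbers of balls, and the Assouad and lower exponents\<close>

abbreviation NN :: "real \<Rightarrow> real \<Rightarrow> real \<times> real \<Rightarrow> real" where
  "NN r R x \<equiv> real (covering_number r (cball x R \<inter> F))"

lemma NN_ge_1: "0 < r \<Longrightarrow> 0 \<le> R \<Longrightarrow> x \<in> F \<Longrightarrow> 1 \<le> NN r R x"
proof -
  assume "0 < r" "0 \<le> R" "x \<in> F"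
  then have "x \<in> cball x R \<inter> F" by simp
  then have "cball x R \<inter> F \<noteq> {}" by blast
  with \<open>0 < r\<close> have "1 \<le> covering_number r (cball x R \<inter> F)" by (intro covering_number_ge_1) auto
  then show ?thesis by simp
qed

text \<open>A crude planar count. It keeps the set of Assouad exponents nonempty and the lower
  exponents bounded above, as the real-valued \<open>Inf\<close> and \<open>Sup\<close>
  require.\<close>

lemma NN_le_square:
  assumes "0 < r" "r < R" "R \<le> 1" "x \<in> F"
  shows "NN r R x \<le> (22 / \<kappa> + 2)\<^sup>2 * (R / r) powr 2"
proof -
  define z where "z = R / r"
  have z: "1 \<le> z" using assms by (simp add: z_def)
  have "NN r R x \<le> real (card (hits (r / 5) (cball x R \<inter> F)))"
    using covering_number_le_hits[of r "cball x R \<inter> F"] assms by simp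
  also have "\<dots> \<le> pack (10 * z)"
  proof (rule card_hits_le)
    fix a b assume "a \<in> cball x R \<inter> F" "b \<in> cball x R \<inter> F"
    then show "dist a b \<le> 10 * z * (r / 5)"
      using dist_triangle2[of a b x] assms by (auto simp: z_def dist_commute)
  qed (use assms z in auto)
  also have "\<dots> \<le> ((22 / \<kappa> + 2) * z)\<^sup>2"
    unfolding pack_def
  proof (rule power_mono)
    have "2 * (1 + 10 * z) / \<kappa> \<le> 22 * z / \<kappa>" using z kappa_pos by (intro divide_right_mono) auto
    then show "2 * (1 + 10 * z) / \<kappa> + 2 \<le> (22 / \<kappa> + 2) * z"
      using z by (simp add: algebra_simps)
    show "0 \<le> 2 * (1 + 10 * z) / \<kappa> + 2" using z kappa_pos by simp
  qed
  finally show ?thesis using assms by (simp add: power_mult_distrib power_divide z_def powr_numeral)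
qed

definition assouad_bound :: "real \<Rightarrow> bool" where
  "assouad_bound \<alpha> \<longleftrightarrow> (\<exists>C>0. \<exists>\<rho>>0. \<forall>r R. 0 < r \<and> r < R \<and> R \<le> \<rho> \<longrightarrow> (\<forall>x\<in>F. NN r R x \<le> C * (R / r) powr \<alpha>))"

definition lower_bound :: "real \<Rightarrow> bool" where
  "lower_bound \<alpha> \<longleftrightarrow> (\<exists>C>0. \<exists>\<rho>>0. \<forall>r R. 0 < r \<and> r < R \<and> R \<le> \<rho> \<longrightarrow> (\<forall>x\<in>F. C * (R / r) powr \<alpha> \<le> NN r R x))"

lemma assouad_dim_eq: "assouad_dim F = Inf {\<alpha>. assouad_bound \<alpha>}"
  by (simp add: assouad_dim_def assouad_bound_def SUP_le_iff)

lemma lower_dim_eq: "lower_dim F = Sup {\<alpha>. lower_bound \<alpha>}"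
  by (simp add: lower_dim_def lower_bound_def le_INF_iff)

lemma assouad_bound_2: "assouad_bound 2"
  unfolding assouad_bound_def using NN_le_square kappa_pos
  by (intro exI[of _ "(22 / \<kappa> + 2)\<^sup>2"] exI[of _ 1] conjI zero_less_power add_pos_pos) auto

lemma lower_bound_0: "lower_bound 0"
  unfolding lower_bound_def using NN_ge_1
  by (intro exI[of _ 1] conjI) (auto simp: powr_zero_eq_one)

text \<open>Both bounds apply to the same point and the same \<open>R\<close>, and
  \<open>r = R / t\<close> lets the ratio tend to infinity.\<close>

lemma lower_bound_le_assouad_bound:
  assumes "assouad_bound \<alpha>" "lower_bound \<sigma>"
  shows "\<sigma> \<le> \<alpha>"
proof -
  obtain C \<rho> where C: "0 < C" "0 < \<rho>"
    "\<And>r R x. 0 < r \<Longrightarrow> r < R \<Longrightarrow> R \<le> \<rho> \<Longrightarrow> x \<in> F \<Longrightarrow> NN r R x \<le> C * (R / r) powr \<alpha>"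
    using assms(1) unfolding assouad_bound_def by blast
  obtain c \<rho>' where c: "0 < c" "0 < \<rho>'"
    "\<And>r R x. 0 < r \<Longrightarrow> r < R \<Longrightarrow> R \<le> \<rho>' \<Longrightarrow> x \<in> F \<Longrightarrow> c * (R / r) powr \<sigma> \<le> NN r R x"
    using assms(2) unfolding lower_bound_def by blast
  obtain x where x: "x \<in> F" using F_nonempty by auto
  define R where "R = min \<rho> \<rho>'"
  have R: "0 < R" "R \<le> \<rho>" "R \<le> \<rho>'" using C c by (auto simp: R_def)
  show ?thesis
  proof (rule powr_le_powr_imp_le[OF c(1) C(1)])
    fix K :: real assume "0 < K"
    define t where "t = K + 1"
    have t: "1 < t" using \<open>0 < K\<close> by (simp add: t_def)
    have r: "0 < R / t" "R / t < R" "R / (R / t) = t" using R t by (auto simp: field_simps)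
    show "\<exists>t\<ge>K. c * t powr \<sigma> \<le> C * t powr \<alpha>"
      using c(3)[OF r(1,2) R(3) x] C(3)[OF r(1,2) R(2) x] unfolding r(3)
      by (intro exI[of _ t]) (auto simp: t_def)
  qed
qed

lemma assouad_dim_le:
  assumes "assouad_bound \<alpha>" shows "assouad_dim F \<le> \<alpha>"
  unfolding assouad_dim_eq using assms lower_bound_le_assouad_bound[OF _ lower_bound_0]
  by (intro cInf_lower bdd_belowI[of _ 0]) auto

lemma le_lower_dim:
  assumes "lower_bound \<alpha>" shows "\<alpha> \<le> lower_dim F"
  unfolding lower_dim_eq using assms lower_bound_le_assouad_bound[OF assouad_bound_2]
  by (intro cSup_upper bdd_aboveI[of _ 2]) auto

text \<open>An admissible exponent comes with unknown \<open>C\<close> and \<open>\<rho>\<close>;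
  hence the witnesses must have arbitrarily small \<open>R\<close> and arbitrarily large
  \<open>R / r\<close>, while \<open>c\<close> stays fixed.\<close>

lemma le_assouad_dim:
  assumes c: "0 < c" and ex: "\<And>K \<rho>. 0 < K \<Longrightarrow> 0 < \<rho> \<Longrightarrow>
      \<exists>r R x. 0 < r \<and> r < R \<and> R \<le> \<rho> \<and> K \<le> R / r \<and> x \<in> F \<and> c * (R / r) powr \<sigma> \<le> NN r R x"
  shows "\<sigma> \<le> assouad_dim F"
  unfolding assouad_dim_eq
proof (rule cInf_greatest)
  show "{\<alpha>. assouad_bound \<alpha>} \<noteq> {}" using assouad_bound_2 by auto
next
  fix \<alpha> assume "\<alpha> \<in> {\<alpha>. assouad_bound \<alpha>}"
  then obtain C \<rho> where C: "0 < C" "0 < \<rho>"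
    "\<And>r R x. 0 < r \<Longrightarrow> r < R \<Longrightarrow> R \<le> \<rho> \<Longrightarrow> x \<in> F \<Longrightarrow> NN r R x \<le> C * (R / r) powr \<alpha>"
    unfolding assouad_bound_def by blast
  show "\<sigma> \<le> \<alpha>"
  proof (rule powr_le_powr_imp_le[OF c C(1)])
    fix K :: real assume "0 < K"
    then show "\<exists>t\<ge>K. c * t powr \<sigma> \<le> C * t powr \<alpha>"
      using ex[OF _ C(2), of K] C(3) by (meson order_trans)
  qed
qed

lemma lower_dim_le:
  assumes c: "0 < c" and ex: "\<And>K \<rho>. 0 < K \<Longrightarrow> 0 < \<rho> \<Longrightarrow>
      \<exists>r R x. 0 < r \<and> r < R \<and> R \<le> \<rho> \<and> K \<le> R / r \<and> x \<in> F \<and> NN r R x \<le> c * (R / r) powr \<sigma>"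
  shows "lower_dim F \<le> \<sigma>"
  unfolding lower_dim_eq
proof (rule cSup_least)
  show "{\<alpha>. lower_bound \<alpha>} \<noteq> {}" using lower_bound_0 by auto
next
  fix \<alpha> assume "\<alpha> \<in> {\<alpha>. lower_bound \<alpha>}"
  then obtain C \<rho> where C: "0 < C" "0 < \<rho>"
    "\<And>r R x. 0 < r \<Longrightarrow> r < R \<Longrightarrow> R \<le> \<rho> \<Longrightarrow> x \<in> F \<Longrightarrow> C * (R / r) powr \<alpha> \<le> NN r R x"
    unfolding lower_bound_def by blast
  show "\<alpha> \<le> \<sigma>"
  proof (rule powr_le_powr_imp_le[OF C(1) c])
    fix K :: real assume "0 < K"
    then show "\<exists>t\<ge>K. C * t powr \<alpha> \<le> c * t powr \<sigma>"
      using ex[OF _ C(2), of K] C(3) by (meson order_trans)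
  qed
qed

section \<open>Counting squares by mass, and the mass distribution principle\<close>

lemma card_times_mass_le:
  assumes W: "probs W" and st: "stopping k l" and C: "\<C> \<subseteq> cells k l"
    and A: "\<Union>\<C> \<subseteq> A" "A \<in> sets (\<mu> W)" and m: "\<And>Q. Q \<in> \<C> \<Longrightarrow> m \<le> measure (\<mu> W) Q"
  shows "real (card \<C>) * m \<le> measure (\<mu> W) A"
proof -
  interpret prob_space "\<mu> W" by (rule prob_mu[OF W])
  have "real (card \<C>) * m = (\<Sum>Q\<in>\<C>. m)" by simp
  also have "\<dots> \<le> (\<Sum>Q\<in>\<C>. measure (\<mu> W) Q)" by (intro sum_mono m)
  also have "\<dots> = measure (\<mu> W) (\<Union>\<C>)" by (rule sum_cells[OF W st C])
  also have "\<dots> \<le> measure (\<mu> W) A" using A by (intro finite_measure_mono)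
  finally show ?thesis .
qed

lemma mass_le_card_times:
  assumes W: "probs W" and st: "stopping k l" and C: "\<C> \<subseteq> cells k l"
    and A: "A \<subseteq> \<Union>\<C>" and m: "\<And>Q. Q \<in> \<C> \<Longrightarrow> measure (\<mu> W) Q \<le> m"
  shows "measure (\<mu> W) A \<le> real (card \<C>) * m"
  using mu_le_sum[OF W st C A] sum_bounded_above[of \<C> "measure (\<mu> W)" m] m by simp

text \<open>A cover with a small sum of \<open>s'\<close>-th powers would catch too little mass:
  each covering set is exchanged for the boundedly many squares of its own scale that it meets. The
  local bound holds only on \<open>G\<close>, so only squares meeting \<open>G\<close> are
  kept.\<close>

lemma mass_distribution:
  assumes W: "probs W" and G: "G \<in> sets (\<mu> W)" "0 < measure (\<mu> W) G" and C: "0 < C"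
    and mass: "\<And>\<omega> R. \<omega> \<in> G \<Longrightarrow> 0 < R \<Longrightarrow> R \<le> 1 \<Longrightarrow> measure (\<mu> W) (sq R \<omega>) \<le> C * R powr s"
    and s': "0 < s'" "hausdorff_measure s' F = 0"
  shows "s \<le> s'"
proof (rule ccontr)
  assume "\<not> s \<le> s'"
  interpret prob_space "\<mu> W" by (rule prob_mu[OF W])
  have GO: "G \<subseteq> \<Omega>" using sets.sets_into_space[OF G(1)] by (simp add: space_mu)
  define K where "K = C * pack 1"
  have K: "0 < K" using C pack_pos by (simp add: K_def)
  \<comment> \<open>The squares will carry mass at most
    \<open>K * (\<epsilon> + \<epsilon>)\<close>, which is half the mass of
    \<open>G\<close>.\<close>
  define \<epsilon> where "\<epsilon> = measure (\<mu> W) G / (4 * K)"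
  have e: "0 < \<epsilon>" using G K by (simp add: \<epsilon>_def)
  have "hausdorff_pre_measure s' 1 F \<le> hausdorff_measure s' F"
    unfolding hausdorff_measure_def by (rule SUP_upper) simp
  then have "hausdorff_pre_measure s' 1 F < ennreal \<epsilon>" using s' e by simp
  then obtain U where U: "F \<subseteq> (\<Union>i::nat. U i)" "\<And>i. bounded (U i)" "\<And>i. diameter (U i) \<le> 1"
    "(\<Sum>i. ennreal (diameter (U i) powr s')) < ennreal \<epsilon>"
    unfolding hausdorff_pre_measure_def INF_less_iff by auto
  have dn: "0 \<le> diameter (U i)" for i using diameter_ge_0[OF U(2)] .
  define h where "h i = \<epsilon> * (1/2) ^ Suc i" for i
  have h: "0 < h i" for i using e by (simp add: h_def)
  \<comment> \<open>A set of diameter 0 determines no scale. It is given one with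
    \<open>a i powr s' \<le> h i\<close>, where the \<open>h i\<close> sum to
    \<open>\<epsilon>\<close>.\<close>
  define a where "a i = (if 0 < diameter (U i) then diameter (U i) else min 1 (h i powr (1 / s')))" for i
  have a: "0 < a i" "a i \<le> 1" "diameter (U i) \<le> a i" "a i powr s' \<le> diameter (U i) powr s' + h i" for i
  proof -
    show "0 < a i" "a i \<le> 1" using h[of i] U(3)[of i] by (auto simp: a_def)
    then show "diameter (U i) \<le> a i"
    proof (cases "0 < diameter (U i)")
      case True
      then show ?thesis by (simp add: a_def)
    next
      case False
      with \<open>0 < a i\<close> show ?thesis by linarith
    qed
    have "min 1 (h i powr (1 / s')) powr s' \<le> (h i powr (1 / s')) powr s'"
      using s' h[of i] by (intro powr_mono2) auto
    also have "\<dots> = h i" using s' h[of i] by (simp add: powr_powr)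
    finally show "a i powr s' \<le> diameter (U i) powr s' + h i"
      using h[of i] powr_ge_zero[of "diameter (U i)" s'] by (auto simp: a_def simp del: powr_ge_zero)
  qed
  define \<C> where "\<C> i = {Q \<in> hits (a i) (U i). Q \<inter> G \<noteq> {}}" for i
  have Csub: "\<C> i \<subseteq> squares (a i)" for i using hits_subset by (auto simp: \<C>_def)
  define B where "B i = \<Union>(\<C> i)" for i
  have B: "B i \<in> sets (\<mu> W)" for i
    unfolding B_def
  proof (rule sets.finite_Union)
    show "finite (\<C> i)" by (rule finite_subset[OF Csub finite_cells[OF stopping_square[OF a(1)]]])
    show "\<C> i \<subseteq> sets (\<mu> W)" using Csub cells_sets[OF W stopping_square[OF a(1)]] by blast
  qed
  have mB: "measure (\<mu> W) (B i) \<le> K * a i powr s'" for i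
  proof -
    have "measure (\<mu> W) (B i) \<le> real (card (\<C> i)) * (C * a i powr s')"
    proof (rule mass_le_card_times[OF W stopping_square[OF a(1)] Csub])
      fix Q assume Q: "Q \<in> \<C> i"
      then obtain \<omega> where w: "\<omega> \<in> Q" "\<omega> \<in> G" by (auto simp: \<C>_def)
      have "Q = sq (a i) \<omega>" using cells_eq[OF stopping_square[OF a(1)]] Csub Q w(1) by blast
      then have "measure (\<mu> W) Q \<le> C * a i powr s" using mass[OF w(2) a(1,2)] by simp
      also have "\<dots> \<le> C * a i powr s'" using C a(1,2)[of i] \<open>\<not> s \<le> s'\<close> by (intro mult_left_mono powr_mono') auto
      finally show "measure (\<mu> W) Q \<le> C * a i powr s'" .
    qed (simp add: B_def)
    also have "\<dots> \<le> pack 1 * (C * a i powr s')"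
    proof (rule mult_right_mono)
      have "real (card (\<C> i)) \<le> real (card (hits (a i) (U i)))"
        unfolding of_nat_le_iff by (rule card_mono[OF finite_hits[OF a(1)[of i]]]) (simp add: \<C>_def)
      also have "\<dots> \<le> pack 1"
      proof (rule card_hits_le[OF a(1)[of i] a(2)[of i] zero_le_one])
        fix x y assume xy: "x \<in> U i" "y \<in> U i"
        have "dist x y \<le> diameter (U i)" by (rule diameter_bounded_bound[OF U(2) xy])
        also note a(3)[of i]
        finally show "dist x y \<le> 1 * a i" by simp
      qed
      finally show "real (card (\<C> i)) \<le> pack 1" .
    qed (use C in auto)
    finally show ?thesis by (simp add: K_def mult_ac)
  qed
  have cov: "G \<subseteq> (\<Union>i. B i)"
  proof
    fix \<omega> assume w: "\<omega> \<in> G"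
    then obtain i where i: "pt \<omega> \<in> U i" using U(1) GO pt_in_F by blast
    have "sq (a i) \<omega> \<in> \<C> i" using hitsI[OF _ i] cell_self w GO unfolding \<C>_def by blast
    then show "\<omega> \<in> (\<Union>i. B i)" unfolding B_def using cell_self w GO by blast
  qed
  have "ennreal (measure (\<mu> W) G) = emeasure (\<mu> W) G" by (simp add: emeasure_eq_measure)
  also have "\<dots> \<le> emeasure (\<mu> W) (\<Union>i. B i)" using B cov by (intro emeasure_mono) auto
  also have "\<dots> \<le> (\<Sum>i. emeasure (\<mu> W) (B i))" using B by (intro emeasure_subadditive_countably) auto
  also have "\<dots> \<le> (\<Sum>i. ennreal K * (ennreal (diameter (U i) powr s') + ennreal (h i)))"
  proof (rule suminf_le)
    fix i
    have "emeasure (\<mu> W) (B i) = ennreal (measure (\<mu> W) (B i))" by (simp add: emeasure_eq_measure)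
    also have "\<dots> \<le> ennreal (K * (diameter (U i) powr s' + h i))"
      using mB[of i] a(4)[of i] K by (intro ennreal_leI) (meson mult_left_mono less_imp_le order_trans)
    also have "\<dots> = ennreal K * (ennreal (diameter (U i) powr s') + ennreal (h i))"
      using K h[of i] by (simp add: ennreal_mult)
    finally show "emeasure (\<mu> W) (B i) \<le> ennreal K * (ennreal (diameter (U i) powr s') + ennreal (h i))" .
  qed auto
  also have "\<dots> = ennreal K * ((\<Sum>i. ennreal (diameter (U i) powr s')) + (\<Sum>i. ennreal (h i)))"
    by (simp add: suminf_add[symmetric])
  also have "(\<Sum>i. ennreal (h i)) = ennreal \<epsilon>"
  proof (rule suminf_ennreal_eq)
    show "h sums \<epsilon>" unfolding h_def using sums_mult[OF power_half_series, of \<epsilon>] by simp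
  qed (use h less_imp_le in auto)
  also have "ennreal K * ((\<Sum>i. ennreal (diameter (U i) powr s')) + ennreal \<epsilon>) \<le> ennreal K * (ennreal \<epsilon> + ennreal \<epsilon>)"
    using U(4) by (intro mult_left_mono add_right_mono) auto
  also have "\<dots> = ennreal (K * (2 * \<epsilon>))" using K e by (simp add: ennreal_mult' flip: ennreal_plus)
  also have "K * (2 * \<epsilon>) = measure (\<mu> W) G / 2" using K by (simp add: \<epsilon>_def)
  finally show False using G(2) by simp
qed

end

section \<open>Exponents, box dimension and the uniform case\<close>

text \<open>At \<open>s = 0\<close> the sum is at least 1, and it falls below 1 for large
  \<open>s\<close> because every \<open>f x < 1\<close>; the root comes from continuity.\<close>

lemma weighted_powr_root:
  assumes A: "finite A" "\<And>x. x \<in> A \<Longrightarrow> 0 < f x \<and> f x < (1::real)" and g: "1 \<le> sum g A"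
  shows "\<exists>s\<ge>0. (\<Sum>x\<in>A. g x * f x powr s) = 1"
proof -
  let ?h = "\<lambda>s. \<Sum>x\<in>A. g x * f x powr s"
  have "(\<lambda>n. \<Sum>x\<in>A. g x * f x ^ n) \<longlonglongrightarrow> (\<Sum>x\<in>A. g x * 0)"
    using A(2) by (intro tendsto_intros LIMSEQ_power_zero) (force simp: less_imp_le)
  then have "\<forall>\<^sub>F n in sequentially. (\<Sum>x\<in>A. g x * f x ^ n) < 1"
    by (intro order_tendstoD(2)[where y = "\<Sum>x\<in>A. g x * 0"]) auto
  then obtain n where n: "(\<Sum>x\<in>A. g x * f x ^ n) < 1" by (auto simp: eventually_sequentially)
  have "?h (real n) = (\<Sum>x\<in>A. g x * f x ^ n)" using A(2) by (intro sum.cong) (auto simp: powr_realpow)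
  then have "?h (real n) \<le> 1" using n by simp
  moreover have "?h 0 = sum g A" using A(2) by (intro sum.cong) (force simp: powr_zero_eq_one)+
  moreover have "continuous_on {0..real n} ?h"
    using A(2) by (intro continuous_intros) force+
  ultimately have "\<exists>s. 0 \<le> s \<and> s \<le> real n \<and> ?h s = 1"
    using g by (intro IVT2') auto
  then show ?thesis by blast
qed

lemma weighted_powr_strict_antimono:
  assumes A: "finite A" "A \<noteq> {}" "\<And>x. x \<in> A \<Longrightarrow> 0 < f x \<and> f x < (1::real)" "\<And>x. x \<in> A \<Longrightarrow> 0 < g x" and "s < s'"
  shows "(\<Sum>x\<in>A. g x * f x powr s') < (\<Sum>x\<in>A. g x * f x powr s)"
  using assms by (intro sum_strict_mono mult_strict_left_mono powr_less_mono') auto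

text \<open>Three Moran-type equations: over the columns, each counted once; within each column; and
  over all rectangles with the column exponent \<open>s1\<close> kept fixed. The fibre exponent is a
  function of rectangles that is constant along columns.\<close>

locale carpet_exponents = carpet +
  fixes s1 \<beta> :: real and t :: "rect \<Rightarrow> real"
  assumes s1_nonneg: "0 \<le> s1" and s1_sum: "(\<Sum>j\<in>col ` I. snd j powr s1) = 1"
    and t_nonneg: "q \<in> I \<Longrightarrow> 0 \<le> t q"
    and t_col: "\<lbrakk>q \<in> I; q' \<in> I; col q = col q'\<rbrakk> \<Longrightarrow> t q = t q'"
    and t_sum: "q \<in> I \<Longrightarrow> (\<Sum>q'\<in>{q'\<in>I. col q' = col q}. height q' powr t q) = 1"
    and beta_nonneg: "0 \<le> \<beta>" and beta_sum: "(\<Sum>q\<in>I. base q powr s1 * height q powr \<beta>) = 1"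

context carpet
begin

lemma sum_columns: "sum g I = (\<Sum>j\<in>col ` I. \<Sum>q\<in>{q\<in>I. col q = j}. g q)"
  by (rule sum.image_gen[OF fin])

lemma exponents_exist: "\<exists>s1 \<beta> t. carpet_exponents I F s1 \<beta> t"
proof -
  have "\<exists>s\<ge>0. (\<Sum>j\<in>col ` I. 1 * snd j powr s) = 1"
  proof (rule weighted_powr_root)
    have "1 \<le> card (col ` I)" using fin ne by (simp add: Suc_le_eq card_gt_0_iff)
    then show "1 \<le> (\<Sum>j\<in>col ` I. 1::real)" by simp
  qed (use fin base_pos base_less in \<open>auto simp: col_def\<close>)
  then obtain s1 where s1: "0 \<le> s1" "(\<Sum>j\<in>col ` I. snd j powr s1) = 1" by auto
  have "\<exists>s\<ge>0. (\<Sum>q'\<in>{q'\<in>I. col q' = col q}. 1 * height q' powr s) = 1" if q: "q \<in> I" for q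
  proof (rule weighted_powr_root)
    have "1 \<le> card {q'\<in>I. col q' = col q}" using q fin by (auto simp: Suc_le_eq card_gt_0_iff)
    then show "1 \<le> (\<Sum>j\<in>{q'\<in>I. col q' = col q}. 1::real)" by simp
  qed (use fin height_pos height_less in auto)
  then have "\<forall>j\<in>col ` I. \<exists>s\<ge>0. (\<Sum>q'\<in>{q'\<in>I. col q' = j}. height q' powr s) = 1" by auto
  then obtain T where T: "\<And>j. j \<in> col ` I \<Longrightarrow> 0 \<le> T j \<and> (\<Sum>q'\<in>{q'\<in>I. col q' = j}. height q' powr T j) = 1"
    by metis
  have "\<exists>s\<ge>0. (\<Sum>q\<in>I. base q powr s1 * height q powr s) = 1"
  proof (rule weighted_powr_root)
    \<comment> \<open>At exponent 0 every column is counted once per rectangle, so the sum is at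
      least the column sum 1.\<close>
    have "(\<Sum>q\<in>I. base q powr s1) = (\<Sum>j\<in>col ` I. \<Sum>q\<in>{q\<in>I. col q = j}. base q powr s1)"
      by (rule sum_columns)
    also have "\<dots> \<ge> (\<Sum>j\<in>col ` I. snd j powr s1)"
    proof (rule sum_mono)
      fix j assume "j \<in> col ` I"
      then obtain q where q: "q \<in> I" "j = col q" by blast
      have "base q powr s1 \<le> (\<Sum>q\<in>{q\<in>I. col q = j}. base q powr s1)"
        using fin q by (intro member_le_sum) auto
      then show "snd j powr s1 \<le> (\<Sum>q\<in>{q\<in>I. col q = j}. base q powr s1)" by (simp add: q col_def)
    qed
    finally show "1 \<le> (\<Sum>q\<in>I. base q powr s1)" using s1 by simp
  qed (use fin height_pos height_less in auto)
  then obtain \<beta> where b: "0 \<le> \<beta>" "(\<Sum>q\<in>I. base q powr s1 * height q powr \<beta>) = 1" by blast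
  have "carpet_exponents I F s1 \<beta> (\<lambda>q. T (col q))"
    using s1 b T by unfold_locales auto
  then show ?thesis by blast
qed

end

context carpet_exponents
begin

text \<open>
  Under the product measure of \<open>p0\<close> the columns are distributed with masses \<open>base q powr s1\<close>, as
  for the natural measure of the projection; \<open>p1\<close> is the distribution of the first \<open>k\<close> rectangles
  of a randomly chosen approximate square.
\<close>

definition p0 :: "rect \<Rightarrow> real" where "p0 q = base q powr s1 * height q powr t q"

definition p1 :: "rect \<Rightarrow> real" where "p1 q = base q powr s1 * height q powr \<beta>"

lemma p0_pos: "q \<in> I \<Longrightarrow> 0 < p0 q"
  using base_pos[of q] height_pos[of q] by (simp add: p0_def)

lemma p1_pos: "q \<in> I \<Longrightarrow> 0 < p1 q"
  using base_pos[of q] height_pos[of q] by (simp add: p1_def)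

lemma colsum_p0: assumes "q \<in> I" shows "colsum p0 q = base q powr s1"
proof -
  have "colsum p0 q = (\<Sum>q'\<in>{q'\<in>I. col q' = col q}. base q powr s1 * height q' powr t q)"
    unfolding colsum_def
  proof (rule sum.cong)
    fix q' assume "q' \<in> {q'\<in>I. col q' = col q}"
    then have "t q' = t q" "base q' = base q" using t_col[of q' q] assms by (auto simp: col_def)
    then show "p0 q' = base q powr s1 * height q' powr t q" by (simp add: p0_def)
  qed simp
  then show ?thesis using t_sum[OF assms] by (simp flip: sum_distrib_left)
qed

lemma is_prob_p0: "is_prob p0"
proof -
  have "sum p0 I = (\<Sum>j\<in>col ` I. snd j powr s1)"
    unfolding sum_columns[of p0]
  proof (rule sum.cong)
    fix j assume "j \<in> col ` I"
    then obtain q where q: "q \<in> I" "j = col q" by blast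
    then show "sum p0 {q\<in>I. col q = j} = snd j powr s1"
      using colsum_p0[OF q(1)] by (simp add: colsum_def col_def)
  qed simp
  then show ?thesis using s1_sum p0_pos by (auto simp: is_prob_def less_imp_le)
qed

lemma is_prob_p1: "is_prob p1"
  using beta_sum p1_pos by (auto simp: is_prob_def less_imp_le p1_def)

lemma probs_p0: "probs (\<lambda>_. p0)" and probs_p1: "probs (\<lambda>_. p1)"
  using is_prob_p0 is_prob_p1 by (auto simp: probs_def)

lemma cc_powr: "(\<Prod>m<n. base (\<omega> m) powr s) = cc \<omega> n powr s"
  unfolding scale_def by (rule prod_powr_distrib[symmetric])

lemma dd_powr: "(\<Prod>m<n. height (\<omega> m) powr s) = dd \<omega> n powr s"
  unfolding scale_def by (rule prod_powr_distrib[symmetric])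

lemma cc_hit_powr:
  assumes "\<omega> \<in> \<Omega>" "0 < R" "R \<le> 1" "0 \<le> s"
  shows "cc \<omega> (lR R \<omega>) powr s \<le> R powr s" "(\<kappa> * R) powr s \<le> cc \<omega> (lR R \<omega>) powr s"
  using assms kappa_pos by (intro powr_mono2 cc_hit_le cc_hit_ge less_imp_le[OF cc_pos]; simp)+

lemma dd_hit_powr:
  assumes "\<omega> \<in> \<Omega>" "0 < R" "R \<le> 1" "0 \<le> s"
  shows "dd \<omega> (kR R \<omega>) powr s \<le> R powr s" "(\<kappa> * R) powr s \<le> dd \<omega> (kR R \<omega>) powr s"
  using assms kappa_pos by (intro powr_mono2 dd_hit_le dd_hit_ge less_imp_le[OF dd_pos]; simp)+

definition tt :: "(nat \<Rightarrow> rect) \<Rightarrow> nat \<Rightarrow> real" where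
  "tt \<omega> n = (\<Prod>m<n. height (\<omega> m) powr t (\<omega> m))"

lemma tt_pos: "\<omega> \<in> \<Omega> \<Longrightarrow> 0 < tt \<omega> n"
  unfolding tt_def by (intro prod_pos) (metis height_pos Omega_D less_irrefl powr_gt_zero)

abbreviation m0 :: "(nat \<Rightarrow> rect) set \<Rightarrow> real" where
  "m0 \<equiv> measure (\<mu> (\<lambda>_. p0))"

lemma prod_base_powr_split:
  assumes w: "\<omega> \<in> \<Omega>" and kl: "k \<le> l"
  shows "(\<Prod>m<k. base (\<omega> m) powr s1) * (\<Prod>m=k..<l. base (\<omega> m) powr s1) = cc \<omega> l powr s1"
proof -
  have "{..<l} = {..<k} \<union> {k..<l}" using kl by auto
  then have "(\<Prod>m<l. base (\<omega> m) powr s1) = (\<Prod>m<k. base (\<omega> m) powr s1) * (\<Prod>m=k..<l. base (\<omega> m) powr s1)"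
    by (simp add: prod.union_disjoint ivl_disj_int)
  then show ?thesis by (simp add: cc_powr)
qed

text \<open>The column masses from \<open>k\<close> to \<open>l\<close> are again
  \<open>base powr s1\<close>, so the bases combine to the full product up to \<open>l\<close> and
  the fibres enter only before \<open>k\<close>.\<close>

lemma m0_cell:
  assumes w: "\<omega> \<in> \<Omega>" and kl: "k \<le> l"
  shows "m0 (cell k l \<omega>) = cc \<omega> l powr s1 * tt \<omega> k"
proof -
  have "(\<Prod>m=k..<l. colsum p0 (\<omega> m)) = (\<Prod>m=k..<l. base (\<omega> m) powr s1)"
    using w by (intro prod.cong) (auto simp: Omega_iff colsum_p0)
  then show ?thesis
    unfolding cell_mu(2)[OF probs_p0 w kl] p0_def prod.distrib tt_def[symmetric]
    using prod_base_powr_split[OF w kl] by (simp add: mult_ac)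
qed

lemma m1_cell:
  assumes w: "\<omega> \<in> \<Omega>"
  shows "measure (\<mu> (\<lambda>_. p1)) (cell k k \<omega>) = cc \<omega> k powr s1 * dd \<omega> k powr \<beta>"
  unfolding cell_mu(2)[OF probs_p1 w order.refl] p1_def
  by (simp add: prod.distrib cc_powr dd_powr)

text \<open>
  A strip is the set of sequences with the same first \<open>k\<close> rectangles. All approximate squares in it
  have comparable \<open>m0\<close>-mass, which gives their number; summing over strips needs the other
  weights \<open>p1\<close>.
\<close>

lemma card_squares_in_strip:
  assumes w: "\<omega> \<in> \<Omega>" and R: "0 < R" "R \<le> 1"
  defines "D \<equiv> cell (kR R \<omega>) (kR R \<omega>) \<omega>"
  shows "R powr s1 * real (card {Q \<in> squares R. Q \<subseteq> D}) \<ge> cc \<omega> (kR R \<omega>) powr s1"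
    "(\<kappa> * R) powr s1 * real (card {Q \<in> squares R. Q \<subseteq> D}) \<le> cc \<omega> (kR R \<omega>) powr s1"
proof -
  let ?C = "{Q \<in> squares R. Q \<subseteq> D}" and ?k = "kR R \<omega>"
  have D: "m0 D = cc \<omega> ?k powr s1 * tt \<omega> ?k" unfolding D_def by (rule m0_cell[OF w order.refl])
  have Q: "m0 Q \<le> R powr s1 * tt \<omega> ?k \<and> (\<kappa> * R) powr s1 * tt \<omega> ?k \<le> m0 Q" if Q: "Q \<in> ?C" for Q
  proof -
    obtain \<omega>' where w': "\<omega>' \<in> \<Omega>" "Q = sq R \<omega>'" using Q by (auto simp: cells_def)
    have wD: "\<omega>' \<in> D" using Q cell_self[OF w'(1)] w'(2) by blast
    have k: "kR R \<omega>' = ?k" using wD kR_cong[OF w R(1)] unfolding D_def by blast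
    have tt: "tt \<omega>' ?k = tt \<omega> ?k" using wD by (auto simp: tt_def D_def cell_def intro!: prod.cong)
    have "m0 Q = cc \<omega>' (lR R \<omega>') powr s1 * tt \<omega> ?k"
      unfolding w'(2) m0_cell[OF w'(1) kR_le_lR[OF w'(1) R(1)]] by (simp only: k tt)
    then show ?thesis
      using cc_hit_powr[OF w'(1) R s1_nonneg] less_imp_le[OF tt_pos[OF w]] by (auto intro!: mult_right_mono)
  qed
  have cov: "D \<subseteq> \<Union>?C"
  proof
    fix \<omega>' assume wD: "\<omega>' \<in> D"
    then have w': "\<omega>' \<in> \<Omega>" by (simp add: D_def cell_def)
    have k: "kR R \<omega>' = ?k" using wD kR_cong[OF w R(1)] unfolding D_def by blast
    have "sq R \<omega>' \<subseteq> cell ?k ?k \<omega>'" using kR_le_lR[OF w' R(1)] by (intro cell_mono) (simp_all only: k order.refl)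
    also have "\<dots> = D" using wD unfolding D_def by (rule cell_eqI)
    finally have "sq R \<omega>' \<in> ?C" using w' by (auto simp: cells_def)
    then show "\<omega>' \<in> \<Union>?C" using cell_self[OF w'] by blast
  qed
  have "m0 D \<le> real (card ?C) * (R powr s1 * tt \<omega> ?k)"
    by (rule mass_le_card_times[OF probs_p0 stopping_square[OF R(1)] _ cov]) (use Q in auto)
  then have "cc \<omega> ?k powr s1 * tt \<omega> ?k \<le> (R powr s1 * real (card ?C)) * tt \<omega> ?k"
    by (simp add: D mult_ac)
  then show "R powr s1 * real (card ?C) \<ge> cc \<omega> ?k powr s1"
    by (rule mult_right_le_imp_le[OF _ tt_pos[OF w]])
  have "real (card ?C) * ((\<kappa> * R) powr s1 * tt \<omega> ?k) \<le> m0 D"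
    by (rule card_times_mass_le[OF probs_p0 stopping_square[OF R(1)]])
      (use Q cell_mu(1)[OF probs_p0 w order.refl] in \<open>auto simp: D_def\<close>)
  then have "((\<kappa> * R) powr s1 * real (card ?C)) * tt \<omega> ?k \<le> cc \<omega> ?k powr s1 * tt \<omega> ?k"
    by (simp add: D mult_ac)
  then show "(\<kappa> * R) powr s1 * real (card ?C) \<le> cc \<omega> ?k powr s1"
    by (rule mult_right_le_imp_le[OF _ tt_pos[OF w]])
qed

text \<open>A strip contains about \<open>(cc \<omega> k / R) powr s1\<close> squares with
  \<open>k = kR R \<omega>\<close>. Its height is comparable to \<open>R\<close>, so up to constants
  this number is its \<open>p1\<close>-mass times \<open>R powr (- (s1 + \<beta>))\<close>, and the
  \<open>p1\<close>-masses of all strips add up to 1.\<close>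

lemma card_squares:
  assumes R: "0 < R" "R \<le> 1"
  shows "R powr (- (s1 + \<beta>)) \<le> real (card (squares R))"
    "real (card (squares R)) \<le> (\<kappa> * R) powr (- (s1 + \<beta>))"
proof -
  let ?S = "cells (kR R) (kR R)"
  let ?C = "\<lambda>D. {Q \<in> squares R. Q \<subseteq> D}"
  let ?m = "measure (\<mu> (\<lambda>_. p1))"
  note st = stopping_strip[OF R(1)]
  have eq: "squares R = (\<Union>D\<in>?S. ?C D)"
  proof (intro equalityI subsetI)
    fix Q assume Q: "Q \<in> squares R"
    then obtain \<omega> where w: "\<omega> \<in> \<Omega>" "Q = sq R \<omega>" by (auto simp: cells_def)
    have "sq R \<omega> \<subseteq> cell (kR R \<omega>) (kR R \<omega>) \<omega>" using kR_le_lR[OF w(1) R(1)] by (intro cell_mono) auto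
    then show "Q \<in> (\<Union>D\<in>?S. ?C D)" using w Q by (auto simp: cells_def)
  qed auto
  have "card (\<Union>D\<in>?S. ?C D) = (\<Sum>D\<in>?S. card (?C D))"
  proof (rule card_UN_disjoint)
    show "finite ?S" by (rule finite_cells[OF st])
    show "\<forall>D\<in>?S. finite (?C D)" using finite_cells[OF stopping_square[OF R(1)]] by auto
    show "\<forall>D\<in>?S. \<forall>D'\<in>?S. D \<noteq> D' \<longrightarrow> ?C D \<inter> ?C D' = {}"
    proof (intro ballI impI)
      fix D D' assume D: "D \<in> ?S" "D' \<in> ?S" "D \<noteq> D'"
      then have "D \<inter> D' = {}" using disjoint_cells[OF st] unfolding disjoint_def by blast
      then show "?C D \<inter> ?C D' = {}" using cells_ne by blast
    qed
  qed
  with arg_cong[OF eq, of card] have "card (squares R) = (\<Sum>D\<in>?S. card (?C D))" by (rule trans)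
  then have card: "real (card (squares R)) = (\<Sum>D\<in>?S. real (card (?C D)))" by simp
  have one: "(\<Sum>D\<in>?S. ?m D) = 1"
    using sum_cells[OF probs_p1 st order.refl] by (simp add: Union_cells mu_Omega[OF probs_p1])
  have D: "?m D \<le> R powr (s1 + \<beta>) * real (card (?C D)) \<and> (\<kappa> * R) powr (s1 + \<beta>) * real (card (?C D)) \<le> ?m D"
    if DS: "D \<in> ?S" for D
  proof -
    obtain \<omega> where w: "\<omega> \<in> \<Omega>" "D = cell (kR R \<omega>) (kR R \<omega>) \<omega>" using DS by (auto simp: cells_def)
    note c = card_squares_in_strip[OF w(1) R, folded w(2)]
    have m: "?m D = cc \<omega> (kR R \<omega>) powr s1 * dd \<omega> (kR R \<omega>) powr \<beta>" unfolding w(2) by (rule m1_cell[OF w(1)])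
    have d: "dd \<omega> (kR R \<omega>) powr \<beta> \<le> R powr \<beta>" "(\<kappa> * R) powr \<beta> \<le> dd \<omega> (kR R \<omega>) powr \<beta>"
      by (rule dd_hit_powr[OF w(1) R beta_nonneg])+
    have "?m D \<le> (R powr s1 * real (card (?C D))) * R powr \<beta>"
      unfolding m using c(1) d(1) by (intro mult_mono) auto
    moreover have "((\<kappa> * R) powr s1 * real (card (?C D))) * (\<kappa> * R) powr \<beta> \<le> ?m D"
      unfolding m using c(2) d(2) by (intro mult_mono) auto
    ultimately show ?thesis by (simp add: powr_add mult_ac)
  qed
  have "1 \<le> R powr (s1 + \<beta>) * real (card (squares R))"
    unfolding one[symmetric] card sum_distrib_left using D by (intro sum_mono) auto
  then show "R powr (- (s1 + \<beta>)) \<le> real (card (squares R))"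
    using R by (simp only: powr_minus_divide) (simp add: divide_le_eq mult.commute)
  have "(\<kappa> * R) powr (s1 + \<beta>) * real (card (squares R)) \<le> 1"
    unfolding one[symmetric] card sum_distrib_left using D by (intro sum_mono) auto
  then show "real (card (squares R)) \<le> (\<kappa> * R) powr (- (s1 + \<beta>))"
    using R kappa_pos by (simp only: powr_minus_divide) (simp add: le_divide_eq mult.commute)
qed

lemma hits_F: "hits R F = squares R"
  using cells_ne cells_subset pt_in_F by (fastforce simp: hits_def)

lemma covering_number_F:
  assumes r: "0 < r" "r \<le> 1"
  shows "1 / pack 1 * r powr (- (s1 + \<beta>)) \<le> real (covering_number r F)"
    "real (covering_number r F) \<le> (\<kappa> / 5) powr (- (s1 + \<beta>)) * r powr (- (s1 + \<beta>))"
proof -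
  have "r powr (- (s1 + \<beta>)) \<le> pack 1 * real (covering_number r F)"
    using card_squares(1)[OF r] hits_le_covering_number[OF r order.refl] by (simp add: hits_F)
  then show "1 / pack 1 * r powr (- (s1 + \<beta>)) \<le> real (covering_number r F)"
    using pack_pos[of 1] by (simp add: field_simps)
  have "real (covering_number r F) \<le> real (card (squares (r / 5)))"
    using covering_number_le_hits[OF r(1) order.refl] by (simp add: hits_F)
  also have "\<dots> \<le> (\<kappa> * (r / 5)) powr (- (s1 + \<beta>))" using r by (intro card_squares) auto
  also have "\<dots> = (\<kappa> / 5) powr (- (s1 + \<beta>)) * r powr (- (s1 + \<beta>))"
    using r kappa_pos by (subst powr_mult[symmetric]) auto
  finally show "real (covering_number r F) \<le> (\<kappa> / 5) powr (- (s1 + \<beta>)) * r powr (- (s1 + \<beta>))" .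
qed

lemma box_dim_F: "box_dim_exists F" "box_dim F = s1 + \<beta>"
  using box_dim_eqI[OF _ _ zero_less_one covering_number_F] pack_pos[of 1] kappa_pos by auto

lemma hausdorff_measure_F_eq_0:
  assumes s: "s1 + \<beta> < s"
  shows "hausdorff_measure s F = 0"
proof (rule hausdorff_measure_eq_0I)
  fix \<epsilon> :: real assume e: "0 < \<epsilon>"
  define d where "d = s - (s1 + \<beta>)"
  have d: "0 < d" using s by (simp add: d_def)
  define K where "K = (\<kappa> / 5) powr (- (s1 + \<beta>))"
  have K: "0 < K" using kappa_pos by (simp add: K_def)
  define r where "r = min (min 1 \<epsilon>) ((\<epsilon> / K) powr (1 / d))"
  have r: "0 < r" "r \<le> 1" "r \<le> \<epsilon>" using e K by (auto simp: r_def)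
  have "r powr d \<le> ((\<epsilon> / K) powr (1 / d)) powr d" using r d by (intro powr_mono2) (auto simp: r_def)
  also have "\<dots> = \<epsilon> / K" using d e K by (simp add: powr_powr)
  finally have rd: "K * r powr d \<le> \<epsilon>" using K by (simp add: field_simps)
  obtain \<V> where V: "finite \<V>" "F \<subseteq> \<Union>\<V>" "\<And>U. U \<in> \<V> \<Longrightarrow> open U \<and> bounded U \<and> diameter U \<le> r"
    "card \<V> = covering_number r F"
    using covering_number_cover[OF r(1) order.refl] by blast
  have "(\<Sum>U\<in>\<V>. diameter U powr s) \<le> (\<Sum>U\<in>\<V>. r powr s)"
    using V(3) diameter_ge_0 s s1_nonneg beta_nonneg by (intro sum_mono powr_mono2) auto
  also have "\<dots> = real (covering_number r F) * r powr s" by (simp add: V(4))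
  also have "\<dots> \<le> (K * r powr (- (s1 + \<beta>))) * r powr s"
    unfolding K_def using covering_number_F(2)[OF r(1,2)] by (intro mult_right_mono) auto
  also have "\<dots> = K * r powr d" by (simp add: d_def mult.assoc algebra_simps flip: powr_add)
  also have "\<dots> \<le> \<epsilon>" by (rule rd)
  finally show "\<exists>\<U>. finite \<U> \<and> F \<subseteq> \<Union>\<U> \<and> (\<forall>U\<in>\<U>. bounded U \<and> diameter U \<le> \<epsilon>) \<and> (\<Sum>U\<in>\<U>. diameter U powr s) \<le> \<epsilon>"
    using V r(3) by (intro exI[of _ \<V>]) force
qed

lemma le_hausdorff_dim:
  assumes "\<And>s'. 0 < s' \<Longrightarrow> hausdorff_measure s' F = 0 \<Longrightarrow> s \<le> s'"
  shows "s \<le> hausdorff_dim F"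
  unfolding hausdorff_dim_def
proof (rule cInf_greatest)
  show "{s. 0 < s \<and> hausdorff_measure s F = 0} \<noteq> {}"
    using hausdorff_measure_F_eq_0[of "s1 + \<beta> + 1"] s1_nonneg beta_nonneg by (auto intro!: exI[of _ "s1 + \<beta> + 1"])
qed (use assms in auto)

lemma hausdorff_dim_le: "0 < s \<Longrightarrow> hausdorff_measure s F = 0 \<Longrightarrow> hausdorff_dim F \<le> s"
  unfolding hausdorff_dim_def by (intro cInf_lower bdd_belowI[of _ 0]) auto

lemma hausdorff_dim_le_box_dim: "hausdorff_dim F \<le> s1 + \<beta>"
proof (rule field_le_epsilon)
  fix e :: real assume "0 < e"
  then show "hausdorff_dim F \<le> s1 + \<beta> + e"
    using s1_nonneg beta_nonneg by (intro hausdorff_dim_le hausdorff_measure_F_eq_0) auto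
qed

lemma uniform_case:
  assumes u: "\<And>q. q \<in> I \<Longrightarrow> t q = t0"
  shows "lower_dim F = s1 + \<beta>" "hausdorff_dim F = s1 + \<beta>" "assouad_dim F = s1 + \<beta>"
proof -
  have t0: "0 \<le> t0" using u t_nonneg ne by force
  have sum0: "(\<Sum>q\<in>I. base q powr s1 * height q powr t0) = 1"
    using is_prob_p0 u by (simp add: is_prob_def p0_def)
  note mono = weighted_powr_strict_antimono[OF fin ne, of height "\<lambda>q. base q powr s1"]
  \<comment> \<open>Both \<open>\<beta>\<close> and \<open>t0\<close> solve the same equation, whose
    left side is strictly decreasing in the exponent.\<close>
  have "\<not> \<beta> < t0" using mono[of \<beta> t0] height_pos height_less base_pos beta_sum sum0 by force
  moreover have "\<not> t0 < \<beta>" using mono[of t0 \<beta>] height_pos height_less base_pos beta_sum sum0 by force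
  ultimately have b: "\<beta> = t0" by simp
  define s where "s = s1 + \<beta>"
  have s: "0 \<le> s" using s1_nonneg beta_nonneg by (simp add: s_def)
  have m: "m0 (sq R \<omega>) \<le> R powr s \<and> (\<kappa> * R) powr s \<le> m0 (sq R \<omega>)" if w: "\<omega> \<in> \<Omega>" and R: "0 < R" "R \<le> 1" for \<omega> R
  proof -
    have "tt \<omega> (kR R \<omega>) = dd \<omega> (kR R \<omega>) powr \<beta>"
      unfolding tt_def dd_powr[symmetric] using u w by (auto simp: b Omega_iff intro!: prod.cong)
    then have "m0 (sq R \<omega>) = cc \<omega> (lR R \<omega>) powr s1 * dd \<omega> (kR R \<omega>) powr \<beta>"
      using m0_cell[OF w kR_le_lR[OF w R(1)]] by simp
    then show ?thesis unfolding s_def powr_add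
      using dd_hit_powr[OF w R beta_nonneg] cc_hit_powr[OF w R s1_nonneg] by (auto intro!: mult_mono)
  qed
  have mQ: "m0 Q \<le> R powr s \<and> (\<kappa> * R) powr s \<le> m0 Q" if Q: "Q \<in> squares R" and R: "0 < R" "R \<le> 1" for Q R
    using m[OF _ R] Q by (auto simp: cells_def)
  have up: "NN r R x \<le> (pack 2 * (\<kappa> / 5) powr (- s)) * (R / r) powr s" if r: "0 < r" "r < R" "R \<le> 1" for r R x
  proof -
    let ?B = "cball x R \<inter> F"
    let ?A = "\<Union>(hits R ?B)"
    have r5: "0 < r / 5" "r / 5 \<le> 1" "0 < R" using r by auto
    have A: "?A \<in> sets (\<mu> (\<lambda>_. p0))"
      using finite_hits[OF r5(3)] cells_sets[OF probs_p0 stopping_square[OF r5(3)]] hits_subset[of R ?B]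
      by (intro sets.finite_Union) auto
    \<comment> \<open>Squares are nested as the scale decreases, so the small squares meeting the
      ball lie in the large ones meeting it. Comparing masses at the two scales gives the
      count.\<close>
    have sub: "\<Union>(hits (r / 5) ?B) \<subseteq> ?A"
    proof
      fix \<omega>' assume "\<omega>' \<in> \<Union>(hits (r / 5) ?B)"
      then obtain Q \<omega> where Q: "Q \<in> squares (r / 5)" "\<omega>' \<in> Q" "\<omega> \<in> Q" "pt \<omega> \<in> ?B" by (auto simp: hits_def)
      have w: "\<omega> \<in> \<Omega>" using Q cells_subset by blast
      have "Q = sq (r / 5) \<omega>" by (rule cells_eq[OF stopping_square[OF r5(1)] Q(1,3)])
      also have "\<dots> \<subseteq> sq R \<omega>" using r r5 by (intro cell_mono kR_mono lR_mono w) auto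
      finally show "\<omega>' \<in> ?A" using hitsI[OF w Q(4)] Q(2) by blast
    qed
    have "real (card (hits (r / 5) ?B)) * (\<kappa> * (r / 5)) powr s \<le> m0 ?A"
      using mQ[OF _ r5(1,2)] hits_subset[of "r / 5" ?B]
      by (intro card_times_mass_le[OF probs_p0 stopping_square[OF r5(1)] hits_subset sub A]) auto
    also have "\<dots> \<le> real (card (hits R ?B)) * R powr s"
      using mQ[OF _ r5(3) r(3)] hits_subset[of R ?B]
      by (intro mass_le_card_times[OF probs_p0 stopping_square[OF r5(3)] hits_subset]) auto
    also have "\<dots> \<le> pack 2 * R powr s"
    proof (intro mult_right_mono card_hits_le r5 r)
      fix a b assume "a \<in> ?B" "b \<in> ?B"
      then show "dist a b \<le> 2 * R" using dist_triangle2[of a b x] by (simp add: dist_commute)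
    qed auto
    finally have "real (card (hits (r / 5) ?B)) \<le> pack 2 * R powr s * (\<kappa> * (r / 5)) powr (- s)"
      using r kappa_pos by (simp add: powr_minus field_simps)
    also have "\<dots> = (pack 2 * (\<kappa> / 5) powr (- s)) * (R / r) powr s"
      using r kappa_pos by (simp add: powr_mult powr_divide powr_minus field_simps)
    finally show ?thesis using covering_number_le_hits[of r ?B] r by simp
  qed
  have lo: "((\<kappa> / 2) powr s / pack 1) * (R / r) powr s \<le> NN r R x" if r: "0 < r" "r < R" "R \<le> 1" and x: "x \<in> F" for r R x
  proof -
    let ?B = "cball x R \<inter> F"
    obtain \<omega> where w: "\<omega> \<in> \<Omega>" "pt \<omega> = x" using F_code x by blast
    \<comment> \<open>At scale \<open>R / 2\<close> all points of the square around \<open>x\<close>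
      are within \<open>R\<close> of \<open>x\<close>, hence in the ball.\<close>
    have r2: "0 < R / 2" "R / 2 \<le> 1" "r \<le> 1" using r by auto
    have "(\<kappa> * (R / 2)) powr s \<le> m0 (sq (R / 2) \<omega>)" using m[OF w(1) r2(1,2)] by simp
    also have "\<dots> \<le> real (card (hits r ?B)) * r powr s"
    proof (rule mass_le_card_times[OF probs_p0 stopping_square[OF r(1)] hits_subset])
      show "sq (R / 2) \<omega> \<subseteq> \<Union>(hits r ?B)"
      proof
        fix \<omega>' assume w': "\<omega>' \<in> sq (R / 2) \<omega>"
        then have "\<omega>' \<in> \<Omega>" by (simp add: cell_def)
        moreover have "pt \<omega>' \<in> ?B"
          using dist_pt_sq[OF w(1) r2(1) w'] w(2) pt_in_F[OF \<open>\<omega>' \<in> \<Omega>\<close>] by simp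
        ultimately show "\<omega>' \<in> \<Union>(hits r ?B)" using hitsI cell_self by blast
      qed
      show "\<And>Q. Q \<in> hits r ?B \<Longrightarrow> m0 Q \<le> r powr s"
        using mQ[OF _ r(1) r2(3)] hits_subset by blast
    qed
    also have "\<dots> \<le> (pack 1 * NN r R x) * r powr s"
      using hits_le_covering_number[OF r(1) r2(3), of ?B] by (intro mult_right_mono) auto
    finally show ?thesis using r kappa_pos pack_pos[of 1] by (simp add: powr_mult powr_divide field_simps)
  qed
  have ab: "assouad_bound s" unfolding assouad_bound_def
  proof (intro exI conjI allI impI ballI)
    show "0 < pack 2 * (\<kappa> / 5) powr (- s)" using pack_pos[of 2] kappa_pos by simp
  qed (use up zero_less_one in blast)+
  have lb: "lower_bound s" unfolding lower_bound_def
  proof (intro exI conjI allI impI ballI)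
    show "0 < (\<kappa> / 2) powr s / pack 1" using pack_pos[of 1] kappa_pos by simp
  qed (use lo zero_less_one in blast)+
  have "lower_dim F \<le> s" unfolding lower_dim_eq
    using lower_bound_0 lower_bound_le_assouad_bound[OF ab] by (intro cSup_least) auto
  then show "lower_dim F = s1 + \<beta>" using le_lower_dim[OF lb] by (simp add: s_def)
  have "s \<le> assouad_dim F" unfolding assouad_dim_eq
    using assouad_bound_2 lower_bound_le_assouad_bound[OF _ lb] by (intro cInf_greatest) auto
  then show "assouad_dim F = s1 + \<beta>" using assouad_dim_le[OF ab] by (simp add: s_def)
  have "s \<le> hausdorff_dim F"
  proof (rule le_hausdorff_dim, rule mass_distribution[OF probs_p0 _ _ zero_less_one])
    show "\<Omega> \<in> sets (\<mu> (\<lambda>_. p0))" using sets.top[of "\<mu> (\<lambda>_. p0)"] by (simp add: space_mu)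
    show "0 < m0 \<Omega>" by (simp add: mu_Omega[OF probs_p0])
  qed (use m in auto)
  then show "hausdorff_dim F = s1 + \<beta>" using hausdorff_dim_le_box_dim by (simp add: s_def)
qed

end

section \<open>Bounds for non-uniform fibres\<close>

lemma scale_split: "n \<le> l \<Longrightarrow> scale a l = scale a n * (\<Prod>m=n..<l. a m)"
  unfolding scale_def using prod.atLeastLessThan_concat[of 0 n l a] by (simp add: atLeast0LessThan)

text \<open>The map of two consecutive letters reaches an end of the unit interval only if both
  letters touch that end, which is impossible for two intervals that do not overlap. The gap
  \<open>\<delta>\<close> depends on these two letters alone.\<close>

lemma nested_intervals_margin:
  assumes "nested_intervals a b"
    and sep: "b n + a n \<le> b (Suc n) \<or> b (Suc n) + a (Suc n) \<le> b n"
  defines "\<delta> \<equiv> min (b n + a n * b (Suc n)) (1 - (b n + a n * (b (Suc n) + a (Suc n))))"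
  shows "0 < \<delta>" "offset a b n + \<delta> * scale a n \<le> (\<Sum>m. scale a m * b m)"
    "(\<Sum>m. scale a m * b m) \<le> offset a b n + scale a n - \<delta> * scale a n"
proof -
  interpret nested_intervals a b by fact
  have p: "0 < a n" "0 < a (Suc n)" "0 \<le> b n" "0 \<le> b (Suc n)" "b n + a n \<le> 1" "b (Suc n) + a (Suc n) \<le> 1"
    by (auto simp: ratio_pos offset_nonneg sum_le_1)
  have "0 < b n + a n * b (Suc n) \<and> b n + a n * (b (Suc n) + a (Suc n)) < 1"
  proof (cases "b n + a n \<le> b (Suc n)")
    case True
    have "0 < a n * b (Suc n)" using p True by (intro mult_pos_pos) auto
    moreover have "a n * (b (Suc n) + a (Suc n)) \<le> a n * 1" using p by (intro mult_left_mono) auto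
    ultimately show ?thesis using p True by linarith
  next
    case False
    then have F: "b (Suc n) + a (Suc n) \<le> b n" using sep by simp
    have "a n * (b (Suc n) + a (Suc n)) < a n * 1" using p F by (intro mult_strict_left_mono) auto
    moreover have "0 \<le> a n * b (Suc n)" using p by simp
    ultimately show ?thesis using p F by linarith
  qed
  then show "0 < \<delta>" by (simp add: \<delta>_def)
  have s: "0 < scale a n" by (rule scale_pos)
  have "\<delta> * scale a n \<le> (b n + a n * b (Suc n)) * scale a n" using s by (intro mult_right_mono) (auto simp: \<delta>_def)
  then show "offset a b n + \<delta> * scale a n \<le> (\<Sum>m. scale a m * b m)"
    using limit_ge[of "Suc (Suc n)"] by (simp add: offset_Suc scale_Suc algebra_simps)
  have "\<delta> * scale a n \<le> (1 - (b n + a n * (b (Suc n) + a (Suc n)))) * scale a n"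
    using s by (intro mult_right_mono) (auto simp: \<delta>_def)
  then show "(\<Sum>m. scale a m * b m) \<le> offset a b n + scale a n - \<delta> * scale a n"
    using limit_le[of "Suc (Suc n)"] by (simp add: offset_Suc scale_Suc algebra_simps)
qed

lemma scale_const: "(\<And>m. m < n \<Longrightarrow> a m = c) \<Longrightarrow> scale a n = c ^ n"
  unfolding scale_def by (subst prod.cong[OF refl, where h = "\<lambda>_. c"]) auto

context carpet_exponents
begin

text \<open>While \<open>t\<close> is constant along the code, \<open>tt\<close> changes like a
  power of the height; the products avoid quotients.\<close>

lemma tt_split:
  assumes nk: "n \<le> k" and eq: "\<And>m. n \<le> m \<Longrightarrow> m < k \<Longrightarrow> t (\<omega> m) = \<tau>"
  shows "tt \<omega> k * dd \<omega> n powr \<tau> = tt \<omega> n * dd \<omega> k powr \<tau>"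
proof -
  have "tt \<omega> k = tt \<omega> n * (\<Prod>m=n..<k. height (\<omega> m) powr t (\<omega> m))"
    using scale_split[OF nk, of "\<lambda>m. height (\<omega> m) powr t (\<omega> m)"] by (simp add: tt_def scale_def)
  also have "(\<Prod>m=n..<k. height (\<omega> m) powr t (\<omega> m)) = (\<Prod>m=n..<k. height (\<omega> m) powr \<tau>)"
    using eq by (intro prod.cong) auto
  also have "tt \<omega> n * \<dots> * dd \<omega> n powr \<tau> = tt \<omega> n * (\<Prod>m<k. height (\<omega> m) powr \<tau>)"
    using scale_split[OF nk, of "\<lambda>m. height (\<omega> m) powr \<tau>"] dd_powr[where n = n and \<omega> = \<omega> and s = \<tau>] by (simp add: scale_def)
  finally show ?thesis by (simp add: dd_powr)
qed

text \<open>Heights are at most the common base. This shows later that a small square stops reading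
  individual letters before the prescribed column ends.\<close>

lemma dd_le_column:
  assumes w: "\<omega> \<in> \<Omega>" and nl: "n \<le> l" and eq: "\<And>m. n \<le> m \<Longrightarrow> m < l \<Longrightarrow> col (\<omega> m) = col J"
  shows "dd \<omega> l \<le> dd \<omega> n * base J ^ (l - n)"
proof -
  have "(\<Prod>m=n..<l. height (\<omega> m)) \<le> (\<Prod>m=n..<l. base J)"
  proof (rule prod_mono)
    fix m assume "m \<in> {n..<l}"
    then have "base (\<omega> m) = base J" using eq[of m] by (auto simp: col_def)
    then show "0 \<le> height (\<omega> m) \<and> height (\<omega> m) \<le> base J"
      using height_pos[OF Omega_D[OF w, of m]] height_le[OF Omega_D[OF w, of m]] by simp
  qed
  then show ?thesis
    unfolding scale_split[OF nl] using dd_pos[OF w, of n] by (intro mult_left_mono) auto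
qed

text \<open>For the code \<open>a, ..., a, J, J, ...\<close> the square of scale \<open>R\<close>
  has only the column of \<open>J\<close> from index \<open>n\<close> to \<open>l\<close>. At scale
  \<open>r = R * e\<close> its subsquares read individual letters up to an index at most
  \<open>l\<close>, so the fibre factor gained after \<open>n\<close> is that of \<open>J\<close>
  alone. Comparing masses yields at least about \<open>e powr (- (s1 + t J))\<close>
  subsquares.\<close>

lemma le_assouad_dim_fibre:
  assumes a: "a \<in> I" "height a < base a" and J: "J \<in> I"
  shows "s1 + t J \<le> assouad_dim F"
proof (rule le_assouad_dim)
  let ?s = "s1 + t J"
  have s: "0 \<le> ?s" using s1_nonneg t_nonneg J by simp
  define c where "c = \<kappa> powr s1 / pack 1 / 2 powr ?s"
  show "0 < c" using kappa_pos pack_pos[of 1] by (simp add: c_def)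
  fix K \<rho> :: real assume K: "0 < K" and \<rho>: "0 < \<rho>"
  define h b where "h = height a" and "b = base a"
  have hb: "0 < h" "h < b" "b < 1" "h < 1"
    using a height_pos base_less by (auto simp: h_def b_def intro: less_trans)
  have "\<forall>\<^sub>F n in sequentially. (h / b) ^ n < min 1 (1 / K)"
    using hb K by (intro order_tendstoD(2)[OF LIMSEQ_power_zero]) auto
  moreover have "\<forall>\<^sub>F n in sequentially. h ^ n < \<rho> / 2"
    using hb \<rho> by (intro order_tendstoD(2)[OF LIMSEQ_power_zero]) auto
  \<comment> \<open>It will turn out that \<open>e \<le> (h / b) ^ n\<close> and
    \<open>R / r = 1 / e\<close>, so a large \<open>n\<close> gives any prescribed ratio.\<close>
  ultimately obtain n where n: "(h / b) ^ n < 1" "(h / b) ^ n < 1 / K" "h ^ n < \<rho> / 2"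
    using eventually_happens[OF eventually_conj] by force
  define \<omega> where "\<omega> m = (if m < n then a else J)" for m
  have w: "\<omega> \<in> \<Omega>" using a J by (auto simp: Omega_iff \<omega>_def)
  define R where "R = h ^ n"
  have R: "0 < R" "R \<le> 1" using hb by (auto simp: R_def power_le_one)
  define l where "l = lR R \<omega>"
  have ddn: "dd \<omega> n = R" and ccn: "cc \<omega> n = b ^ n"
    unfolding R_def h_def b_def by (auto intro!: scale_const simp: \<omega>_def)
  have ccl: "cc \<omega> l \<le> R" "\<kappa> * R \<le> cc \<omega> l" unfolding l_def by (rule cc_hit_le[OF w R(1)] cc_hit_ge[OF w R])+
  have nl: "n \<le> l"
  proof (rule ccontr)
    assume "\<not> n \<le> l"
    then have "cc \<omega> n \<le> cc \<omega> l" by (intro cc_antimono w) simp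
    then have "b ^ n \<le> h ^ n" using ccl(1) by (simp add: ccn R_def)
    then have "1 \<le> (h / b) ^ n" using hb by (simp add: power_divide)
    with n(1) show False by simp
  qed
  define e where "e = base J ^ (l - n)"
  have "(\<Prod>m=n..<l. base (\<omega> m)) = e" unfolding e_def using prod_constant
    by (subst prod.cong[OF refl, where h = "\<lambda>_. base J"]) (auto simp: \<omega>_def)
  then have "cc \<omega> l = b ^ n * e" using scale_split[OF nl] by (simp add: ccn)
  then have e_le: "e \<le> (h / b) ^ n" using ccl(1) hb by (simp add: R_def power_divide field_simps)
  have e: "0 < e" using base_pos[OF J] by (simp add: e_def)
  \<comment> \<open>Between \<open>n\<close> and \<open>l\<close> every code in the cell loses
    height by at least the factor \<open>e\<close>, so at this scale the strip index is at most
    \<open>l\<close>.\<close>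
  define r where "r = R * e"
  have "0 < r" "r < R" using R e e_le n(1) by (auto simp: r_def)
  then have r: "0 < r" "r < R" "r \<le> 1" using R by auto
  have "e < 1 / K" using e_le n(2) by simp
  then have Kr: "K \<le> 2 * R / r" using K R e by (simp add: r_def field_simps)
  define A where "A = cell n l \<omega>"
  let ?B = "cball (pt \<omega>) (2 * R) \<inter> F"
  have q: "kR r \<omega>' \<le> l \<and> m0 (sq r \<omega>') \<le> r powr s1 * (tt \<omega> n * e powr t J)" if wA: "\<omega>' \<in> A" for \<omega>'
  proof -
    have w': "\<omega>' \<in> \<Omega>" using wA by (simp add: A_def cell_def)
    have cJ: "col (\<omega>' m) = col J" if "n \<le> m" "m < l" for m
      using wA that by (simp add: A_def cell_def \<omega>_def)
    have dn: "dd \<omega>' n = R" using cell_dd[OF wA[unfolded A_def] order.refl] ddn by simp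
    have "dd \<omega>' l \<le> r" using dd_le_column[OF w' nl cJ] by (simp add: dn r_def e_def)
    then have kl: "kR r \<omega>' \<le> l" by (rule hit_le)
    have nk: "n \<le> kR r \<omega>'"
    proof (rule ccontr)
      assume "\<not> n \<le> kR r \<omega>'"
      then have "R \<le> dd \<omega>' (kR r \<omega>')" unfolding dn[symmetric] by (intro dd_antimono w') simp
      with dd_hit_le[OF w' r(1)] r(2) show False by simp
    qed
    have ttn: "tt \<omega>' n = tt \<omega> n" using wA by (auto simp: tt_def A_def cell_def intro!: prod.cong)
    have "tt \<omega>' (kR r \<omega>') * R powr t J = tt \<omega> n * dd \<omega>' (kR r \<omega>') powr t J"
      unfolding dn[symmetric] ttn[symmetric]
    proof (rule tt_split[OF nk])
      fix m assume "n \<le> m" "m < kR r \<omega>'"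
      then show "t (\<omega>' m) = t J" using cJ kl by (intro t_col Omega_D w' J) auto
    qed
    also have "\<dots> \<le> tt \<omega> n * r powr t J"
      using dd_hit_powr(1)[OF w' r(1,3) t_nonneg[OF J]] tt_pos[OF w] by (simp add: less_imp_le)
    also have "\<dots> = (tt \<omega> n * e powr t J) * R powr t J"
      using R e by (simp add: r_def powr_mult)
    finally have "tt \<omega>' (kR r \<omega>') \<le> tt \<omega> n * e powr t J" using R by simp
    then have "m0 (sq r \<omega>') \<le> r powr s1 * (tt \<omega> n * e powr t J)"
      unfolding m0_cell[OF w' kR_le_lR[OF w' r(1)]]
      using cc_hit_powr(1)[OF w' r(1,3) s1_nonneg] tt_pos[OF w'] by (intro mult_mono) (auto simp: less_imp_le)
    with kl show ?thesis by blast
  qed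
  have "(\<kappa> * R) powr s1 * tt \<omega> n \<le> m0 A"
    unfolding A_def m0_cell[OF w nl] unfolding l_def using cc_hit_powr(2)[OF w R s1_nonneg] tt_pos[OF w]
    by (intro mult_right_mono) (auto simp: less_imp_le)
  also have "\<dots> \<le> real (card (sq r ` A)) * (r powr s1 * (tt \<omega> n * e powr t J))"
  proof (rule mass_le_card_times[OF probs_p0 stopping_square[OF r(1)]])
    show "sq r ` A \<subseteq> squares r" unfolding cells_def A_def using cell_subset by blast
    show "A \<subseteq> \<Union>(sq r ` A)" using cell_self by (auto simp: A_def cell_def)
  qed (use q in auto)
  also have "\<dots> \<le> (pack 1 * NN r (2 * R) (pt \<omega>)) * (r powr s1 * (tt \<omega> n * e powr t J))"
  proof (rule mult_right_mono)
    have "sq r ` A \<subseteq> hits r ?B"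
    proof (rule image_subsetI)
      fix \<omega>' assume wA: "\<omega>' \<in> A"
      then have w': "\<omega>' \<in> \<Omega>" by (simp add: A_def cell_def)
      have "dist (pt \<omega>) (pt \<omega>') \<le> 2 * R"
        using dist_pt_cell[OF w wA[unfolded A_def]] ccl(1) ddn by simp
      then show "sq r \<omega>' \<in> hits r ?B" using pt_in_F[OF w'] by (intro hitsI w') auto
    qed
    then have "card (sq r ` A) \<le> card (hits r ?B)" by (intro card_mono finite_hits r)
    then show "real (card (sq r ` A)) \<le> pack 1 * NN r (2 * R) (pt \<omega>)"
      using hits_le_covering_number[OF r(1,3), of ?B] by simp
  qed (use tt_pos[OF w] in \<open>auto simp: less_imp_le\<close>)
  finally have "((\<kappa> * R) powr s1) * tt \<omega> n \<le> (pack 1 * NN r (2 * R) (pt \<omega>) * (r powr s1 * e powr t J)) * tt \<omega> n"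
    by (simp add: mult_ac)
  then have main: "(\<kappa> * R) powr s1 \<le> pack 1 * NN r (2 * R) (pt \<omega>) * (r powr s1 * e powr t J)"
    by (rule mult_right_le_imp_le[OF _ tt_pos[OF w]])
  have "c * (2 * R / r) powr ?s \<le> NN r (2 * R) (pt \<omega>)"
  proof -
    have "2 * R / r = 2 / e" using R e by (simp add: r_def)
    then have "c * (2 * R / r) powr ?s = \<kappa> powr s1 / pack 1 / (e powr s1 * e powr t J)"
      using e by (simp add: c_def powr_divide powr_add)
    also have "\<dots> = (\<kappa> * R) powr s1 / (pack 1 * (r powr s1 * e powr t J))"
      using R e kappa_pos by (simp add: r_def powr_mult)
    also have "\<dots> \<le> NN r (2 * R) (pt \<omega>)"
      using main pack_pos[of 1] e r by (subst pos_divide_le_eq) (auto simp: mult_ac)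
    finally show ?thesis .
  qed
  then show "\<exists>r R x. 0 < r \<and> r < R \<and> R \<le> \<rho> \<and> K \<le> R / r \<and> x \<in> F \<and> c * (R / r) powr ?s \<le> NN r R x"
    using r R Kr n(3) pt_in_F[OF w] by (intro exI[of _ r] exI[of _ "2 * R"] exI[of _ "pt \<omega>"]) (auto simp: R_def)
qed

text \<open>
  Here the ball around the witness must not meet neighbouring cells. The letters \<open>q1, q2\<close> keep
  it away from the horizontal sides of the strip and \<open>j1, j2\<close> from the vertical sides of the column.
\<close>

lemma lower_dim_le_fibre:
  assumes a: "a \<in> I" "height a < base a" and J: "J \<in> I"
    and q: "q1 \<in> I" "q2 \<in> I" "col q1 = col q2" "q1 \<noteq> q2"
    and j: "j1 \<in> I" "j2 \<in> I" "col j1 \<noteq> col j2"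
  shows "lower_dim F \<le> s1 + t J"
proof (rule lower_dim_le)
  let ?s = "s1 + t J"
  have s: "0 \<le> ?s" using s1_nonneg t_nonneg J by simp
  define h b where "h = height a" and "b = base a"
  have hb: "0 < h" "h < b" "b < 1" "h < 1"
    using a height_pos base_less by (auto simp: h_def b_def intro: less_trans)
  define dx where "dx = min (left j1 + base j1 * left j2) (1 - (left j1 + base j1 * (left j2 + base j2)))"
  define dy where "dy = min (bottom q1 + height q1 * bottom q2) (1 - (bottom q1 + height q1 * (bottom q2 + height q2)))"
  \<comment> \<open>The column will have width at least \<open>\<kappa> * R\<close> and the strip
    height \<open>R\<close>, so a ball of radius \<open>\<delta> * R\<close> stays within both
    margins; halving makes this strict.\<close>
  define \<delta> where "\<delta> = min (\<kappa> * dx) dy / 2"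
  define T where "T = t q1"
  \<comment> \<open>The 5 comes from bounding covering numbers at \<open>5 * r\<close> by squares of
    scale \<open>r\<close>, the power of \<open>\<kappa>\<close> from stopping overshoots and from
    the two letters in the column of \<open>q1\<close>.\<close>
  define c where "c = (5 / \<delta>) powr ?s / (\<kappa> powr (?s + 2 * T))"
  fix K \<rho> :: real
  have dxy: "0 < dx \<and> 0 < dy"
  proof -
    define \<omega> where "\<omega> m = (if m = 0 then j1 else j2)" for m :: nat
    define \<omega>' where "\<omega>' m = (if m = 0 then q1 else q2)" for m :: nat
    have w: "\<omega> \<in> \<Omega>" "\<omega>' \<in> \<Omega>" using q j by (auto simp: Omega_iff \<omega>_def \<omega>'_def)
    show ?thesis
      using nested_intervals_margin(1)[OF nested_x[OF w(1)], of 0] col_sep[OF j]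
        nested_intervals_margin(1)[OF nested_y[OF w(2)], of 0] row_sep[OF q]
      by (auto simp: \<omega>_def \<omega>'_def dx_def dy_def)
  qed
  then have \<delta>: "0 < \<delta>" "\<delta> < \<kappa> * dx" "\<delta> < dy" using kappa_pos by (auto simp: \<delta>_def min_def)
  then show c: "0 < c" using kappa_pos by (simp add: c_def)
  assume K: "0 < K" and \<rho>: "0 < \<rho>"
  \<comment> \<open>The minimum collects the three upper bounds that \<open>e\<close> must satisfy;
    the last factor makes up for the bases of \<open>q1\<close> and \<open>q2\<close>.\<close>
  define M where "M = min (\<kappa>\<^sup>2) (min (\<delta> / 5) (\<delta> / (5 * K))) * \<kappa>\<^sup>2"
  have M: "0 < M" using kappa_pos \<delta> K by (auto simp: M_def)
  have "\<forall>\<^sub>F n in sequentially. (h / b) ^ n < M"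
    using hb M by (intro order_tendstoD(2)[OF LIMSEQ_power_zero]) auto
  moreover have "\<forall>\<^sub>F n in sequentially. h ^ n < \<rho> / \<delta>"
    using hb \<rho> \<delta> by (intro order_tendstoD(2)[OF LIMSEQ_power_zero]) auto
  ultimately obtain n where n: "(h / b) ^ n < M" "h ^ n < \<rho> / \<delta>"
    using eventually_happens[OF eventually_conj] by force
  define R where "R = h ^ n"
  have R: "0 < R" "R \<le> 1" using hb by (auto simp: R_def power_le_one)
  \<comment> \<open>The vertical buffer \<open>q1, q2\<close> precedes the run of \<open>J\<close>.
    The horizontal buffer \<open>j1, j2\<close> can be placed only after \<open>l\<close>, so
    \<open>l\<close> is read off from \<open>\<omega>0\<close> before the tail is changed.\<close>
  define \<omega>0 where "\<omega>0 m = (if m < n then a else if m = n then q1 else if m = Suc n then q2 else J)" for m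
  have w0: "\<omega>0 \<in> \<Omega>" using a J q by (auto simp: Omega_iff \<omega>0_def)
  define l where "l = lR R \<omega>0"
  define \<omega> where "\<omega> m = (if m < l then \<omega>0 m else if m = l then j1 else j2)" for m
  have w: "\<omega> \<in> \<Omega>" using w0 j by (auto simp: Omega_iff \<omega>_def)
  have ccn0: "cc \<omega>0 n = b ^ n" unfolding b_def by (rule scale_const) (simp add: \<omega>0_def)
  have bq: "base q2 = base q1" using q by (simp add: col_def)
  have ccn2: "cc \<omega>0 (Suc (Suc n)) = b ^ n * (base q1)\<^sup>2"
  proof -
    have "\<omega>0 n = q1" "\<omega>0 (Suc n) = q2" by (auto simp: \<omega>0_def)
    then show ?thesis by (simp add: scale_Suc ccn0 bq power2_eq_square)
  qed
  have "\<kappa>\<^sup>2 \<le> (base q1)\<^sup>2" using kappa_le_base[OF q(1)] kappa_pos by (intro power_mono) auto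
  have small: "R < M * b ^ n" using n(1) hb by (simp add: R_def power_divide field_simps)
  have "M \<le> \<kappa>\<^sup>2 * \<kappa>\<^sup>2" using kappa_pos unfolding M_def by (intro mult_right_mono) auto
  also have "\<dots> \<le> 1 * \<kappa>\<^sup>2" using kappa_pos kappa_less_1 by (intro mult_right_mono) (auto simp: power_le_one)
  finally have "M \<le> (base q1)\<^sup>2" using \<open>\<kappa>\<^sup>2 \<le> (base q1)\<^sup>2\<close> by simp
  then have "R < cc \<omega>0 (Suc (Suc n))"
    unfolding ccn2 using small hb by (smt (verit) mult.commute mult_right_mono zero_le_power)
  have nl: "Suc (Suc n) \<le> l"
  proof (rule ccontr)
    assume "\<not> Suc (Suc n) \<le> l"
    then have "cc \<omega>0 (Suc (Suc n)) \<le> cc \<omega>0 l" by (intro cc_antimono w0) simp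
    with cc_hit_le[OF w0 R(1)] \<open>R < cc \<omega>0 (Suc (Suc n))\<close> show False by (simp add: l_def)
  qed
  have cc_eq: "cc \<omega> l = cc \<omega>0 l" by (intro scale_cong) (simp add: \<omega>_def)
  have ccl: "cc \<omega> l \<le> R" "\<kappa> * R \<le> cc \<omega> l"
    unfolding cc_eq unfolding l_def by (rule cc_hit_le[OF w0 R(1)] cc_hit_ge[OF w0 R])+
  have ddn: "dd \<omega> n = R"
    unfolding R_def h_def using nl by (intro scale_const) (simp add: \<omega>_def \<omega>0_def)
  define e where "e = base J ^ (l - Suc (Suc n))"
  have e: "0 < e" using base_pos[OF J] by (simp add: e_def)
  have "(\<Prod>m=Suc (Suc n)..<l. base (\<omega>0 m)) = e" unfolding e_def
    by (subst prod.cong[OF refl, where h = "\<lambda>_. base J"]) (auto simp: \<omega>0_def)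
  then have "cc \<omega> l = b ^ n * (base q1)\<^sup>2 * e" using scale_split[OF nl] by (simp add: cc_eq ccn2)
  then have "b ^ n * \<kappa>\<^sup>2 * e \<le> R"
    using ccl(1) \<open>\<kappa>\<^sup>2 \<le> (base q1)\<^sup>2\<close> e hb by (smt (verit) mult_left_mono mult_right_mono zero_le_power)
  also have "R < M * b ^ n" by (rule small)
  finally have "e * \<kappa>\<^sup>2 < M" using hb by (simp add: mult_ac)
  then have e_less: "e < \<kappa>\<^sup>2" "e < \<delta> / 5" "e < \<delta> / (5 * K)" using kappa_pos by (simp_all add: M_def)
  define r where "r = R * e"
  have r: "0 < r" "r < \<kappa>\<^sup>2 * R" using R e e_less by (auto simp: r_def)
  have "\<kappa>\<^sup>2 * R \<le> \<kappa> * R" using R kappa_pos kappa_less_1 by (simp add: power2_eq_square)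
  moreover have "\<kappa> * R \<le> R" using R kappa_less_1 by simp
  ultimately have r': "r < \<kappa> * R" "r < R" "r \<le> 1" using r R by linarith+
  define A where "A = cell n l \<omega>"
  let ?B = "cball (pt \<omega>) (\<delta> * R) \<inter> F"
  have xm: "xx \<omega> l + dx * cc \<omega> l \<le> fst (pt \<omega>)" "fst (pt \<omega>) \<le> xx \<omega> l + cc \<omega> l - dx * cc \<omega> l"
    using nested_intervals_margin(2,3)[OF nested_x[OF w], of l] col_sep[OF j]
    by (auto simp: pt_def \<omega>_def dx_def)
  have "\<omega> n = q1" "\<omega> (Suc n) = q2" using nl by (auto simp: \<omega>_def \<omega>0_def)
  then have ym: "yy \<omega> n + dy * dd \<omega> n \<le> snd (pt \<omega>)" "snd (pt \<omega>) \<le> yy \<omega> n + dd \<omega> n - dy * dd \<omega> n"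
    using nested_intervals_margin(2,3)[OF nested_y[OF w], of n] row_sep[OF q]
    by (auto simp: pt_def dy_def)
  \<comment> \<open>A code outside the cell would lie beyond a side of the column or of the strip,
    farther from \<open>pt \<omega>\<close> than the radius allows. Columns come first, because
    vertical separation presupposes them.\<close>
  have inA: "\<omega>' \<in> A" if w': "\<omega>' \<in> \<Omega>" and pB: "pt \<omega>' \<in> ?B" for \<omega>'
  proof -
    have d: "\<bar>fst (pt \<omega>) - fst (pt \<omega>')\<bar> \<le> \<delta> * R" "\<bar>snd (pt \<omega>) - snd (pt \<omega>')\<bar> \<le> \<delta> * R"
      using pB dist_fst_le[of "pt \<omega>" "pt \<omega>'"] dist_snd_le[of "pt \<omega>" "pt \<omega>'"] by (auto simp: dist_real_def)
    have cols: "\<forall>m<l. col (\<omega> m) = col (\<omega>' m)"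
    proof (rule ccontr)
      assume "\<not> ?thesis"
      then have ex: "\<exists>m. m < l \<and> col (\<omega> m) \<noteq> col (\<omega>' m)" by blast
      define m where "m = (LEAST m. m < l \<and> col (\<omega> m) \<noteq> col (\<omega>' m))"
      have m: "m < l \<and> col (\<omega> m) \<noteq> col (\<omega>' m)" unfolding m_def using ex by (rule LeastI_ex)
      have "col (\<omega> i) = col (\<omega>' i)" if "i < m" for i
        using not_less_Least[OF that[unfolded m_def]] that m by auto
      from x_separated[OF w w' this, of m l l] m
      have "xx \<omega> l + cc \<omega> l \<le> xx \<omega>' l \<or> xx \<omega>' l + cc \<omega>' l \<le> xx \<omega> l" by auto
      then have "dx * cc \<omega> l \<le> \<delta> * R" using pt_in[OF w', of l] xm d(1) by linarith
      moreover have "\<delta> * R < \<kappa> * dx * R" using \<delta>(2) R by simp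
      moreover have "\<kappa> * dx * R \<le> dx * cc \<omega> l" using ccl(2) dxy by (metis less_imp_le mult.assoc mult.commute mult_left_mono)
      ultimately show False by simp
    qed
    have lets: "\<forall>m<n. \<omega> m = \<omega>' m"
    proof (rule ccontr)
      assume "\<not> ?thesis"
      then have ex: "\<exists>m. m < n \<and> \<omega> m \<noteq> \<omega>' m" by blast
      define m where "m = (LEAST m. m < n \<and> \<omega> m \<noteq> \<omega>' m)"
      have m: "m < n \<and> \<omega> m \<noteq> \<omega>' m" unfolding m_def using ex by (rule LeastI_ex)
      have "\<omega> i = \<omega>' i" if "i < m" for i
        using not_less_Least[OF that[unfolded m_def]] that m by auto
      moreover have "col (\<omega> m) = col (\<omega>' m)" using cols m nl by simp
      ultimately have "yy \<omega> n + dd \<omega> n \<le> yy \<omega>' n \<or> yy \<omega>' n + dd \<omega>' n \<le> yy \<omega> n"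
        using y_separated[OF w w', of m n n] m by auto
      then have "dy * dd \<omega> n \<le> \<delta> * R" using pt_in[OF w', of n] ym d(2) by linarith
      moreover have "\<delta> * R < dy * dd \<omega> n" using \<delta>(3) R by (simp add: ddn)
      ultimately show False by simp
    qed
    show ?thesis using w' cols lets by (simp add: A_def cell_def)
  qed
  \<comment> \<open>The letters at \<open>n\<close> and \<open>Suc n\<close> have fibre exponent
    \<open>T\<close> in place of \<open>t J\<close>; being only two, they cost at most the constant
    \<open>\<kappa> powr (2 * T)\<close>.\<close>
  have sqA: "sq r \<omega>' \<subseteq> A \<and> (\<kappa> * r) powr s1 * (tt \<omega> n * \<kappa> powr (2 * T) * (\<kappa> * e) powr t J) \<le> m0 (sq r \<omega>')"
    if wA: "\<omega>' \<in> A" for \<omega>'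
  proof -
    have w': "\<omega>' \<in> \<Omega>" using wA by (simp add: A_def cell_def)
    have dn: "dd \<omega>' n = R" using cell_dd[OF wA[unfolded A_def] order.refl] ddn by simp
    have cl: "cc \<omega>' l = cc \<omega> l" using cell_cc[OF wA[unfolded A_def] order.refl] by simp
    have colw: "col (\<omega>' m) = col (\<omega>0 m)" if "m < l" for m using wA that by (simp add: A_def cell_def \<omega>_def)
    have cJ: "col (\<omega>' m) = col J" if "Suc (Suc n) \<le> m" "m < l" for m
      using colw[OF that(2)] that(1) by (simp add: \<omega>0_def)
    have d2: "\<kappa>\<^sup>2 * R \<le> dd \<omega>' (Suc (Suc n))" "dd \<omega>' (Suc (Suc n)) \<le> R"
    proof -
      have "\<kappa> * \<kappa> \<le> height (\<omega>' n) * height (\<omega>' (Suc n))"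
        using kappa_le_height[OF Omega_D[OF w']] kappa_pos by (intro mult_mono) (auto intro: order_trans less_imp_le)
      then show "\<kappa>\<^sup>2 * R \<le> dd \<omega>' (Suc (Suc n))"
        using R by (simp add: scale_Suc dn power2_eq_square mult_ac)
      show "dd \<omega>' (Suc (Suc n)) \<le> R" unfolding dn[symmetric] by (intro dd_antimono w') simp
    qed
    have "dd \<omega>' l \<le> dd \<omega>' (Suc (Suc n)) * e" unfolding e_def by (rule dd_le_column[OF w' nl cJ])
    also have "\<dots> \<le> r" unfolding r_def using d2(2) e by (intro mult_right_mono) auto
    finally have kl: "kR r \<omega>' \<le> l" by (rule hit_le)
    have nk: "Suc (Suc n) \<le> kR r \<omega>'"
    proof (rule ccontr)
      assume "\<not> Suc (Suc n) \<le> kR r \<omega>'"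
      then have "dd \<omega>' (Suc (Suc n)) \<le> dd \<omega>' (kR r \<omega>')" by (intro dd_antimono w') simp
      with dd_hit_le[OF w' r(1)] r(2) d2(1) show False by simp
    qed
    have ll: "l \<le> lR r \<omega>'"
    proof (rule ccontr)
      assume "\<not> l \<le> lR r \<omega>'"
      then have "cc \<omega>' l \<le> cc \<omega>' (lR r \<omega>')" by (intro cc_antimono w') simp
      with cc_hit_le[OF w' r(1)] ccl(2) r'(1) show False by (simp add: cl)
    qed
    have "sq r \<omega>' \<subseteq> cell n l \<omega>'" using nk ll by (intro cell_mono) auto
    also have "\<dots> = A" unfolding A_def using wA by (intro cell_eqI) (simp add: A_def)
    finally have sub: "sq r \<omega>' \<subseteq> A" .
    have ttn: "tt \<omega>' n = tt \<omega> n" using wA by (auto simp: tt_def A_def cell_def intro!: prod.cong)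
    have T': "t (\<omega>' n) = T" "t (\<omega>' (Suc n)) = T"
    proof -
      have "col (\<omega>' n) = col q1" "col (\<omega>' (Suc n)) = col q1"
        using colw[of n] colw[of "Suc n"] nl q(3) by (auto simp: \<omega>0_def)
      then show "t (\<omega>' n) = T" "t (\<omega>' (Suc n)) = T"
        unfolding T_def by (intro t_col Omega_D w' q; simp)+
    qed
    have kT: "\<kappa> powr T \<le> height (\<omega>' m) powr T" for m
      using kappa_le_height[OF Omega_D[OF w']] kappa_pos t_nonneg[OF q(1)] by (intro powr_mono2) (auto simp: T_def)
    have "tt \<omega> n * \<kappa> powr (2 * T) = tt \<omega> n * (\<kappa> powr T * \<kappa> powr T)" by (simp flip: powr_add)
    also have "\<dots> \<le> tt \<omega> n * (height (\<omega>' n) powr T * height (\<omega>' (Suc n)) powr T)"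
      using kT tt_pos[OF w, of n] by (intro mult_left_mono mult_mono) auto
    also have "\<dots> = tt \<omega>' (Suc (Suc n))" unfolding ttn[symmetric] by (simp add: tt_def T')
    finally have tt2: "tt \<omega> n * \<kappa> powr (2 * T) \<le> tt \<omega>' (Suc (Suc n))" .
    have tJ: "0 \<le> t J" by (rule t_nonneg[OF J])
    have "(tt \<omega> n * \<kappa> powr (2 * T) * (\<kappa> * e) powr t J) * R powr t J
      = (tt \<omega> n * \<kappa> powr (2 * T)) * (\<kappa> * r) powr t J"
      using R e kappa_pos by (simp add: r_def powr_mult)
    also have "\<dots> \<le> tt \<omega>' (Suc (Suc n)) * dd \<omega>' (kR r \<omega>') powr t J"
      using tt2 dd_hit_powr(2)[OF w' r(1) r'(3) tJ] tt_pos[OF w'] by (intro mult_mono) (auto simp: less_imp_le)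
    also have "\<dots> = tt \<omega>' (kR r \<omega>') * dd \<omega>' (Suc (Suc n)) powr t J"
    proof (rule tt_split[OF nk, symmetric])
      fix m assume "Suc (Suc n) \<le> m" "m < kR r \<omega>'"
      then show "t (\<omega>' m) = t J" using cJ kl by (intro t_col Omega_D w' J) auto
    qed
    also have "\<dots> \<le> tt \<omega>' (kR r \<omega>') * R powr t J"
      using d2(2) dd_pos[OF w'] tt_pos[OF w'] tJ by (intro mult_left_mono powr_mono2) (auto simp: less_imp_le)
    finally have "tt \<omega> n * \<kappa> powr (2 * T) * (\<kappa> * e) powr t J \<le> tt \<omega>' (kR r \<omega>')"
      using R by simp
    then have "(\<kappa> * r) powr s1 * (tt \<omega> n * \<kappa> powr (2 * T) * (\<kappa> * e) powr t J) \<le> m0 (sq r \<omega>')"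
      unfolding m0_cell[OF w' kR_le_lR[OF w' r(1)]]
      using cc_hit_powr(2)[OF w' r(1) r'(3) s1_nonneg] tt_pos[OF w, of n] by (intro mult_mono) (auto simp: less_imp_le)
    with sub show ?thesis by blast
  qed
  define m where "m = (\<kappa> * r) powr s1 * (\<kappa> powr (2 * T) * (\<kappa> * e) powr t J)"
  have m: "0 < m" using r e kappa_pos by (simp add: m_def)
  have hit: "Q \<subseteq> A \<and> m * tt \<omega> n \<le> m0 Q" if Q: "Q \<in> hits r ?B" for Q
  proof -
    obtain \<omega>' where w': "\<omega>' \<in> Q" "pt \<omega>' \<in> ?B" "Q \<in> squares r" using Q by (auto simp: hits_def)
    have "\<omega>' \<in> \<Omega>" using w' cells_subset by blast
    then have "\<omega>' \<in> A" using inA w'(2) by blast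
    moreover have "Q = sq r \<omega>'" by (rule cells_eq[OF stopping_square[OF r(1)] w'(3,1)])
    ultimately show ?thesis using sqA[of \<omega>'] by (simp add: m_def mult_ac)
  qed
  have nl': "n \<le> l" using nl by simp
  have "real (card (hits r ?B)) * (m * tt \<omega> n) \<le> m0 A"
    using hit cell_mu(1)[OF probs_p0 w nl']
    by (intro card_times_mass_le[OF probs_p0 stopping_square[OF r(1)] hits_subset]) (auto simp: A_def)
  also have "\<dots> \<le> R powr s1 * tt \<omega> n"
    unfolding A_def m0_cell[OF w nl']
    using ccl(1) cc_pos[OF w] s1_nonneg tt_pos[OF w] by (intro mult_right_mono powr_mono2) (auto simp: less_imp_le)
  finally have "(real (card (hits r ?B)) * m) * tt \<omega> n \<le> R powr s1 * tt \<omega> n" by (simp add: mult_ac)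
  then have "real (card (hits r ?B)) * m \<le> R powr s1"
    by (rule mult_right_le_imp_le[OF _ tt_pos[OF w]])
  then have "real (card (hits r ?B)) \<le> R powr s1 / m" using m by (simp add: field_simps)
  also have "\<dots> = (1 / e) powr ?s / \<kappa> powr (?s + 2 * T)"
    using R e kappa_pos by (simp add: m_def r_def powr_mult powr_add powr_divide field_simps)
  also have "\<dots> = c * ((\<delta> * R) / (5 * r)) powr ?s"
    using R e \<delta>(1) by (simp add: c_def r_def powr_mult powr_divide)
  finally have "NN (5 * r) (\<delta> * R) (pt \<omega>) \<le> c * ((\<delta> * R) / (5 * r)) powr ?s"
    using covering_number_le_hits[of "5 * r" ?B] r by simp
  moreover have "5 * r < \<delta> * R" using e_less(2) R by (simp add: r_def)
  moreover have "K \<le> (\<delta> * R) / (5 * r)" using e_less(3) R K e by (simp add: r_def field_simps)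
  moreover have "\<delta> * R \<le> \<rho>" using n(2) \<delta>(1) by (simp add: R_def field_simps)
  ultimately show "\<exists>r R x. 0 < r \<and> r < R \<and> R \<le> \<rho> \<and> K \<le> R / r \<and> x \<in> F \<and> NN r R x \<le> c * (R / r) powr ?s"
    using r(1) pt_in_F[OF w] by (intro exI[of _ "5 * r"] exI[of _ "\<delta> * R"] exI[of _ "pt \<omega>"]) auto
qed

text \<open>
  Tilting \<open>p0\<close> by \<open>g\<close> shows that the product of the \<open>g (\<omega> m)\<close> is exponentially small outside a set
  of mass at most one half.
\<close>

lemma less_hausdorff_dim:
  assumes J: "J \<in> I" "\<And>q. q \<in> I \<Longrightarrow> t J \<le> t q" and q0: "q0 \<in> I" "t J < t q0"
  shows "s1 + t J < hausdorff_dim F"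
proof -
  define g where "g q = height q powr (t q - t J)" for q
  have g: "0 < g q" "g q \<le> 1" if "q \<in> I" for q
    using height_pos[OF that] height_less[OF that] J(2)[OF that] by (auto simp: g_def powr_le1)
  define Z where "Z = (\<Sum>q\<in>I. p0 q * g q)"
  have Z: "0 < Z" unfolding Z_def using fin ne p0_pos g by (intro sum_pos) auto
  have "g q0 < 1" using height_pos[OF q0(1)] height_less[OF q0(1)] q0(2)
    using powr_less_mono'[of "height q0" 0 "t q0 - t J"] by (auto simp: g_def)
  then have "Z < (\<Sum>q\<in>I. p0 q * 1)" unfolding Z_def
    using g p0_pos fin q0(1) by (intro sum_strict_mono_ex1) (auto intro!: mult_left_le less_imp_le)
  then have Z1: "Z < 1" using is_prob_p0 by (simp add: is_prob_def)
  \<comment> \<open>Of \<open>Z ^ n = y ^ n * y ^ n\<close>, one factor bounds the mass of the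
    exceptional set, the other the product of the \<open>g (\<omega> m)\<close> outside it.\<close>
  define y where "y = sqrt Z"
  have y: "0 < y" "y < 1" "y * y = Z" using Z Z1 by (auto simp: y_def)
  define p where "p q = p0 q * g q / Z" for q
  have p: "probs (\<lambda>_. p)"
    using Z p0_pos g by (auto simp: probs_def is_prob_def p_def Z_def less_imp_le simp flip: sum_divide_distrib)
  define gn where "gn \<omega> n = (\<Prod>m<n. g (\<omega> m))" for \<omega> and n :: nat
  \<comment> \<open>Chosen so that the bounds \<open>y ^ n / C\<close> for the exceptional masses
    sum to one half.\<close>
  define C where "C = 2 / (1 - y)"
  have C: "0 < C" using y by (simp add: C_def)
  interpret M: prob_space "\<mu> (\<lambda>_. p0)" by (rule prob_mu[OF probs_p0])
  let ?c = "\<lambda>n. cells (\<lambda>_. n) (\<lambda>_. n)"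
  define S where "S n = {Q \<in> ?c n. \<exists>\<omega>\<in>Q. C * y ^ n < gn \<omega> n}" for n
  define B where "B n = \<Union>(S n)" for n
  have Ssub: "S n \<subseteq> ?c n" for n by (auto simp: S_def)
  have B: "B n \<in> sets (\<mu> (\<lambda>_. p0))" for n
    unfolding B_def
  proof (rule sets.finite_Union)
    show "finite (S n)" by (rule finite_subset[OF Ssub finite_cells[OF stopping_const]])
    show "S n \<subseteq> sets (\<mu> (\<lambda>_. p0))" using Ssub cells_sets[OF probs_p0 stopping_const] by blast
  qed
  have mB: "m0 (B n) \<le> (1 - y) / 2 * y ^ n" for n
  proof -
    have "m0 (B n) = (\<Sum>Q\<in>S n. m0 Q)" unfolding B_def by (rule sum_cells[OF probs_p0 stopping_const Ssub, symmetric])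
    also have "\<dots> \<le> (\<Sum>Q\<in>S n. (y ^ n / C) * measure (\<mu> (\<lambda>_. p)) Q)"
    proof (rule sum_mono)
      fix Q assume Q: "Q \<in> S n"
      then obtain \<omega> where w: "\<omega> \<in> Q" "C * y ^ n < gn \<omega> n" by (auto simp: S_def)
      have wO: "\<omega> \<in> \<Omega>" using Q Ssub w(1) cells_subset by blast
      have Qe: "Q = cell n n \<omega>" using cells_eq[OF stopping_const _ w(1)] Q Ssub by blast
      \<comment> \<open>The tilted mass of a cylinder is its \<open>m0\<close>-mass times
        \<open>gn \<omega> n / Z ^ n\<close>. Since tilted masses sum to at most 1, this yields a
        Markov-type bound for the cylinders with large \<open>gn\<close>.\<close>
      have "(\<Prod>m<n. p (\<omega> m)) = (\<Prod>m<n. p0 (\<omega> m)) * gn \<omega> n / Z ^ n"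
        by (simp add: p_def gn_def prod.distrib prod_dividef)
      then have "Z ^ n * measure (\<mu> (\<lambda>_. p)) Q = m0 Q * gn \<omega> n"
        unfolding Qe cell_mu(2)[OF p wO order.refl] cell_mu(2)[OF probs_p0 wO order.refl] using Z by simp
      moreover have "m0 Q * (C * y ^ n) \<le> m0 Q * gn \<omega> n" using w(2) by (intro mult_left_mono) auto
      ultimately have "m0 Q * (C * y ^ n) \<le> y ^ n * y ^ n * measure (\<mu> (\<lambda>_. p)) Q"
        by (simp add: y(3)[symmetric] power_mult_distrib)
      then show "m0 Q \<le> (y ^ n / C) * measure (\<mu> (\<lambda>_. p)) Q" using y C by (simp add: field_simps)
    qed
    also have "\<dots> = (y ^ n / C) * (\<Sum>Q\<in>S n. measure (\<mu> (\<lambda>_. p)) Q)" by (simp add: sum_distrib_left)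
    also have "\<dots> \<le> (y ^ n / C) * 1"
      using sum_cells_le_1[OF p stopping_const Ssub] y C by (intro mult_left_mono) auto
    finally show ?thesis by (simp add: C_def mult_ac)
  qed
  define G where "G = \<Omega> - (\<Union>n. B n)"
  have OS: "\<Omega> \<in> sets (\<mu> (\<lambda>_. p0))" using sets.top[of "\<mu> (\<lambda>_. p0)"] by (simp add: space_mu)
  have UB: "(\<Union>n. B n) \<in> sets (\<mu> (\<lambda>_. p0))" using B by auto
  have G: "G \<in> sets (\<mu> (\<lambda>_. p0))" unfolding G_def using OS UB by blast
  have sums: "(\<lambda>n. (1 - y) / 2 * y ^ n) sums (1 / 2)"
  proof -
    have "(1 - y) / 2 * (1 / (1 - y)) = 1 / 2" using y by simp
    then show ?thesis using sums_mult[OF geometric_sums[of y], of "(1 - y) / 2"] y by (simp only: real_norm_def abs_of_pos)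
  qed
  have "m0 (\<Union>n. B n) \<le> (\<Sum>n. m0 (B n))"
    using B mB sums y by (intro M.finite_measure_subadditive_countably summable_comparison_test'[OF sums_summable[OF sums]]) auto
  also have "\<dots> \<le> 1 / 2"
    unfolding sums_unique[OF sums]
    using B mB sums y by (intro suminf_le sums_summable[OF sums] summable_comparison_test'[OF sums_summable[OF sums]]) auto
  finally have "m0 (\<Union>n. B n) \<le> 1 / 2" .
  moreover have "m0 G = 1 - m0 (\<Union>n. B n)"
    unfolding G_def using M.prob_compl[OF UB] by (simp add: space_mu)
  ultimately have mG: "0 < m0 G" by simp
  have gG: "gn \<omega> n \<le> C * y ^ n" if w: "\<omega> \<in> G" for \<omega> n
  proof (rule ccontr)
    assume "\<not> ?thesis"
    moreover have wO: "\<omega> \<in> \<Omega>" using w by (simp add: G_def)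
    ultimately have "cell n n \<omega> \<in> S n" using cell_self[OF wO] by (auto simp: S_def cells_def not_le)
    then have "\<omega> \<in> B n" unfolding B_def using cell_self[OF wO] by blast
    with w show False by (auto simp: G_def)
  qed
  \<comment> \<open>The exponent with \<open>\<kappa> powr \<eta> = y\<close>: as
    \<open>dd \<omega> k \<ge> \<kappa> ^ k\<close>, decay in the number of letters becomes decay in
    the scale.\<close>
  define \<eta> where "\<eta> = ln y / ln \<kappa>"
  have \<eta>: "0 < \<eta>" using y kappa_pos kappa_less_1 by (simp add: \<eta>_def divide_neg_neg)
  have ky: "\<kappa> powr \<eta> = y" using y kappa_pos kappa_less_1 by (simp add: \<eta>_def powr_def)
  have tJ: "0 \<le> t J" by (rule t_nonneg[OF J(1)])
  have mass: "m0 (sq R \<omega>) \<le> C * R powr (s1 + t J + \<eta>)" if w: "\<omega> \<in> G" and R: "0 < R" "R \<le> 1" for \<omega> R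
  proof -
    have wO: "\<omega> \<in> \<Omega>" using w by (simp add: G_def)
    let ?k = "kR R \<omega>"
    have "y ^ ?k = (\<kappa> ^ ?k) powr \<eta>" unfolding ky[symmetric] using kappa_pos by (simp add: powr_power mult.commute powr_powr flip: powr_realpow)
    also have "\<dots> \<le> dd \<omega> ?k powr \<eta>" using dd_ge_kappa[OF wO] kappa_pos \<eta> by (intro powr_mono2) auto
    also have "\<dots> \<le> R powr \<eta>" using dd_hit_powr(1)[OF wO R] \<eta> by simp
    finally have yk: "y ^ ?k \<le> R powr \<eta>" .
    have "tt \<omega> ?k = dd \<omega> ?k powr t J * gn \<omega> ?k"
      unfolding tt_def gn_def g_def dd_powr[symmetric] prod.distrib[symmetric] by (simp flip: powr_add)
    also have "\<dots> \<le> R powr t J * (C * R powr \<eta>)"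
    proof (intro mult_mono)
      show "dd \<omega> ?k powr t J \<le> R powr t J" by (rule dd_hit_powr(1)[OF wO R tJ])
      show "gn \<omega> ?k \<le> C * R powr \<eta>" using gG[OF w, of ?k] yk C by (meson mult_left_mono less_imp_le order_trans)
      show "0 \<le> gn \<omega> ?k" unfolding gn_def using g(1)[OF Omega_D[OF wO]] by (intro prod_nonneg) (simp add: less_imp_le)
    qed auto
    finally have "m0 (sq R \<omega>) \<le> R powr s1 * (R powr t J * (C * R powr \<eta>))"
      unfolding m0_cell[OF wO kR_le_lR[OF wO R(1)]]
      using cc_hit_powr(1)[OF wO R s1_nonneg] tt_pos[OF wO] by (intro mult_mono) (auto simp: less_imp_le)
    then show ?thesis by (simp add: powr_add mult_ac)
  qed
  have "s1 + t J + \<eta> \<le> hausdorff_dim F"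
    by (rule le_hausdorff_dim, rule mass_distribution[OF probs_p0 G mG C mass])
  then show ?thesis using \<eta> by simp
qed

text \<open>\<open>sum p0 I = 1\<close> is the equation of \<open>\<beta>\<close> with
  \<open>t q\<close> in place of \<open>\<beta>\<close>. Raising every \<open>t q\<close> to the
  maximum brings the sum below 1, so \<open>\<beta>\<close> is less than the maximum.\<close>

lemma box_dim_less_assouad_dim:
  assumes a: "a \<in> I" "height a < base a" and J: "J \<in> I" "\<And>q. q \<in> I \<Longrightarrow> t q \<le> t J" and q0: "q0 \<in> I" "t q0 < t J"
  shows "s1 + \<beta> < assouad_dim F"
proof -
  have "\<beta> < t J"
  proof (rule ccontr)
    assume *: "\<not> \<beta> < t J"
    have "(\<Sum>q\<in>I. base q powr s1 * height q powr \<beta>) \<le> (\<Sum>q\<in>I. base q powr s1 * height q powr t J)"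
      using * height_pos height_less by (intro sum_mono mult_left_mono powr_mono') (auto simp: less_imp_le)
    also have "\<dots> < (\<Sum>q\<in>I. base q powr s1 * height q powr t q)"
    proof (rule sum_strict_mono_ex1[OF fin])
      show "\<forall>q\<in>I. base q powr s1 * height q powr t J \<le> base q powr s1 * height q powr t q"
        using J(2) height_pos height_less by (intro ballI mult_left_mono powr_mono') (auto simp: less_imp_le)
      have "base q0 powr s1 * height q0 powr t J < base q0 powr s1 * height q0 powr t q0"
        using q0 height_pos[OF q0(1)] height_less[OF q0(1)] base_pos[OF q0(1)]
        by (intro mult_strict_left_mono powr_less_mono') auto
      then show "\<exists>q\<in>I. base q powr s1 * height q powr t J < base q powr s1 * height q powr t q" using q0(1) by blast
    qed
    also have "\<dots> = 1" using is_prob_p0 by (simp add: is_prob_def p0_def)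
    finally show False using beta_sum by simp
  qed
  then show ?thesis using le_assouad_dim_fibre[OF a J(1)] by simp
qed

end

section \<open>Hausdorff dimension below box dimension\<close>

lemma sqrt_le_mean: "0 \<le> x \<Longrightarrow> sqrt x \<le> (1 + x) / 2" "0 \<le> x \<Longrightarrow> x \<noteq> 1 \<Longrightarrow> sqrt x < (1 + x) / 2"
proof -
  assume x: "0 \<le> x"
  then have e: "(sqrt x - 1)\<^sup>2 = x + 1 - 2 * sqrt x" by (simp add: power2_diff)
  show "sqrt x \<le> (1 + x) / 2" using zero_le_power2[of "sqrt x - 1"] unfolding e by simp
  assume "x \<noteq> 1"
  then have "sqrt x - 1 \<noteq> 0" by simp
  then have "0 < (sqrt x - 1)\<^sup>2" by (rule zero_less_power2[THEN iffD2])
  then show "sqrt x < (1 + x) / 2" unfolding e by simp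
qed

context carpet_exponents
begin

text \<open>Approximate squares with a fixed number \<open>k\<close> of individual letters, and
  therefore of varying size. A fixed \<open>k\<close> lets the weights change at indices that do not
  depend on the code.\<close>

abbreviation lev :: "nat \<Rightarrow> (nat \<Rightarrow> rect) \<Rightarrow> (nat \<Rightarrow> rect) set" where
  "lev k \<omega> \<equiv> cell k (lR (dd \<omega> k) \<omega>) \<omega>"

abbreviation levels :: "nat \<Rightarrow> (nat \<Rightarrow> rect) set set" where
  "levels k \<equiv> cells (\<lambda>_. k) (\<lambda>\<omega>. lR (dd \<omega> k) \<omega>)"

lemma diameter_lev:
  assumes w: "\<omega> \<in> \<Omega>"
  shows "bounded (pt ` lev k \<omega>)" "diameter (pt ` lev k \<omega>) \<le> 4 * dd \<omega> k"
proof -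
  have d: "dist (pt \<omega>) (pt \<omega>') \<le> 2 * dd \<omega> k" if "\<omega>' \<in> lev k \<omega>" for \<omega>'
    using dist_pt_cell[OF w that] cc_hit_le[OF w dd_pos[OF w], of k] by simp
  then show "bounded (pt ` lev k \<omega>)" unfolding bounded_def by blast
  show "diameter (pt ` lev k \<omega>) \<le> 4 * dd \<omega> k"
  proof (rule diameter_le)
    show "pt ` lev k \<omega> \<noteq> {} \<or> 0 \<le> 4 * dd \<omega> k" using dd_pos[OF w, of k] by simp
    fix x y assume "x \<in> pt ` lev k \<omega>" "y \<in> pt ` lev k \<omega>"
    then have "dist (pt \<omega>) x \<le> 2 * dd \<omega> k" "dist (pt \<omega>) y \<le> 2 * dd \<omega> k" using d by auto
    then show "norm (x - y) \<le> 4 * dd \<omega> k"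
      using dist_triangle2[of x y "pt \<omega>"] by (simp add: dist_commute flip: dist_norm)
  qed
qed

text \<open>The masses of the cells sum to at most 1, so a lower mass bound for each cell bounds the
  covering sum; a large \<open>c\<close> makes it small.\<close>

lemma sum_diameter_levels:
  assumes W: "probs W" and s: "0 < s" and c: "0 < c" and C: "\<C> \<subseteq> levels k"
    and mass: "\<And>\<omega>. \<omega> \<in> \<Omega> \<Longrightarrow> lev k \<omega> \<in> \<C> \<Longrightarrow> c * dd \<omega> k powr s \<le> measure (\<mu> W) (lev k \<omega>)"
  shows "(\<Sum>Q\<in>\<C>. diameter (pt ` Q) powr s) \<le> 4 powr s / c"
proof -
  have "(\<Sum>Q\<in>\<C>. diameter (pt ` Q) powr s) \<le> (\<Sum>Q\<in>\<C>. (4 powr s / c) * measure (\<mu> W) Q)"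
  proof (rule sum_mono)
    fix Q assume Q: "Q \<in> \<C>"
    then obtain \<omega> where w: "\<omega> \<in> \<Omega>" "Q = lev k \<omega>" using C by (auto simp: cells_def)
    have "diameter (pt ` Q) powr s \<le> (4 * dd \<omega> k) powr s"
      unfolding w(2) using diameter_lev[OF w(1)] diameter_ge_0 s by (intro powr_mono2) auto
    also have "\<dots> = 4 powr s / c * (c * dd \<omega> k powr s)" using dd_pos[OF w(1)] c by (simp add: powr_mult)
    also have "\<dots> \<le> 4 powr s / c * measure (\<mu> W) Q"
      using mass[OF w(1)] Q c unfolding w(2) by (intro mult_left_mono) auto
    finally show "diameter (pt ` Q) powr s \<le> 4 powr s / c * measure (\<mu> W) Q" .
  qed
  also have "\<dots> = (4 powr s / c) * (\<Sum>Q\<in>\<C>. measure (\<mu> W) Q)" by (simp add: sum_distrib_left)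
  also have "\<dots> \<le> (4 powr s / c) * 1"
    using sum_cells_le_1[OF W stopping_level C] c by (intro mult_left_mono) auto
  finally show ?thesis by simp
qed

text \<open>The mass of \<open>lev k \<omega>\<close> when the weights are \<open>p1\<close> before
  \<open>k\<close> and \<open>p0\<close> from \<open>k\<close> on. These weights change with
  \<open>k\<close>; the values serve as a reference for the weights used below.\<close>

definition lbase :: "nat \<Rightarrow> (nat \<Rightarrow> rect) \<Rightarrow> real" where
  "lbase k \<omega> = (\<Prod>m<k. p1 (\<omega> m)) * (\<Prod>m=k..<lR (dd \<omega> k) \<omega>. colsum p0 (\<omega> m))"

lemma lev_le: "\<omega> \<in> \<Omega> \<Longrightarrow> k \<le> lR (dd \<omega> k) \<omega>"
  using stopping_le[OF stopping_level] by blast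

lemma dd_le_1: "\<omega> \<in> \<Omega> \<Longrightarrow> dd \<omega> k \<le> 1"
  using dd_antimono[of \<omega> 0 k] by simp

lemma lbase_ge:
  assumes w: "\<omega> \<in> \<Omega>"
  shows "\<kappa> powr s1 * dd \<omega> k powr (s1 + \<beta>) \<le> lbase k \<omega>"
proof -
  let ?l = "lR (dd \<omega> k) \<omega>"
  have "(\<Prod>m=k..<?l. colsum p0 (\<omega> m)) = (\<Prod>m=k..<?l. base (\<omega> m) powr s1)"
    using w by (intro prod.cong) (auto simp: Omega_iff colsum_p0)
  then have "lbase k \<omega> = cc \<omega> ?l powr s1 * dd \<omega> k powr \<beta>"
    unfolding lbase_def p1_def prod.distrib dd_powr
    using prod_base_powr_split[OF w lev_le[OF w]] by (simp add: mult_ac)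
  moreover have "(\<kappa> * dd \<omega> k) powr s1 \<le> cc \<omega> ?l powr s1"
    by (rule cc_hit_powr(2)[OF w dd_pos[OF w] dd_le_1[OF w] s1_nonneg])
  ultimately show ?thesis
    using kappa_pos dd_pos[OF w, of k] by (simp add: powr_mult powr_add mult_right_mono flip: mult.assoc)
qed

lemma lbase_pos: "\<omega> \<in> \<Omega> \<Longrightarrow> 0 < lbase k \<omega>"
  using lbase_ge[of \<omega> k] kappa_pos dd_pos[of \<omega> k] by (smt (verit) mult_pos_pos powr_gt_zero)

lemma colsum_cong: "col q = col q' \<Longrightarrow> colsum u q = colsum u q'"
  by (simp add: colsum_def)

lemma colsum_pos: "(\<And>q. q \<in> I \<Longrightarrow> 0 < u q) \<Longrightarrow> q \<in> I \<Longrightarrow> 0 < colsum u q"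
  unfolding colsum_def using fin by (intro sum_pos) auto

lemma colsum_mult_column:
  assumes "\<And>q'. q' \<in> I \<Longrightarrow> col q' = col q \<Longrightarrow> v q' = v q"
  shows "colsum (\<lambda>q. u q * v q) q = colsum u q * v q"
  unfolding colsum_def sum_distrib_right using assms by (intro sum.cong) auto

text \<open>If \<open>p0\<close> and \<open>p1\<close> gave all columns the same masses,
  \<open>\<beta>\<close> would solve the equation of every column and so equal every
  \<open>t q\<close>.\<close>

lemma column_masses_differ:
  assumes "q1 \<in> I" "q2 \<in> I" "t q1 \<noteq> t q2"
  shows "\<exists>q\<in>I. colsum p0 q \<noteq> colsum p1 q"
proof (rule ccontr)
  assume eq: "\<not> ?thesis"
  have "t q = \<beta>" if q: "q \<in> I" for q
  proof -
    let ?J = "{q'\<in>I. col q' = col q}"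
    have "colsum p1 q = (\<Sum>q'\<in>?J. base q powr s1 * height q' powr \<beta>)"
      unfolding colsum_def p1_def by (intro sum.cong) (auto simp: col_def)
    also have "\<dots> = base q powr s1 * (\<Sum>q'\<in>?J. height q' powr \<beta>)" by (simp add: sum_distrib_left)
    finally have "base q powr s1 * (\<Sum>q'\<in>?J. height q' powr \<beta>) = base q powr s1 * 1"
      using eq q colsum_p0[OF q] by auto
    then have one: "(\<Sum>q'\<in>?J. height q' powr \<beta>) = 1" using base_pos[OF q] by simp
    note mono = weighted_powr_strict_antimono[of ?J height "\<lambda>_. 1"]
    have "?J \<noteq> {}" "finite ?J" using q fin by auto
    moreover have "\<And>q'. q' \<in> ?J \<Longrightarrow> 0 < height q' \<and> height q' < 1" using height_pos height_less by auto
    ultimately have "\<not> t q < \<beta>" "\<not> \<beta> < t q" using mono[of "t q" \<beta>] mono[of \<beta> "t q"] one t_sum[OF q] by auto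
    then show ?thesis by simp
  qed
  with assms show False by simp
qed

text \<open>
  An approximate square sees individual rectangles up to index \<open>k\<close> and only columns from \<open>k\<close>
  to \<open>l\<close>. The weights for which all squares of one size have comparable mass give the columns the
  masses \<open>colsum p1\<close> before \<open>k\<close> and \<open>colsum p0\<close> after it. Replacing both by their normalised
  geometric mean on a block \<open>{k..<k'}\<close> gains a factor that is exponential in the length of the
  block, either for the level \<open>k\<close> square or for the level \<open>k'\<close> square. The remaining points, for
  which \<open>l < k'\<close>, have few indices with height smaller than base and are covered efficiently by
  weights tilted towards squares.
\<close>

lemma hausdorff_dim_less_box_dim:
  assumes a: "a \<in> I" "height a < base a" and qq: "q1 \<in> I" "q2 \<in> I" "t q1 \<noteq> t q2"
    and b0: "0 < s1 + \<beta>"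
  shows "hausdorff_dim F < s1 + \<beta>"
proof -
  \<comment> \<open>\<open>p1 q * rho q\<close> sums over a column to the geometric mean of its
    masses under \<open>p0\<close> and \<open>p1\<close>. The total \<open>Z\<close> is below 1
    because these masses do not all coincide.\<close>
  define rho where "rho q = sqrt (colsum p0 q / colsum p1 q)" for q
  have P: "0 < colsum p0 q" "0 < colsum p1 q" if "q \<in> I" for q
    using colsum_pos[OF p0_pos that] colsum_pos[OF p1_pos that] by auto
  have rho: "0 < rho q" "rho q * rho q = colsum p0 q / colsum p1 q" if "q \<in> I" for q
    using P[OF that] by (auto simp: rho_def)
  define Z where "Z = (\<Sum>q\<in>I. p1 q * rho q)"
  have Z0: "0 < Z" unfolding Z_def using fin ne p1_pos rho by (intro sum_pos) auto
  have ratio1: "(\<Sum>q\<in>I. p1 q * (colsum p0 q / colsum p1 q)) = 1"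
  proof -
    have "(\<Sum>q\<in>I. p1 q * (colsum p0 q / colsum p1 q)) = sum p0 I"
      unfolding sum_columns[of p0] sum_columns[of "\<lambda>q. p1 q * (colsum p0 q / colsum p1 q)"]
    proof (rule sum.cong)
      fix j assume "j \<in> col ` I"
      then obtain q where q: "q \<in> I" "j = col q" by blast
      have "colsum (\<lambda>q. p1 q * (colsum p0 q / colsum p1 q)) q = colsum p1 q * (colsum p0 q / colsum p1 q)"
        by (intro colsum_mult_column) (metis colsum_cong)
      also have "\<dots> = colsum p0 q" using P[OF q(1)] by simp
      finally show "(\<Sum>q\<in>{q\<in>I. col q = j}. p1 q * (colsum p0 q / colsum p1 q)) = sum p0 {q\<in>I. col q = j}"
        by (simp add: colsum_def q(2))
    qed simp
    then show ?thesis using is_prob_p0 by (simp add: is_prob_def)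
  qed
  have Z1: "Z < 1"
  proof -
    have "Z < (\<Sum>q\<in>I. p1 q * ((1 + colsum p0 q / colsum p1 q) / 2))"
      unfolding Z_def
    proof (rule sum_strict_mono_ex1[OF fin])
      show "\<forall>q\<in>I. p1 q * rho q \<le> p1 q * ((1 + colsum p0 q / colsum p1 q) / 2)"
      proof
        fix q assume q: "q \<in> I"
        have "0 \<le> colsum p0 q / colsum p1 q" using P[OF q] by simp
        then show "p1 q * rho q \<le> p1 q * ((1 + colsum p0 q / colsum p1 q) / 2)"
          unfolding rho_def using p1_pos[OF q] by (intro mult_left_mono sqrt_le_mean) auto
      qed
      obtain q where q: "q \<in> I" "colsum p0 q \<noteq> colsum p1 q" using column_masses_differ[OF qq] by blast
      have "0 \<le> colsum p0 q / colsum p1 q" "colsum p0 q / colsum p1 q \<noteq> 1" using P[OF q(1)] q(2) by auto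
      then have "p1 q * rho q < p1 q * ((1 + colsum p0 q / colsum p1 q) / 2)"
        unfolding rho_def using p1_pos[OF q(1)] by (intro mult_strict_left_mono sqrt_le_mean) auto
      then show "\<exists>q\<in>I. p1 q * rho q < p1 q * ((1 + colsum p0 q / colsum p1 q) / 2)" using q(1) by blast
    qed
    also have "\<dots> = (sum p1 I + (\<Sum>q\<in>I. p1 q * (colsum p0 q / colsum p1 q))) / 2"
      unfolding sum.distrib[symmetric] sum_divide_distrib by (intro sum.cong) (auto simp: algebra_simps)
    also have "\<dots> = 1" using ratio1 is_prob_p1 by (simp add: is_prob_def)
    finally show ?thesis .
  qed
  define p2 where "p2 q = p1 q * (rho q / Z)" for q
  have p2: "is_prob p2"
    using Z0 p1_pos rho by (auto simp: is_prob_def p2_def Z_def less_imp_le simp flip: sum_divide_distrib)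
  have col2: "colsum p2 q = colsum p0 q / (rho q * Z)" if q: "q \<in> I" for q
  proof -
    have "colsum p2 q = colsum p1 q * (rho q / Z)"
      unfolding p2_def rho_def by (intro colsum_mult_column) (metis colsum_cong)
    moreover have "colsum p0 q = colsum p1 q * (rho q * rho q)" using P[OF q] rho(2)[OF q] by simp
    ultimately show ?thesis using rho(1)[OF q] by simp
  qed
  \<comment> \<open>The aspect ratio. Its \<open>p1\<close>-mean \<open>Y\<close> is below 1 because
    of the rectangle \<open>a\<close>.\<close>
  define e where "e q = height q / base q" for q
  have e: "0 < e q" "e q \<le> 1" if "q \<in> I" for q
    using height_pos[OF that] base_pos[OF that] height_le[OF that] by (auto simp: e_def)
  define Y where "Y = (\<Sum>q\<in>I. p1 q * e q)"
  have Y0: "0 < Y" unfolding Y_def using fin ne p1_pos e by (intro sum_pos) auto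
  have "Y < (\<Sum>q\<in>I. p1 q * 1)" unfolding Y_def
  proof (rule sum_strict_mono_ex1[OF fin])
    show "\<forall>q\<in>I. p1 q * e q \<le> p1 q * 1" using e p1_pos by (intro ballI mult_left_mono) (auto simp: less_imp_le)
    have "e a < 1" using a height_pos base_pos by (auto simp: e_def)
    then show "\<exists>q\<in>I. p1 q * e q < p1 q * 1" using a(1) p1_pos by (intro bexI[of _ a] mult_strict_left_mono) auto
  qed
  then have Y1: "Y < 1" using is_prob_p1 by (simp add: is_prob_def)
  define p3 where "p3 q = p1 q * (e q / Y)" for q
  have p3: "is_prob p3"
    using Y0 p1_pos e by (auto simp: is_prob_def p3_def Y_def less_imp_le simp flip: sum_divide_distrib)
  define y where "y = sqrt Y"
  have y: "0 < y" "y < 1" "y * y = Y" using Y0 Y1 by (auto simp: y_def)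
  \<comment> \<open>For \<open>k = N * i\<close> this gives \<open>y ^ k \<le> \<kappa> ^ i\<close>,
    and \<open>\<kappa> ^ i\<close> bounds from below the factor that a block of \<open>i\<close>
    letters contributes to the base.\<close>
  obtain N where N: "y ^ N < \<kappa>" using real_arch_pow_inv[OF kappa_pos y(2)] by blast
  have N0: "1 \<le> N"
  proof (rule ccontr)
    assume "\<not> 1 \<le> N"
    then have "N = 0" by simp
    with N kappa_less_1 show False by simp
  qed
  define \<zeta> where "\<zeta> = max (y ^ N) Z"
  have \<zeta>: "0 < \<zeta>" "\<zeta> < 1" "y ^ N \<le> \<zeta>" "Z \<le> \<zeta>" using y Z0 Z1 N0 by (auto simp: \<zeta>_def power_less_one_iff)
  \<comment> \<open>Of the gain \<open>\<zeta> ^ i = \<eta> ^ i * \<eta> ^ i\<close>, one factor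
    pays for lowering the exponent by \<open>\<epsilon>\<close>, the other drives the covering sums
    to 0.\<close>
  define \<eta> where "\<eta> = sqrt \<zeta>"
  have \<eta>: "0 < \<eta>" "\<eta> < 1" "\<eta> * \<eta> = \<zeta>" using \<zeta> by (auto simp: \<eta>_def)
  define b where "b = s1 + \<beta>"
  \<comment> \<open>The sizes that occur are at least \<open>\<kappa> ^ (Suc N * i)\<close>, and the
    first bound makes the power \<open>\<epsilon>\<close> of this at least
    \<open>\<eta> ^ i\<close>. The bound \<open>b / 2\<close> keeps \<open>s\<close>
    positive.\<close>
  define \<epsilon> where "\<epsilon> = min (ln \<eta> / (real (Suc N) * ln \<kappa>)) (b / 2)"
  have lk: "ln \<kappa> < 0" "ln \<eta> < 0" using kappa_pos kappa_less_1 \<eta> by auto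
  have \<epsilon>: "0 < \<epsilon>" using lk b0 by (auto simp: \<epsilon>_def b_def intro!: divide_neg_neg mult_pos_neg)
  define s where "s = b - \<epsilon>"
  have "\<epsilon> \<le> b / 2" unfolding \<epsilon>_def by (rule min.cobounded2)
  then have s: "0 < s" "s < b" using \<epsilon> b0 by (auto simp: s_def b_def)
  have kap: "\<eta> ^ i \<le> (\<kappa> ^ (Suc N * i)) powr \<epsilon>" for i
  proof -
    have "\<epsilon> * real (Suc N) * ln \<kappa> \<ge> ln \<eta>"
    proof -
      have "\<epsilon> \<le> ln \<eta> / (real (Suc N) * ln \<kappa>)" by (simp add: \<epsilon>_def)
      moreover have "real (Suc N) * ln \<kappa> < 0" using lk by (intro mult_pos_neg) auto
      ultimately show ?thesis by (simp add: neg_le_divide_eq mult_ac)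
    qed
    then have "\<eta> \<le> \<kappa> powr (\<epsilon> * real (Suc N))"
      using \<eta>(1) kappa_pos by (subst ln_le_cancel_iff[symmetric]) (auto simp: ln_powr)
    then have "\<eta> ^ i \<le> (\<kappa> powr (\<epsilon> * real (Suc N))) ^ i" using \<eta> by (intro power_mono) auto
    also have "\<dots> = (\<kappa> ^ (Suc N * i)) powr \<epsilon>"
      using kappa_pos by (simp add: powr_powr algebra_simps flip: powr_realpow)
    finally show ?thesis .
  qed
  define c where "c i = \<kappa> powr s1 / \<eta> ^ i" for i :: nat
  have c: "0 < c i" for i using kappa_pos \<eta> by (simp add: c_def)
  \<comment> \<open>Turns a gain \<open>\<zeta> ^ i\<close> over the reference mass into the
    hypothesis of \<open>sum_diameter_levels\<close>, with a constant \<open>c i\<close> that tends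
    to infinity.\<close>
  have bridge: "c i * dd \<omega> k powr s \<le> X"
    if w: "\<omega> \<in> \<Omega>" and k: "k \<le> Suc N * i" and X: "lbase k \<omega> \<le> X * \<zeta> ^ i" for \<omega> k i X
  proof -
    have "\<kappa> ^ (Suc N * i) \<le> \<kappa> ^ k" using k kappa_pos kappa_less_1 by (intro power_decreasing) auto
    also have "\<dots> \<le> dd \<omega> k" by (rule dd_ge_kappa[OF w])
    finally have "(\<kappa> ^ (Suc N * i)) powr \<epsilon> \<le> dd \<omega> k powr \<epsilon>" using \<epsilon> kappa_pos by (intro powr_mono2) auto
    then have "\<eta> ^ i \<le> dd \<omega> k powr \<epsilon>" using kap[of i] by simp
    then have "\<kappa> powr s1 * (dd \<omega> k powr s * \<eta> ^ i) \<le> \<kappa> powr s1 * (dd \<omega> k powr s * dd \<omega> k powr \<epsilon>)"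
      by (intro mult_left_mono) auto
    also have "\<dots> = \<kappa> powr s1 * dd \<omega> k powr b" by (simp add: s_def flip: powr_add)
    also have "\<dots> \<le> X * (\<eta> ^ i * \<eta> ^ i)"
      using lbase_ge[OF w, of k] X by (simp add: b_def \<eta>(3) flip: power_mult_distrib)
    finally have "(\<kappa> powr s1 * dd \<omega> k powr s) * \<eta> ^ i \<le> (X * \<eta> ^ i) * \<eta> ^ i" by (simp add: mult_ac)
    then have "\<kappa> powr s1 * dd \<omega> k powr s \<le> X * \<eta> ^ i" by (rule mult_right_le_imp_le) (use \<eta> in simp)
    then show ?thesis using \<eta> by (simp add: c_def field_simps)
  qed
  define W where "W i m = (if m < N * i then p1 else if m < Suc N * i then p2 else p0)" for i m :: nat
  define W3 where "W3 i m = (if m < N * i then p3 else p0)" for i m :: nat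
  have W: "probs (W i)" and W3: "probs (W3 i)" for i
    using is_prob_p0 is_prob_p1 p2 p3 by (auto simp: probs_def W_def W3_def)
  define \<C>1 where "\<C>1 i = {Q \<in> levels (N * i). \<forall>\<omega>\<in>Q. c i * dd \<omega> (N * i) powr s \<le> measure (\<mu> (W i)) Q}" for i
  define \<C>2 where "\<C>2 i = {Q \<in> levels (Suc N * i). \<forall>\<omega>\<in>Q. c i * dd \<omega> (Suc N * i) powr s \<le> measure (\<mu> (W i)) Q}" for i
  define \<C>3 where "\<C>3 i = {Q \<in> levels (N * i). \<forall>\<omega>\<in>Q. c i * dd \<omega> (N * i) powr s \<le> measure (\<mu> (W3 i)) Q}" for i
  have memI: "lev k \<omega> \<in> {Q \<in> levels k. \<forall>\<omega>\<in>Q. c i * dd \<omega> k powr s \<le> measure M Q}"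
    if w: "\<omega> \<in> \<Omega>" and le: "c i * dd \<omega> k powr s \<le> measure M (lev k \<omega>)" for k i M \<omega>
  proof -
    have "dd \<omega>' k = dd \<omega> k" if "\<omega>' \<in> lev k \<omega>" for \<omega>' by (rule cell_dd[OF that order.refl])
    then show ?thesis using w le by (simp add: cells_def)
  qed
  have cover: "\<exists>Q\<in>\<C>1 i \<union> \<C>2 i \<union> \<C>3 i. \<omega> \<in> Q" if w: "\<omega> \<in> \<Omega>" for \<omega> i
  proof -
    define k k' l l' where "k = N * i" and "k' = Suc N * i"
      and "l = lR (dd \<omega> k) \<omega>" and "l' = lR (dd \<omega> k') \<omega>"
    have kk': "k \<le> k'" "k' - k = i" by (auto simp: k_def k'_def)
    have kl: "k \<le> l" "k' \<le> l'" using lev_le[OF w] by (auto simp: l_def l'_def)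
    note wI = Omega_D[OF w]
    show ?thesis
    proof (cases "l < k'")
      case True
      \<comment> \<open>Fewer than \<open>i\<close> letters bring the base down from
        \<open>cc \<omega> k\<close> to \<open>dd \<omega> k\<close>, so height over base after
        \<open>k\<close> letters is at least \<open>\<kappa> ^ i\<close>.\<close>
      have "cc \<omega> k * \<kappa> ^ i \<le> cc \<omega> k * \<kappa> ^ (l - k)"
        using True kk' cc_pos[OF w, of k] kappa_pos kappa_less_1 by (intro mult_left_mono power_decreasing) auto
      also have "\<dots> \<le> cc \<omega> l"
        unfolding scale_split[OF kl(1)] using cc_pos[OF w, of k] kappa_pos prod_mono[of "{k..<l}" "\<lambda>_. \<kappa>" "\<lambda>m. base (\<omega> m)"]
          kappa_le_base[OF wI] by (intro mult_left_mono) auto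
      also have "\<dots> \<le> dd \<omega> k" unfolding l_def by (rule cc_hit_le[OF w dd_pos[OF w]])
      finally have "\<kappa> ^ i \<le> dd \<omega> k / cc \<omega> k" using cc_pos[OF w, of k] by (simp add: field_simps)
      moreover have "y ^ k \<le> \<kappa> ^ i" unfolding k_def power_mult using N y by (intro power_mono) auto
      moreover have "(\<Prod>m<k. e (\<omega> m)) = dd \<omega> k / cc \<omega> k" by (simp add: e_def prod_dividef scale_def)
      ultimately have ye: "y ^ k \<le> (\<Prod>m<k. e (\<omega> m))" by simp
      define X where "X = measure (\<mu> (W3 i)) (lev k \<omega>)"
      have "X = (\<Prod>m<k. p3 (\<omega> m)) * (\<Prod>m=k..<l. colsum p0 (\<omega> m))"
        unfolding X_def cell_mu(2)[OF W3 w lev_le[OF w]] unfolding l_def[symmetric]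
        by (intro arg_cong2[where f = "(*)"] prod.cong) (auto simp: W3_def k_def)
      also have "(\<Prod>m<k. p3 (\<omega> m)) = (\<Prod>m<k. p1 (\<omega> m)) * ((\<Prod>m<k. e (\<omega> m)) / (y ^ k * y ^ k))"
        by (simp add: p3_def prod.distrib prod_dividef y(3) flip: power_mult_distrib)
      finally have "X * (y ^ k * y ^ k) = lbase k \<omega> * (\<Prod>m<k. e (\<omega> m))"
        using y by (simp add: lbase_def l_def field_simps)
      also have "\<dots> \<ge> lbase k \<omega> * y ^ k" using ye lbase_pos[OF w] by (intro mult_left_mono) (auto simp: less_imp_le)
      finally have "lbase k \<omega> * y ^ k \<le> (X * y ^ k) * y ^ k" by (simp add: mult_ac)
      then have "lbase k \<omega> \<le> X * y ^ k" by (rule mult_right_le_imp_le) (use y in simp)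
      also have "\<dots> \<le> X * \<zeta> ^ i"
        unfolding k_def power_mult using \<zeta>(3) y by (intro mult_left_mono power_mono) (auto simp: X_def)
      finally have "lev k \<omega> \<in> \<C>3 i"
        unfolding \<C>3_def k_def[symmetric] X_def using kk' by (intro memI w bridge) (auto simp: k_def)
      then show ?thesis using cell_self[OF w] by blast
    next
      case False
      \<comment> \<open>Relative to the reference masses, \<open>p2\<close> on the block multiplies
        the level \<open>k\<close> mass by \<open>1 / (S * Z ^ i)\<close> and the level
        \<open>k'\<close> mass by \<open>S / Z ^ i\<close>. On either side of \<open>S = 1\<close>,
        one of the two gains at least \<open>1 / Z ^ i\<close>.\<close>
      define S where "S = (\<Prod>m=k..<k'. rho (\<omega> m))"
      have S0: "0 < S" unfolding S_def using rho(1)[OF wI] by (intro prod_pos) auto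
      define X where "X = measure (\<mu> (W i)) (lev k \<omega>)"
      define X' where "X' = measure (\<mu> (W i)) (lev k' \<omega>)"
      have "X = (\<Prod>m<k. p1 (\<omega> m)) * (\<Prod>m=k..<l. colsum (W i m) (\<omega> m))"
        unfolding X_def cell_mu(2)[OF W w lev_le[OF w]] unfolding l_def[symmetric]
        by (intro arg_cong2[where f = "(*)"] prod.cong) (auto simp: W_def k_def)
      also have "(\<Prod>m=k..<l. colsum (W i m) (\<omega> m)) = (\<Prod>m=k..<k'. colsum p2 (\<omega> m)) * (\<Prod>m=k'..<l. colsum p0 (\<omega> m))"
        using False kk' by (subst prod.atLeastLessThan_concat[of k k' l, symmetric])
          (auto intro!: arg_cong2[where f = "(*)"] prod.cong simp: W_def k_def k'_def)
      also have "(\<Prod>m=k..<k'. colsum p2 (\<omega> m)) = (\<Prod>m=k..<k'. colsum p0 (\<omega> m)) / (S * Z ^ i)"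
        using col2[OF wI] by (simp add: prod_dividef prod.distrib S_def kk'(2))
      finally have "X * (S * Z ^ i) = (\<Prod>m<k. p1 (\<omega> m)) * ((\<Prod>m=k..<k'. colsum p0 (\<omega> m)) * (\<Prod>m=k'..<l. colsum p0 (\<omega> m)))"
        using S0 Z0 by simp
      also have "(\<Prod>m=k..<k'. colsum p0 (\<omega> m)) * (\<Prod>m=k'..<l. colsum p0 (\<omega> m)) = (\<Prod>m=k..<l. colsum p0 (\<omega> m))"
        using False kk' by (intro prod.atLeastLessThan_concat) auto
      finally have X: "X * (S * Z ^ i) = lbase k \<omega>" by (simp add: lbase_def l_def)
      have "X' = (\<Prod>m<k'. W i m (\<omega> m)) * (\<Prod>m=k'..<l'. colsum p0 (\<omega> m))"
        unfolding X'_def cell_mu(2)[OF W w lev_le[OF w]] unfolding l'_def[symmetric]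
        by (intro arg_cong2[where f = "(*)"] prod.cong) (auto simp: W_def k_def k'_def)
      also have "(\<Prod>m<k'. W i m (\<omega> m)) = (\<Prod>m<k. p1 (\<omega> m)) * (\<Prod>m=k..<k'. p2 (\<omega> m))"
        using scale_split[OF kk'(1), of "\<lambda>m. W i m (\<omega> m)"] unfolding scale_def
        by (auto intro!: arg_cong2[where f = "(*)"] prod.cong simp: W_def k_def k'_def)
      also have "(\<Prod>m=k..<k'. p2 (\<omega> m)) = (\<Prod>m=k..<k'. p1 (\<omega> m)) * (S / Z ^ i)"
        by (simp add: p2_def prod_dividef prod.distrib S_def kk'(2))
      finally have "X' * Z ^ i = S * (((\<Prod>m<k. p1 (\<omega> m)) * (\<Prod>m=k..<k'. p1 (\<omega> m))) * (\<Prod>m=k'..<l'. colsum p0 (\<omega> m)))"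
        using Z0 by simp
      also have "(\<Prod>m<k. p1 (\<omega> m)) * (\<Prod>m=k..<k'. p1 (\<omega> m)) = (\<Prod>m<k'. p1 (\<omega> m))"
        using scale_split[OF kk'(1), of "\<lambda>m. p1 (\<omega> m)"] by (simp add: scale_def)
      finally have X': "X' * Z ^ i = S * lbase k' \<omega>" by (simp add: lbase_def l'_def)
      have nn: "0 \<le> X" "0 \<le> X'" by (auto simp: X_def X'_def)
      have Zz: "Z ^ i \<le> \<zeta> ^ i" using Z0 \<zeta> by (intro power_mono) auto
      show ?thesis
      proof (cases "S \<le> 1")
        case True
        have "lbase k \<omega> = S * (X * Z ^ i)" using X by (simp add: mult_ac)
        also have "\<dots> \<le> 1 * (X * Z ^ i)" using True nn Z0 by (intro mult_right_mono) auto
        also have "\<dots> \<le> X * \<zeta> ^ i" using Zz nn by (simp add: mult_left_mono)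
        finally have "lev k \<omega> \<in> \<C>1 i"
          unfolding \<C>1_def k_def[symmetric] X_def using kk' by (intro memI w bridge) (auto simp: k_def)
        then show ?thesis using cell_self[OF w] by blast
      next
        case False
        have "1 * lbase k' \<omega> \<le> S * lbase k' \<omega>" using False lbase_pos[OF w, of k'] by (intro mult_right_mono) auto
        also have "\<dots> \<le> X' * \<zeta> ^ i" unfolding X'[symmetric] using Zz nn by (simp add: mult_left_mono)
        finally have "lev k' \<omega> \<in> \<C>2 i"
          unfolding \<C>2_def k'_def[symmetric] X'_def by (intro memI w bridge) (auto simp: k'_def)
        then show ?thesis using cell_self[OF w] by blast
      qed
    qed
  qed
  have "hausdorff_measure s F = 0"
  proof (rule hausdorff_measure_eq_0I)
    fix \<delta> :: real assume \<delta>: "0 < \<delta>"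
    define K where "K = 3 * (4 powr s / \<kappa> powr s1)"
    have K: "0 < K" using kappa_pos by (simp add: K_def)
    have "\<forall>\<^sub>F i in sequentially. \<eta> ^ i < \<delta> / K"
      using \<eta> \<delta> K by (intro order_tendstoD(2)[OF LIMSEQ_power_zero]) auto
    moreover have "\<forall>\<^sub>F i in sequentially. \<theta> ^ i < \<delta> / 4"
      using theta_pos theta_less_1 \<delta> by (intro order_tendstoD(2)[OF LIMSEQ_power_zero]) auto
    ultimately obtain i where i: "\<eta> ^ i < \<delta> / K" "\<theta> ^ i < \<delta> / 4"
      using eventually_happens[OF eventually_conj] by force
    let ?C = "\<C>1 i \<union> \<C>2 i \<union> \<C>3 i"
    have finC: "finite (\<C>1 i)" "finite (\<C>2 i)" "finite (\<C>3 i)"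
      using finite_cells[OF stopping_level] unfolding \<C>1_def \<C>2_def \<C>3_def by (auto intro: finite_subset)
    have Q: "bounded (pt ` Q) \<and> diameter (pt ` Q) \<le> \<delta>" if QC: "Q \<in> ?C" for Q
    proof -
      have "Q \<in> levels (N * i) \<or> Q \<in> levels (Suc N * i)"
        using QC unfolding \<C>1_def \<C>2_def \<C>3_def by blast
      moreover have "i \<le> N * i" "i \<le> Suc N * i" using N0 by auto
      ultimately obtain k where k: "Q \<in> levels k" "i \<le> k" by blast
      obtain \<omega> where w: "\<omega> \<in> \<Omega>" "Q = lev k \<omega>" using k(1) by (auto simp: cells_def)
      have "dd \<omega> k \<le> \<theta> ^ k" by (rule dd_le_theta[OF w(1)])
      also have "\<dots> \<le> \<theta> ^ i" using k(2) theta_pos theta_less_1 by (intro power_decreasing) auto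
      finally show ?thesis unfolding w(2) using diameter_lev[OF w(1), of k] i(2) by auto
    qed
    let ?f = "\<lambda>Q. diameter (pt ` Q) powr s"
    have "sum (\<lambda>U. diameter U powr s) ((`) pt ` ?C) \<le> sum ?f ?C"
      using sum_image_le[of ?C "\<lambda>U. diameter U powr s" "(`) pt"] finC by (simp add: o_def)
    also have "\<dots> \<le> sum ?f (\<C>1 i \<union> \<C>2 i) + sum ?f (\<C>3 i)"
      using sum.union_inter[of "\<C>1 i \<union> \<C>2 i" "\<C>3 i" ?f] finC sum_nonneg[of "(\<C>1 i \<union> \<C>2 i) \<inter> \<C>3 i" ?f] by simp
    also have "\<dots> \<le> sum ?f (\<C>1 i) + sum ?f (\<C>2 i) + sum ?f (\<C>3 i)"
      using sum.union_inter[of "\<C>1 i" "\<C>2 i" ?f] finC sum_nonneg[of "\<C>1 i \<inter> \<C>2 i" ?f] by simp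
    also have "\<dots> \<le> 4 powr s / c i + 4 powr s / c i + 4 powr s / c i"
    proof (intro add_mono)
      show "sum ?f (\<C>1 i) \<le> 4 powr s / c i"
        by (rule sum_diameter_levels[OF W s(1) c, where k = "N * i"]) (use cell_self in \<open>auto simp: \<C>1_def\<close>)
      show "sum ?f (\<C>2 i) \<le> 4 powr s / c i"
        by (rule sum_diameter_levels[OF W s(1) c, where k = "Suc N * i"]) (use cell_self in \<open>auto simp: \<C>2_def\<close>)
      show "sum ?f (\<C>3 i) \<le> 4 powr s / c i"
        by (rule sum_diameter_levels[OF W3 s(1) c, where k = "N * i"]) (use cell_self in \<open>auto simp: \<C>3_def\<close>)
    qed
    also have "\<dots> = K * \<eta> ^ i" by (simp add: K_def c_def)
    also have "\<dots> \<le> \<delta>" using i(1) K by (simp add: field_simps)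
    finally have "sum (\<lambda>U. diameter U powr s) ((`) pt ` ?C) \<le> \<delta>" .
    moreover have "F \<subseteq> \<Union>((`) pt ` ?C)"
    proof
      fix x assume "x \<in> F"
      then obtain \<omega> where w: "\<omega> \<in> \<Omega>" "pt \<omega> = x" using F_code by blast
      then show "x \<in> \<Union>((`) pt ` ?C)" using cover[OF w(1), of i] by blast
    qed
    ultimately show "\<exists>\<U>. finite \<U> \<and> F \<subseteq> \<Union>\<U> \<and> (\<forall>U\<in>\<U>. bounded U \<and> diameter U \<le> \<delta>) \<and> (\<Sum>U\<in>\<U>. diameter U powr s) \<le> \<delta>"
      using finC Q by (intro exI[of _ "(`) pt ` ?C"]) auto
  qed
  then have "hausdorff_dim F \<le> s" by (rule hausdorff_dim_le[OF s(1)])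
  then show ?thesis using s(2) by (simp add: b_def)
qed

end

section \<open>The two classes and the exchange of coordinates\<close>

context carpet_exponents
begin

lemma carpet_dichotomy:
  assumes a: "a \<in> I" "height a < base a"
  shows "(lower_dim F < hausdorff_dim F \<and> hausdorff_dim F < s1 + \<beta> \<and> s1 + \<beta> < assouad_dim F) \<or>
    (lower_dim F = hausdorff_dim F \<and> hausdorff_dim F = s1 + \<beta> \<and> s1 + \<beta> = assouad_dim F)"
proof (cases "\<exists>t0. \<forall>q\<in>I. t q = t0")
  case True
  then obtain t0 where "\<And>q. q \<in> I \<Longrightarrow> t q = t0" by blast
  then show ?thesis using uniform_case[of t0] by simp
next
  case False
  have "Min (t ` I) \<in> t ` I" "Max (t ` I) \<in> t ` I" using fin ne by auto
  then obtain J J' where JI: "J \<in> I" "t J = Min (t ` I)" "J' \<in> I" "t J' = Max (t ` I)" by force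
  then have J: "t J \<le> t q" "t q \<le> t J'" if "q \<in> I" for q using that fin by auto
  obtain q0 where q0: "q0 \<in> I" "t q0 \<noteq> t J" using False by blast
  then have less: "t J < t q0" "t J < t J'" using J[OF q0(1)] by auto
  have colne: "col J \<noteq> col q0" using t_col[OF JI(1) q0(1)] q0(2) by auto
  \<comment> \<open>With a single rectangle in each column every \<open>t\<close> would be 0,
    whereas \<open>t q0 > t J \<ge> 0\<close>.\<close>
  have "\<exists>q1 q2. q1 \<in> I \<and> q2 \<in> I \<and> col q1 = col q2 \<and> q1 \<noteq> q2"
  proof (rule ccontr)
    assume *: "\<not> ?thesis"
    have "t q0 = 0"
    proof -
      have "{q\<in>I. col q = col q0} = {q0}" using * q0(1) by blast
      then have "height q0 powr t q0 = 1" using t_sum[OF q0(1)] by simp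
      then show ?thesis using height_pos[OF q0(1)] height_less[OF q0(1)]
        by (simp add: powr_eq_one_iff_gen)
    qed
    then show False using less(1) t_nonneg[OF JI(1)] by simp
  qed
  then obtain q1 q2 where q: "q1 \<in> I" "q2 \<in> I" "col q1 = col q2" "q1 \<noteq> q2" by blast
  have "lower_dim F \<le> s1 + t J"
    by (rule lower_dim_le_fibre[OF a JI(1) q JI(1) q0(1) colne])
  moreover have "s1 + t J < hausdorff_dim F"
    by (rule less_hausdorff_dim[OF JI(1) J(1) q0(1) less(1)])
  moreover have "hausdorff_dim F < s1 + \<beta>"
  proof (rule hausdorff_dim_less_box_dim[OF a JI(1) q0(1)])
    show "0 < s1 + \<beta>"
      using hausdorff_dim_le_box_dim \<open>s1 + t J < hausdorff_dim F\<close> s1_nonneg t_nonneg[OF JI(1)] by simp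
  qed (use less in simp)
  moreover have "s1 + \<beta> < assouad_dim F"
    by (rule box_dim_less_assouad_dim[OF a JI(3) J(2) JI(1) less(2)])
  ultimately show ?thesis by simp
qed

end

definition dims_dichotomy :: "(real \<times> real) set \<Rightarrow> bool" where
  "dims_dichotomy F \<longleftrightarrow> box_dim_exists F \<and>
    ((lower_dim F < hausdorff_dim F \<and> hausdorff_dim F < box_dim F \<and> box_dim F < assouad_dim F) \<or>
     (lower_dim F = hausdorff_dim F \<and> hausdorff_dim F = box_dim F \<and> box_dim F = assouad_dim F))"

lemma (in carpet) carpet_dims_dichotomy:
  assumes "a \<in> I" "height a < base a"
  shows "dims_dichotomy F"
proof -
  obtain s1 \<beta> t where "carpet_exponents I F s1 \<beta> t" using exponents_exist by blast
  then interpret carpet_exponents I F s1 \<beta> t .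
  show ?thesis unfolding dims_dichotomy_def box_dim_F(2) using box_dim_F(1) carpet_dichotomy[OF assms] by blast
qed

section \<open>From the two classes to the conditions of \<open>carpet\<close>\<close>

lemma subdivision_less:
  assumes "subdivision m x" "i < j" "j \<le> m"
  shows "x i < x j"
  using assms(2,3)
proof (induction j)
  case (Suc j)
  have "x j < x (Suc j)" using assms(1) Suc.prems by (simp add: subdivision_def)
  moreover have "i = j \<or> x i < x j" using Suc by (auto simp: less_Suc_eq)
  ultimately show ?case by auto
qed simp

lemma subdivision_le: "subdivision m x \<Longrightarrow> i \<le> j \<Longrightarrow> j \<le> m \<Longrightarrow> x i \<le> x j"
  using subdivision_less[of m x i j] by (cases "i = j") auto

lemma subdivision_bounds:
  assumes "subdivision m x" "j < m"
  shows "0 \<le> x j" "x j < x (Suc j)" "x (Suc j) \<le> 1"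
  using assms subdivision_le[of m x 0 j] subdivision_le[of m x "Suc j" m] by (auto simp: subdivision_def)

lemma subdivision_length_less_1:
  assumes "subdivision m x" "2 \<le> m" "j < m"
  shows "x (Suc j) - x j < 1"
proof (cases j)
  case 0
  have "x (Suc j) < x m" using 0 assms by (intro subdivision_less) auto
  then show ?thesis using 0 assms(1) by (simp add: subdivision_def)
next
  case (Suc i)
  have "x 0 < x j" using Suc assms by (intro subdivision_less) auto
  then show ?thesis using subdivision_bounds[OF assms(1,3)] assms(1) by (simp add: subdivision_def)
qed

lemma carpet_of_columns:
  assumes I: "finite I" "I \<noteq> {}" and m: "2 \<le> m" "subdivision m x" "\<forall>j<m. subdivision (n j) (y j)"
    and sub: "I \<subseteq> {Rect (x j) (y j k) (x (Suc j) - x j) (y j (Suc k) - y j k) | j k. j < m \<and> k < n j}"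
    and hor: "\<forall>q\<in>I. height q \<le> base q" and attr: "attractor I F"
  shows "carpet I F"
proof
  have ex: "\<exists>j k. j < m \<and> k < n j \<and> q = Rect (x j) (y j k) (x (Suc j) - x j) (y j (Suc k) - y j k)" if "q \<in> I" for q
    using sub that by blast
  have yb: "0 \<le> y j k" "y j k < y j (Suc k)" "y j (Suc k) \<le> 1" if "j < m" "k < n j" for j k
    using subdivision_bounds m(3) that by blast+
  fix q assume q: "q \<in> I"
  then obtain j k where jk: "j < m" "k < n j" "q = Rect (x j) (y j k) (x (Suc j) - x j) (y j (Suc k) - y j k)"
    using ex by blast
  show "0 < height q" "0 \<le> bottom q" "bottom q + height q \<le> 1" using yb[OF jk(1,2)] by (auto simp: jk(3))
  show "height q \<le> base q" using hor q by blast
  show "base q < 1" using subdivision_length_less_1[OF m(2,1) jk(1)] by (simp add: jk(3))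
  show "0 \<le> left q" "left q + base q \<le> 1" using subdivision_bounds[OF m(2) jk(1)] by (auto simp: jk(3))
  fix q' assume q': "q' \<in> I"
  then obtain j' k' where jk': "j' < m" "k' < n j'" "q' = Rect (x j') (y j' k') (x (Suc j') - x j') (y j' (Suc k') - y j' k')"
    using ex by blast
  show "left q + base q \<le> left q' \<or> left q' + base q' \<le> left q" if "col q \<noteq> col q'"
  proof -
    have "j < j' \<or> j' < j" using that by (cases "j = j'") (auto simp: col_def jk jk')
    then have "x (Suc j) \<le> x j' \<or> x (Suc j') \<le> x j"
      using jk(1) jk'(1) subdivision_le[OF m(2), of "Suc j" j'] subdivision_le[OF m(2), of "Suc j'" j] by auto
    then show ?thesis by (auto simp: jk jk')
  qed
  show "bottom q + height q \<le> bottom q' \<or> bottom q' + height q' \<le> bottom q" if "col q = col q'" "q \<noteq> q'"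
  proof -
    \<comment> \<open>Left ends increase strictly with the index, so rectangles with the same
      \<open>col\<close> have the same column index.\<close>
    have "x j = x j'" using that(1) by (simp add: col_def jk jk')
    then have j: "j' = j"
      using subdivision_less[OF m(2), of j j'] subdivision_less[OF m(2), of j' j] jk(1) jk'(1) by (metis less_irrefl less_imp_le nat_neq_iff)
    have "k < k' \<or> k' < k" using that(2) by (cases "k = k'") (auto simp: jk jk' j)
    moreover have sy: "subdivision (n j) (y j)" using m(3) jk(1) by blast
    ultimately have "y j (Suc k) \<le> y j k' \<or> y j (Suc k') \<le> y j k"
      using jk(2) jk'(2) subdivision_le[OF sy, of "Suc k" k'] subdivision_le[OF sy, of "Suc k'" k] unfolding j by auto
    then show ?thesis by (auto simp: jk jk' j)
  qed
qed (use I attr in auto)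

lemma carpet_horizontal:
  assumes "self_affine_carpet I F" "horizontal_type I"
  shows "carpet I F"
proof -
  have I: "finite I" "I \<noteq> {}" "attractor I F" using assms(1) by (auto simp: self_affine_carpet_def)
  have hor: "\<forall>q\<in>I. height q \<le> base q" using assms(2) by (simp add: horizontal_type_def)
  from assms(1) consider "extended_lalley_gatzouras I" | "baranski I" by (auto simp: self_affine_carpet_def)
  then show ?thesis
  proof cases
    case 1
    then obtain m x n y where "2 \<le> m" "subdivision m x" "\<forall>j<m. subdivision (n j) (y j)"
      "I \<subseteq> {Rect (x j) (y j k) (x (Suc j) - x j) (y j (Suc k) - y j k) | j k. j < m \<and> k < n j}"
      unfolding extended_lalley_gatzouras_def by blast
    then show ?thesis by (rule carpet_of_columns[OF I(1,2) _ _ _ _ hor I(3)])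
  next
    case 2
    then obtain m x n y where "2 \<le> m" "subdivision m x" "subdivision n y"
      "I \<subseteq> {Rect (x j) (y k) (x (Suc j) - x j) (y (Suc k) - y k) | j k. j < m \<and> k < n}"
      unfolding baranski_def by blast
    \<comment> \<open>A grid is the special case in which all columns are sliced at the same
      heights.\<close>
    then show ?thesis
      by (intro carpet_of_columns[of I m x "\<lambda>_. n" "\<lambda>_. y"] I hor) auto
  qed
qed

lemma horizontal_dims_dichotomy:
  assumes "self_affine_carpet I F" "horizontal_type I"
  shows "dims_dichotomy F"
proof -
  obtain a where a: "a \<in> I" "base a \<noteq> height a" using assms(1) by (auto simp: self_affine_carpet_def)
  with assms(2) have "height a < base a" by (force simp: horizontal_type_def)
  with carpet.carpet_dims_dichotomy[OF carpet_horizontal[OF assms] a(1)] show ?thesis .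
qed

section \<open>Invariance of the dimensions under exchange of coordinates\<close>

abbreviation swap_set :: "(real \<times> real) set \<Rightarrow> (real \<times> real) set" where
  "swap_set E \<equiv> prod.swap ` E"

definition swap_rect :: "rect \<Rightarrow> rect" where
  "swap_rect q = Rect (bottom q) (left q) (height q) (base q)"

lemma swap_rect_simps [simp]:
  "left (swap_rect q) = bottom q" "bottom (swap_rect q) = left q"
  "base (swap_rect q) = height q" "height (swap_rect q) = base q"
  by (auto simp: swap_rect_def)

lemma swap_swap_set: "swap_set (swap_set E) = E"
  by (simp add: image_image)

lemma mem_swap_set: "p \<in> swap_set U \<longleftrightarrow> prod.swap p \<in> U"
  by (metis image_iff swap_swap)

lemma dist_swap: "dist (prod.swap x) (prod.swap y) = dist x (y :: real \<times> real)"
  by (cases x; cases y) (simp add: dist_Pair_Pair add.commute)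

lemma diameter_swap_set: "diameter (swap_set U) = diameter U"
proof -
  have "swap_set U \<times> swap_set U = (\<lambda>(x, y). (prod.swap x, prod.swap y)) ` (U \<times> U)"
    by (rule image_paired_Times[symmetric])
  then have "(\<lambda>(x, y). dist x y) ` (swap_set U \<times> swap_set U) = (\<lambda>(x, y). dist x y) ` (U \<times> U)"
    by (simp add: image_image case_prod_beta dist_swap)
  then show ?thesis by (simp add: diameter_def)
qed

lemma open_swap_set: "open U \<Longrightarrow> open (swap_set U)"
proof -
  assume U: "open U"
  have "swap_set U = prod.swap -` U" using mem_swap_set by blast
  moreover have "open (prod.swap -` U)"
    by (rule open_vimage[OF U]) (simp add: prod.swap_def continuous_on_Pair continuous_on_fst continuous_on_snd)
  ultimately show ?thesis by simp
qed

lemma bounded_swap_set: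
  assumes "bounded U" shows "bounded (swap_set U)"
proof -
  obtain x e where "\<And>y. y \<in> U \<Longrightarrow> dist x y \<le> e" using assms by (auto simp: bounded_def)
  then have "dist (prod.swap x) y \<le> e" if "y \<in> swap_set U" for y
    using that dist_swap[of x "prod.swap y"] by (simp add: mem_swap_set)
  then show ?thesis unfolding bounded_def by blast
qed

text \<open>The exchange is an isometry and maps covers to covers. It is also an involution, so one
  inclusion, applied to \<open>E\<close> and to its image, gives both.\<close>

lemma covering_number_swap_set: "covering_number r (swap_set E) = covering_number r E"
proof -
  let ?S = "\<lambda>E. {card \<U> | \<U>. finite \<U> \<and> E \<subseteq> \<Union>\<U> \<and> (\<forall>U\<in>\<U>. open U \<and> bounded U \<and> diameter U \<le> r)}"
  have sub: "?S E \<subseteq> ?S (swap_set E)" for E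
  proof
    fix k assume "k \<in> ?S E"
    then obtain \<U> where U: "k = card \<U>" "finite \<U>" "E \<subseteq> \<Union>\<U>" "\<forall>U\<in>\<U>. open U \<and> bounded U \<and> diameter U \<le> r" by blast
    have inj: "inj_on swap_set \<U>" by (rule inj_onI) (metis swap_swap_set)
    have "k = card (swap_set ` \<U>)" using card_image[OF inj] U(1) by simp
    moreover have "swap_set E \<subseteq> \<Union>(swap_set ` \<U>)" using U(3) by blast
    moreover have "finite (swap_set ` \<U>)" using U(2) by simp
    moreover have "\<forall>V\<in>swap_set ` \<U>. open V \<and> bounded V \<and> diameter V \<le> r"
      using U(4) open_swap_set bounded_swap_set by (simp add: diameter_swap_set)
    ultimately show "k \<in> ?S (swap_set E)" by blast
  qed
  have "?S (swap_set E) = ?S E" using sub[of E] sub[of "swap_set E"] unfolding swap_swap_set by (rule equalityI[rotated])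
  then show ?thesis by (simp add: covering_number_def)
qed

lemma covering_number_cball_swap_set:
  "covering_number r (cball (prod.swap x) R \<inter> swap_set F) = covering_number r (cball x R \<inter> F)"
proof -
  have "cball (prod.swap x) R \<inter> swap_set F = swap_set (cball x R \<inter> F)"
    using dist_swap[of x] by (intro set_eqI) (simp only: Int_iff mem_swap_set mem_cball, metis swap_swap)
  then show ?thesis by (simp only: covering_number_swap_set)
qed

lemma assouad_dim_swap_set: "assouad_dim (swap_set F) = assouad_dim F"
  by (simp add: assouad_dim_def image_image covering_number_cball_swap_set)

lemma lower_dim_swap_set: "lower_dim (swap_set F) = lower_dim F"
  by (simp add: lower_dim_def image_image covering_number_cball_swap_set)

lemma hausdorff_pre_measure_swap_set_le: "hausdorff_pre_measure s \<delta> (swap_set E) \<le> hausdorff_pre_measure s \<delta> E"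
  unfolding hausdorff_pre_measure_def
proof (rule INF_greatest)
  fix U :: "nat \<Rightarrow> (real \<times> real) set"
  assume U: "U \<in> {U. E \<subseteq> (\<Union>i. U i) \<and> (\<forall>i. bounded (U i) \<and> diameter (U i) \<le> \<delta>)}"
  then have "swap_set E \<subseteq> (\<Union>i. swap_set (U i))" by blast
  then show "(INF U\<in>{U :: nat \<Rightarrow> (real \<times> real) set. swap_set E \<subseteq> (\<Union>i. U i) \<and> (\<forall>i. bounded (U i) \<and> diameter (U i) \<le> \<delta>)}.
      \<Sum>i. ennreal (diameter (U i) powr s)) \<le> (\<Sum>i. ennreal (diameter (U i) powr s))"
    using U by (intro INF_lower2[of "\<lambda>i. swap_set (U i)"]) (auto simp: bounded_swap_set diameter_swap_set)
qed

lemma hausdorff_dim_swap_set: "hausdorff_dim (swap_set E) = hausdorff_dim E"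
proof -
  have "hausdorff_pre_measure s \<delta> (swap_set E) = hausdorff_pre_measure s \<delta> E" for s \<delta>
    using hausdorff_pre_measure_swap_set_le[of s \<delta> E] hausdorff_pre_measure_swap_set_le[of s \<delta> "swap_set E"]
    unfolding swap_swap_set by (rule antisym)
  then show ?thesis by (simp add: hausdorff_dim_def hausdorff_measure_def)
qed

lemma dims_dichotomy_swap_set: "dims_dichotomy (swap_set F) = dims_dichotomy F"
  by (simp add: dims_dichotomy_def box_dim_exists_def box_dim_def covering_number_swap_set
      assouad_dim_swap_set lower_dim_swap_set hausdorff_dim_swap_set)

lemma attractor_swap:
  assumes "attractor I F"
  shows "attractor (swap_rect ` I) (swap_set F)"
proof -
  have F: "F \<noteq> {}" "compact F" "F = (\<Union>q\<in>I. rect_map q ` F)" using assms by (simp_all add: attractor_def)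
  have sw: "rect_map (swap_rect q) (prod.swap z) = prod.swap (rect_map q z)" for q z
    by (cases z) (simp add: rect_map_def)
  have "compact (swap_set F)"
    by (intro compact_continuous_image F) (simp add: prod.swap_def continuous_on_Pair continuous_on_fst continuous_on_snd)
  moreover have "swap_set F = (\<Union>q\<in>swap_rect ` I. rect_map q ` swap_set F)"
  proof -
    have "(\<Union>q\<in>swap_rect ` I. rect_map q ` swap_set F) = (\<Union>q\<in>I. swap_set (rect_map q ` F))"
      by (simp add: image_image sw)
    also have "\<dots> = swap_set (\<Union>q\<in>I. rect_map q ` F)" by blast
    also have "\<dots> = swap_set F" by (simp only: F(3)[symmetric])
    finally show ?thesis by (rule sym)
  qed
  ultimately show ?thesis unfolding attractor_def using F(1) by blast
qed

lemma baranski_swap: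
  assumes "baranski I"
  shows "baranski (swap_rect ` I)"
proof -
  obtain m x n y where "2 \<le> m" "subdivision m x" "2 \<le> n" "subdivision n y"
    and I: "I \<subseteq> {Rect (x j) (y k) (x (Suc j) - x j) (y (Suc k) - y k) | j k. j < m \<and> k < n}"
    using assms unfolding baranski_def by blast
  moreover have "swap_rect ` I \<subseteq> {Rect (y j) (x k) (y (Suc j) - y j) (x (Suc k) - x k) | j k. j < n \<and> k < m}"
  proof
    fix q' assume "q' \<in> swap_rect ` I"
    then obtain q where q: "q \<in> I" "q' = swap_rect q" by blast
    then obtain j k where "j < m" "k < n" "q = Rect (x j) (y k) (x (Suc j) - x j) (y (Suc k) - y k)"
      using I by blast
    then show "q' \<in> {Rect (y j) (x k) (y (Suc j) - y j) (x (Suc k) - x k) | j k. j < n \<and> k < m}"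
      by (auto simp: q(2) swap_rect_def)
  qed
  ultimately show ?thesis unfolding baranski_def by blast
qed

theorem corollary2p14:
  fixes I :: "rect set" and F :: "(real \<times> real) set"
  assumes "self_affine_carpet I F"
    and "horizontal_type I \<or> vertical_type I"
  shows "box_dim_exists F \<and>
    ((lower_dim F < hausdorff_dim F \<and> hausdorff_dim F < box_dim F \<and> box_dim F < assouad_dim F) \<or>
     (lower_dim F = hausdorff_dim F \<and> hausdorff_dim F = box_dim F \<and> box_dim F = assouad_dim F))"
proof -
  have "dims_dichotomy F"
  proof (cases "horizontal_type I")
    case True
    with assms(1) show ?thesis by (rule horizontal_dims_dichotomy)
  next
    case False
    then have vert: "vertical_type I" using assms(2) by blast
    \<comment> \<open>The extended Lalley-Gatzouras class requires base at least height, so it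
      contains only systems of horizontal type.\<close>
    have "baranski I" using assms(1) False by (auto simp: self_affine_carpet_def extended_lalley_gatzouras_def horizontal_type_def)
    moreover have "inj swap_rect" by (rule injI) (auto simp: swap_rect_def rect.expand)
    moreover have "\<exists>q\<in>swap_rect ` I. base q \<noteq> height q"
      using assms(1) by (force simp: self_affine_carpet_def)
    ultimately have "self_affine_carpet (swap_rect ` I) (swap_set F)"
      using assms(1) baranski_swap attractor_swap
      unfolding self_affine_carpet_def by (simp add: card_image inj_on_subset)
    moreover have "horizontal_type (swap_rect ` I)" using vert by (auto simp: horizontal_type_def vertical_type_def)
    ultimately have "dims_dichotomy (swap_set F)" by (rule horizontal_dims_dichotomy)
    then show ?thesis by (simp only: dims_dichotomy_swap_set)
  qed
  then show ?thesis by (simp only: dims_dichotomy_def)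
qed

end
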